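(* For each finite Borel measure $\mu$ in $\mathbb{C}$ the logarithmic potential $$u(z)=\int_{\mathbb{C}}\log\frac{1}{|z-w|}\,d\mu(w),\quad z\in\mathbb{C},$$ is differentiable in the weak capacity sense at $H^\varphi$ almost all points; that is, the set of points at which $u$ is not differentiable in the weak capacity sense has zero $H^\varphi$ measure.
   Context: $B(a,r)$ is the disc of center $a$ and radius $r$; $\mathbb{C}$ is identified with $\mathbb{R}^2$. The measure $\mu$ is not assumed to be positive. $\varphi$ is the measure function $\varphi(0)=0$, $\varphi(t)=t\,\frac{1}{\log(1/t)}$ for $0<t\le e^{-1}$, $\varphi(t)=t$ for $t\ge e^{-1}$, and $H^\varphi$ is the associated Hausdorff measure, $H^\varphi(E)=\lim_{\delta\to0}\inf\{\sum_i\varphi(\operatorname{diam}E_i):E\subset\bigcup_iE_i,\ \operatorname{diam}E_i\le\delta\}$ (countable coverings). Wiener capacity: when dealing with capacity in the plane, all sets are tacitly assumed to be contained in the disc centered at the origin of radius $1/2$ (the definition is translation invariant, and for sets near another point one uses a translated disc). For a compact set $E$ in this disc, $\operatorname{Cap}(E)=\sup\nu(E)$, the supremum being over all positive finite Borel measures $\nu$ supported on $E$ with $\int\log\frac{1}{|z-w|}\,d\nu(w)\le1$ for all $z\in\mathbb{C}$. For a non-compact Borel set in this disc, $\operatorname{Cap}$ is the supremum of the capacities of its compact subsets. One has $\operatorname{Cap}(B(a,r))=1/\log(1/r)$ for $|a|<1/4$, $0<r<1/4$. Differentiability in the weak capacity sense: a real function $u$ is differentiable in the weak capacity sense at $a\in\mathbb{R}^2$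 if there exist real numbers $A_1,A_2$ such that $$\lim_{r\to0}\frac{\sup_{t>0}t\,\operatorname{Cap}(\{x\in B(a,r):|u(x)-u(a)-\sum_{i=1}^2A_i(x_i-a_i)|>t\})}{r\,\operatorname{Cap}(B(a,r))}=0.$$ *)

theory Defs
  imports "HOL-Analysis.Analysis"
begin

section \<open>Finite signed Borel measures\<close>

text \<open>
  A finite signed Borel measure is a real-valued countably additive function on the Borel sets;
  its values on other sets are irrelevant. Finiteness of the total variation is automatic, since
  the values are real numbers.
\<close>

definition finite_signed_borel_measure :: "('a::topological_space set \<Rightarrow> real) \<Rightarrow> bool" where
  "finite_signed_borel_measure \<mu> \<longleftrightarrow>
     \<mu> {} = 0 \<and>
     (\<forall>A :: nat \<Rightarrow> 'a set. range A \<subseteq> sets borel \<longrightarrow> disjoint_family A \<longrightarrow>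
        (\<lambda>n. \<mu> (A n)) sums \<mu> (\<Union>n. A n))"

text \<open>
  The positive variation $\mu^+(A) = \sup \{\mu(B) : B \subseteq A\}$. Negative values of \<open>\<mu> B\<close> are
  truncated to \<open>0\<close> by \<^const>\<open>ennreal\<close>, which is harmless because \<open>B = {}\<close> is admissible.
\<close>

definition pos_variation :: "('a::topological_space set \<Rightarrow> real) \<Rightarrow> 'a measure" where
  "pos_variation \<mu> =
     measure_of UNIV (sets borel) (\<lambda>A. SUP B\<in>{B \<in> sets borel. B \<subseteq> A}. ennreal (\<mu> B))"

definition neg_variation :: "('a::topological_space set \<Rightarrow> real) \<Rightarrow> 'a measure" where
  "neg_variation \<mu> = pos_variation (\<lambda>B. - \<mu> B)"

lemma sets_pos_variation [simp]: "sets (pos_variation \<mu>) = sets borel"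
  and space_pos_variation [simp]: "space (pos_variation \<mu>) = UNIV"
  and sets_neg_variation [simp]: "sets (neg_variation \<mu>) = sets borel"
  and space_neg_variation [simp]: "space (neg_variation \<mu>) = UNIV"
  using sets.sigma_sets_eq[of borel]
  by (auto simp: pos_variation_def neg_variation_def space_borel)

lemma finite_signed_borel_measure_uminus:
  "finite_signed_borel_measure \<mu> \<Longrightarrow> finite_signed_borel_measure (\<lambda>B. - \<mu> B)"
  by (auto simp: finite_signed_borel_measure_def intro: sums_minus)

lemma finite_signed_borel_measure_Un:
  assumes \<mu>: "finite_signed_borel_measure \<mu>"
    and A: "A \<in> sets borel" and B: "B \<in> sets borel" and AB: "A \<inter> B = {}"
  shows "\<mu> (A \<union> B) = \<mu> A + \<mu> B"
proof -
  let ?F = "binaryset A B"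
  have "range ?F \<subseteq> sets borel" "disjoint_family ?F"
    using A B AB by (auto simp: range_binaryset_eq disjoint_family_on_def binaryset_def)
  then have "(\<lambda>n. \<mu> (?F n)) sums \<mu> (\<Union>n. ?F n)"
    using \<mu> by (auto simp: finite_signed_borel_measure_def)
  moreover have "(\<lambda>n. \<mu> (?F n)) sums (\<mu> A + \<mu> B)"
    using \<mu> by (intro binaryset_sums) (simp add: finite_signed_borel_measure_def)
  ultimately show ?thesis
    by (simp add: UN_binaryset_eq sums_unique2)
qed

text \<open>The set function passed to \<^const>\<open>measure_of\<close> is indeed a measure.\<close>

lemma emeasure_pos_variation:
  fixes \<mu> :: "'a::topological_space set \<Rightarrow> real"
  assumes \<mu>: "finite_signed_borel_measure \<mu>" and A: "A \<in> sets borel"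
  shows "emeasure (pos_variation \<mu>) A = (SUP B\<in>{B \<in> sets borel. B \<subseteq> A}. ennreal (\<mu> B))"
proof -
  define V where "V = (\<lambda>A. SUP B\<in>{B \<in> sets borel. B \<subseteq> A}. ennreal (\<mu> B))"
  have \<mu>0: "\<mu> {} = 0"
    using \<mu> by (simp add: finite_signed_borel_measure_def)
  have V_upper: "ennreal (\<mu> B) \<le> V A" if "B \<in> sets borel" "B \<subseteq> A" for A B
    unfolding V_def using that by (intro SUP_upper) auto
  have V_mono: "V A \<le> V B" if "A \<subseteq> B" for A B
    unfolding V_def using that by (intro SUP_subset_mono) auto
  have V_super: "V A + V B \<le> V (A \<union> B)" if AB: "A \<inter> B = {}" for A B
  proof -
    have le: "ennreal (\<mu> C) + ennreal (\<mu> D) \<le> V (A \<union> B)"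
      if C: "C \<in> sets borel" "C \<subseteq> A" and D: "D \<in> sets borel" "D \<subseteq> B" for C D
    proof -
      consider "\<mu> C < 0" | "\<mu> D < 0" | "0 \<le> \<mu> C" "0 \<le> \<mu> D" by linarith
      then show ?thesis
      proof cases
        case 1
        then show ?thesis using V_upper[of D "A \<union> B"] D by (auto simp: ennreal_neg)
      next
        case 2
        then show ?thesis using V_upper[of C "A \<union> B"] C by (auto simp: ennreal_neg)
      next
        case 3
        have "\<mu> (C \<union> D) = \<mu> C + \<mu> D"
          using C D AB by (intro finite_signed_borel_measure_Un[OF \<mu>]) auto
        then show ?thesis
          using V_upper[of "C \<union> D" "A \<union> B"] C D 3 by (auto simp: ennreal_plus)
      qed
    qed
    have "V A + V B = (SUP C\<in>{C \<in> sets borel. C \<subseteq> A}. ennreal (\<mu> C) + V B)"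
      unfolding V_def by (rule ennreal_SUP_add_left[symmetric]) auto
    also have "\<dots> \<le> V (A \<union> B)"
    proof (rule SUP_least)
      fix C assume C: "C \<in> {C \<in> sets borel. C \<subseteq> A}"
      have "ennreal (\<mu> C) + V B = (SUP D\<in>{D \<in> sets borel. D \<subseteq> B}. ennreal (\<mu> C) + ennreal (\<mu> D))"
        unfolding V_def by (rule ennreal_SUP_add_right) auto
      also have "\<dots> \<le> V (A \<union> B)"
        using C le by (intro SUP_least) auto
      finally show "ennreal (\<mu> C) + V B \<le> V (A \<union> B)" .
    qed
    finally show ?thesis .
  qed
  have V0: "V {} = 0"
    using \<mu>0 by (simp add: V_def cong: conj_cong)
  have "countably_additive (sets borel) V"
    unfolding countably_additive_def
  proof (intro allI impI antisym)
    fix F :: "nat \<Rightarrow> 'a set"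
    assume F: "range F \<subseteq> sets borel" "disjoint_family F"
    have fin: "(\<Sum>i<n. V (F i)) \<le> V (\<Union>i<n. F i)" for n
    proof (induction n)
      case (Suc n)
      have "(\<Union>i<n. F i) \<inter> F n = {}"
        using F(2) unfolding disjoint_family_on_def by (blast dest: less_imp_neq)
      from V_super[OF this] Suc show ?case
        by (auto simp: lessThan_Suc Un_commute add.commute intro: order_trans[OF add_mono])
    qed (simp add: V0)
    show "(\<Sum>i. V (F i)) \<le> V (\<Union>i. F i)"
      by (rule suminf_le_const) (auto intro!: order_trans[OF fin] V_mono)
    show "V (\<Union>i. F i) \<le> (\<Sum>i. V (F i))"
    proof (subst V_def, rule SUP_least)
      fix B assume B: "B \<in> {B \<in> sets borel. B \<subseteq> (\<Union>i. F i)}"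
      have "range (\<lambda>i. B \<inter> F i) \<subseteq> sets borel" "disjoint_family (\<lambda>i. B \<inter> F i)"
        using B F by (auto simp: disjoint_family_on_def)
      then have "(\<lambda>i. \<mu> (B \<inter> F i)) sums \<mu> (\<Union>i. B \<inter> F i)"
        using \<mu> unfolding finite_signed_borel_measure_def by blast
      also have "(\<Union>i. B \<inter> F i) = B" using B by auto
      finally have "(\<lambda>n. ennreal (\<Sum>i<n. \<mu> (B \<inter> F i))) \<longlonglongrightarrow> ennreal (\<mu> B)"
        by (auto simp: sums_def intro: tendsto_ennrealI)
      moreover have "ennreal (\<Sum>i<n. \<mu> (B \<inter> F i)) \<le> (\<Sum>i. V (F i))" for n
      proof -
        have "ennreal (\<Sum>i<n. \<mu> (B \<inter> F i)) \<le> (\<Sum>i<n. ennreal (\<mu> (B \<inter> F i)))"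
        proof -
          have "ennreal (\<Sum>i<n. \<mu> (B \<inter> F i)) \<le> ennreal (\<Sum>i<n. max 0 (\<mu> (B \<inter> F i)))"
            by (intro ennreal_leI sum_mono) auto
          also have "\<dots> = (\<Sum>i<n. ennreal (max 0 (\<mu> (B \<inter> F i))))"
            by (rule sum_ennreal[symmetric]) auto
          also have "\<dots> = (\<Sum>i<n. ennreal (\<mu> (B \<inter> F i)))"
            by (intro sum.cong) (auto simp: max_def ennreal_neg)
          finally show ?thesis .
        qed
        also have "\<dots> \<le> (\<Sum>i<n. V (F i))"
          using B F by (intro sum_mono V_upper) auto
        also have "\<dots> \<le> (\<Sum>i. V (F i))"
          by (rule sum_le_suminf) auto
        finally show ?thesis .
      qed
      ultimately show "ennreal (\<mu> B) \<le> (\<Sum>i. V (F i))"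
        by (intro LIMSEQ_le_const2) auto
    qed
  qed
  then have "countably_additive (sets (pos_variation \<mu>)) V"
    by simp
  moreover have "pos_variation \<mu> = measure_of UNIV (sets borel) V"
    unfolding pos_variation_def V_def ..
  ultimately have "emeasure (pos_variation \<mu>) A = V A"
    using A V0 by (rule_tac emeasure_measure_of) (simp_all only: positive_def sets_pos_variation, simp_all)
  then show ?thesis unfolding V_def .
qed


section \<open>The logarithmic potential\<close>

text \<open>
  Absolute convergence of $\int \log (1/|z-w|)\, d\nu(w)$ for a positive measure \<open>\<nu>\<close>. In HOL
  \<open>ln (1 / 0) = 0\<close>, whereas the kernel is $+\infty$ at $w = z$; hence the separate requirement
  that \<open>z\<close> is not an atom.
\<close>

definition log_integrable :: "complex measure \<Rightarrow> complex \<Rightarrow> bool" where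
  "log_integrable \<nu> z \<longleftrightarrow>
     emeasure \<nu> {z} = 0 \<and> integrable \<nu> (\<lambda>w. ln (1 / cmod (z - w)))"

definition log_potential_converges :: "(complex set \<Rightarrow> real) \<Rightarrow> complex \<Rightarrow> bool" where
  "log_potential_converges \<mu> z \<longleftrightarrow>
     log_integrable (pos_variation \<mu>) z \<and> log_integrable (neg_variation \<mu>) z"

text \<open>Points where the integral does not converge absolutely get the dummy value \<open>0\<close>.\<close>

definition log_potential :: "(complex set \<Rightarrow> real) \<Rightarrow> complex \<Rightarrow> real" where
  "log_potential \<mu> z =
     (if log_potential_converges \<mu> z
      then (LINT w|pos_variation \<mu>. ln (1 / cmod (z - w)))
         - (LINT w|neg_variation \<mu>. ln (1 / cmod (z - w)))
      else 0)"


section \<open>Wiener capacity\<close>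

text \<open>
  A positive finite Borel measure on the compact set \<open>K\<close> whose potential is at most \<open>1\<close> everywhere.
  The negative part of the kernel is bounded on \<open>K\<close>, so an extended-real valued potential bounded
  by \<open>1\<close> converges absolutely.
\<close>

definition cap_admissible :: "complex set \<Rightarrow> complex measure \<Rightarrow> bool" where
  "cap_admissible K \<nu> \<longleftrightarrow>
     sets \<nu> = sets borel \<and> finite_measure \<nu> \<and> emeasure \<nu> (- K) = 0 \<and>
     (\<forall>z. log_integrable \<nu> z \<and> (LINT w|\<nu>. ln (1 / cmod (z - w))) \<le> 1)"

definition wiener_cap_compact :: "complex set \<Rightarrow> ennreal" where
  "wiener_cap_compact K = (SUP \<nu>\<in>{\<nu>. cap_admissible K \<nu>}. emeasure \<nu> UNIV)"

text \<open>
  Meaningful for sets contained in some disc of radius \<open>1/2\<close>, with arbitrary center since the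
  definition is translation invariant.
\<close>

definition wiener_cap :: "complex set \<Rightarrow> ennreal" where
  "wiener_cap E = (SUP K\<in>{K. compact K \<and> K \<subseteq> E}. wiener_cap_compact K)"

lemma wiener_cap_compact_mono:
  assumes "compact K" "compact L" "K \<subseteq> L"
  shows "wiener_cap_compact K \<le> wiener_cap_compact L"
  unfolding wiener_cap_compact_def
proof (rule SUP_subset_mono)
  show "{\<nu>. cap_admissible K \<nu>} \<subseteq> {\<nu>. cap_admissible L \<nu>}"
  proof safe
    fix \<nu> assume \<nu>: "cap_admissible K \<nu>"
    then have "emeasure \<nu> (- L) \<le> emeasure \<nu> (- K)"
      using assms by (intro emeasure_mono) (auto simp: cap_admissible_def intro!: borel_open dest: compact_imp_closed)
    with \<nu> show "cap_admissible L \<nu>" by (auto simp: cap_admissible_def)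
  qed
qed simp

lemma wiener_cap_eq_compact: "compact K \<Longrightarrow> wiener_cap K = wiener_cap_compact K"
  unfolding wiener_cap_def
  by (intro antisym SUP_least SUP_upper) (auto intro: wiener_cap_compact_mono)


section \<open>Differentiability in the weak capacity sense\<close>

definition weak_cap_differentiable :: "(complex \<Rightarrow> real) \<Rightarrow> complex \<Rightarrow> bool" where
  "weak_cap_differentiable u a \<longleftrightarrow>
     (\<exists>A1 A2 :: real.
        ((\<lambda>r. (SUP t\<in>{0<..}. ennreal t *
                 wiener_cap {x \<in> ball a r.
                   \<bar>u x - u a - (A1 * (Re x - Re a) + A2 * (Im x - Im a))\<bar> > t})
              / (ennreal r * wiener_cap (ball a r))) \<longlongrightarrow> 0) (at_right 0))"


section \<open>Hausdorff measures\<close>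

definition phi :: "real \<Rightarrow> real" where
  "phi t = (if t \<le> 0 then 0 else if t \<le> exp (-1) then t * (1 / ln (1 / t)) else t)"

text \<open>
  Finite coverings are covered by \<open>F i = {}\<close>, of diameter \<open>0\<close>. Boundedness is explicit because
  \<^const>\<open>diameter\<close> is unspecified on unbounded sets.
\<close>

definition hausdorff_content ::
    "(real \<Rightarrow> real) \<Rightarrow> real \<Rightarrow> 'a::metric_space set \<Rightarrow> ennreal" where
  "hausdorff_content h \<delta> E =
     (INF F\<in>{F :: nat \<Rightarrow> 'a set. E \<subseteq> (\<Union>i. F i) \<and> (\<forall>i. bounded (F i) \<and> diameter (F i) \<le> \<delta>)}.
        \<Sum>i. ennreal (h (diameter (F i))))"

text \<open>The supremum is the limit as \<open>\<delta> \<rightarrow> 0\<close>; see the lemma below.\<close>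

definition hausdorff_measure :: "(real \<Rightarrow> real) \<Rightarrow> 'a::metric_space set \<Rightarrow> ennreal" where
  "hausdorff_measure h E = (SUP \<delta>\<in>{0<..}. hausdorff_content h \<delta> E)"

lemma hausdorff_content_antimono:
  "\<delta> \<le> \<epsilon> \<Longrightarrow> hausdorff_content h \<epsilon> E \<le> hausdorff_content h \<delta> E"
  unfolding hausdorff_content_def by (intro INF_superset_mono) (auto intro: order_trans)

lemma tendsto_hausdorff_content:
  "((\<lambda>\<delta>. hausdorff_content h \<delta> E) \<longlongrightarrow> hausdorff_measure h E) (at_right 0)"
proof (rule order_tendstoI)
  fix y assume "y < hausdorff_measure h E"
  then obtain \<delta> where "\<delta> > 0" "y < hausdorff_content h \<delta> E"
    by (auto simp: hausdorff_measure_def less_SUP_iff)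
  then show "\<forall>\<^sub>F \<epsilon> in at_right 0. y < hausdorff_content h \<epsilon> E"
    unfolding eventually_at_right_field
    by (intro exI[of _ \<delta>]) (auto intro: less_le_trans hausdorff_content_antimono less_imp_le)
next
  fix y assume y: "hausdorff_measure h E < y"
  have "hausdorff_content h \<epsilon> E < y" if "\<epsilon> > 0" for \<epsilon>
  proof -
    have "hausdorff_content h \<epsilon> E \<le> hausdorff_measure h E"
      unfolding hausdorff_measure_def using that by (intro SUP_upper) simp
    then show ?thesis using y by (rule le_less_trans)
  qed
  then show "\<forall>\<^sub>F \<epsilon> in at_right 0. hausdorff_content h \<epsilon> E < y"
    unfolding eventually_at_right_field by (auto intro: exI[of _ 1])
qed

end

theory Submission
  imports Defs
begin

text \<open>
  The potential is linear in the measure, so the positive and the negative variation are treated separately;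
  let \<open>M\<close> be a finite positive measure. The gradient of its potential ought to be given by the principal
  value of the Cauchy integral of \<open>M\<close>, and the theorem says that this is right, up to sets of small capacity, at
  almost every point. Three facts are needed, each outside a null set of \<open>H\<^sup>\<phi>\<close>.

  First, Vitali's covering lemma shows that \<open>M\<close> grows at most like \<open>N * phi r\<close> around almost every point, for some \<open>N\<close>
  depending on the point. For fixed \<open>N\<close> these points form a closed set \<open>E\<close>, and at almost all of them the mass off
  \<open>E\<close> is \<open>o(phi r)\<close> (\<open>growth_sets_exhaust\<close>, \<open>density_outside_closed\<close>).

  Second, the principal value of the Cauchy integral exists at almost every point of \<open>E\<close>
  (\<open>principal_values_exist\<close>); this is the heart of the matter. The kernel \<open>1 / (x - y)\<close> is too singular for absolute
  convergence, since the densities \<open>phi r / r\<close> at the dyadic scales \<open>r = 2\<^sup>-\<^sup>k\<close> are of order \<open>1 / k\<close>. But the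
  \<open>L\<^sup>2\<close> norm of a truncated Cauchy integral with respect to the same measure is a triple integral which,
  symmetrized over the three variables, becomes an integral of squared Menger curvature; it is bounded by the sum of the
  \<^emph>\<open>squares\<close> of the densities (\<open>trunc_cauchy_L2\<close>). Applying this to the sum of the given measure and a discrete Frostman measure
  on the set where its Cauchy integral is large bounds the content of that set (\<open>trunc_cauchy_content\<close>), and a
  Borel-Cantelli argument along a sparse sequence of scales gives convergence; between the scales the trivial estimate is enough.
  All this needs growth around every point, not only on \<open>E\<close>. So the part of \<open>M\<close> off \<open>E\<close> is first
  smeared out over regions of size comparable to the distance from \<open>E\<close>. As \<open>1 / (a - w)\<close> is holomorphic in \<open>w\<close>, the mean value
  property shows that the Cauchy integral at the points of \<open>E\<close> is hardly affected (\<open>smear_growth\<close>,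
  \<open>trunc_cauchy_smear_diff\<close>).

  Third, at a point \<open>a\<close> with these properties the error of the linear approximation in \<open>ball a r\<close> is \<open>o(r)\<close> plus
  the potential of the restriction \<open>\<tau>\<close> of \<open>M\<close> to \<open>ball a (2 * r)\<close> without \<open>E\<close> (\<open>log_expansion_at_good_point\<close>). The mass
  of \<open>\<tau>\<close> is \<open>o(phi r)\<close>, and the potential of \<open>\<tau>\<close> exceeds \<open>t\<close> only on a set of capacity at most the mass divided by \<open>t\<close>, by
  duality (\<open>cap_admissible_local_potential_le\<close>). Since the capacity of a disc of radius \<open>r\<close> is at least a multiple of
  \<open>1 / ln (1 / r)\<close>, its product with \<open>r\<close> dominates \<open>phi r\<close>, which is exactly what weak differentiability in the capacity sense
  requires.
\<close>


section \<open>The gauge function\<close>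

text \<open>
  The density \<open>phi t / t\<close>. Everything below rests on two of its properties: it varies slowly
  (doubling the radius at most doubles it), and at radius \<open>2\<^sup>-\<^sup>k\<close> it is of order \<open>1 / k\<close>, so that
  its square is summable over dyadic scales although it is not itself summable.
\<close>

definition gauge_ratio :: "real \<Rightarrow> real" where
  "gauge_ratio t = (if t \<le> exp (-1) then 1 / ln (1 / t) else 1)"

lemma phi_eq_gauge_ratio: "0 < t \<Longrightarrow> phi t = t * gauge_ratio t"
  by (simp add: phi_def gauge_ratio_def)

lemma phi_0 [simp]: "phi 0 = 0"
  by (simp add: phi_def)

lemma one_le_ln_inverse_iff: "0 < t \<Longrightarrow> 1 \<le> ln (1 / t) \<longleftrightarrow> t \<le> exp (-1)" for t :: real
proof -
  assume t: "0 < t"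
  have "t \<le> exp (-1) \<longleftrightarrow> ln t \<le> -1"
    using t by (metis exp_le_cancel_iff exp_ln)
  then show ?thesis using t by (auto simp: ln_div)
qed

lemma gauge_ratio_pos: assumes "0 < t" shows "0 < gauge_ratio t"
proof (cases "t \<le> exp (-1)")
  case True
  then have "1 \<le> ln (1 / t)" using assms one_le_ln_inverse_iff by blast
  then have "0 < 1 / ln (1 / t)" by (intro divide_pos_pos) linarith+
  then show ?thesis using True by (simp only: gauge_ratio_def if_True)
qed (simp add: gauge_ratio_def)

lemma gauge_ratio_le_1: assumes "0 < t" shows "gauge_ratio t \<le> 1"
proof (cases "t \<le> exp (-1)")
  case True
  then have "1 \<le> ln (1 / t)" using assms one_le_ln_inverse_iff by blast
  then have "1 / ln (1 / t) \<le> 1 / 1" by (intro divide_left_mono) auto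
  then show ?thesis using True by (simp only: gauge_ratio_def if_True)
qed (simp add: gauge_ratio_def)

lemma gauge_ratio_mono:
  assumes "0 < s" "s \<le> t" shows "gauge_ratio s \<le> gauge_ratio t"
proof (cases "t \<le> exp (-1)")
  case True
  have "1 \<le> ln (1 / t)" "ln (1 / t) \<le> ln (1 / s)"
    using True assms one_le_ln_inverse_iff[of t] by (auto simp: ln_div)
  then have "1 / ln (1 / s) \<le> 1 / ln (1 / t)" by (intro divide_left_mono mult_pos_pos) linarith+
  then show ?thesis using True assms by (simp add: gauge_ratio_def)
next
  case False
  then show ?thesis using gauge_ratio_le_1[of s] assms by (auto simp: gauge_ratio_def)
qed

lemma gauge_ratio_double:
  assumes "0 < t" shows "gauge_ratio (2 * t) \<le> 2 * gauge_ratio t"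
proof -
  have ln2: "ln 2 \<le> (1::real)" using ln_2_less_1 by simp
  consider "t > exp (-1)" | "t \<le> exp (-1)" "ln (1/t) \<le> 2" | "ln (1/t) > 2" by linarith
  then show ?thesis
  proof cases
    case 1
    then show ?thesis using assms gauge_ratio_le_1[of "2*t"] by (simp add: gauge_ratio_def)
  next
    case 2
    have "1 \<le> ln (1 / t)" using assms 2 one_le_ln_inverse_iff by blast
    then have "1 / 2 \<le> 1 / ln (1 / t)" using 2 by (intro divide_left_mono mult_pos_pos) linarith+
    then have "1 / 2 \<le> gauge_ratio t"
      using 2 by (simp only: gauge_ratio_def if_True)
    then show ?thesis using gauge_ratio_le_1[of "2*t"] assms by linarith
  next
    case 3
    have l: "ln (1 / (2*t)) = ln (1/t) - ln 2"
      using assms by (simp add: ln_div ln_mult)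
    have t: "t \<le> exp (-1)" using one_le_ln_inverse_iff[OF assms] 3 by linarith
    have h: "ln (1 / (2*t)) \<ge> ln (1/t) / 2" using l ln2 3 by linarith
    have t2: "2 * t \<le> exp (-1)" using one_le_ln_inverse_iff[of "2*t"] assms 3 h by linarith
    have "1 / ln (1 / (2*t)) \<le> 1 / (ln (1/t) / 2)"
      using h 3 by (intro divide_left_mono mult_pos_pos) linarith+
    then show ?thesis using t t2 by (simp add: gauge_ratio_def)
  qed
qed

lemma phi_pos: "0 < t \<Longrightarrow> 0 < phi t"
  by (simp add: phi_eq_gauge_ratio gauge_ratio_pos)

lemma phi_nonneg [simp]: "0 \<le> phi t"
  using phi_pos[of t] by (cases "0 < t") (auto simp: phi_def)

lemma phi_mono: assumes "s \<le> t" shows "phi s \<le> phi t"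
proof (cases "0 < s")
  case True
  then show ?thesis using assms gauge_ratio_mono[OF True assms] gauge_ratio_pos[OF True]
    by (auto simp: phi_eq_gauge_ratio intro!: mult_mono)
next
  case False
  then have "phi s = 0" by (simp add: phi_def)
  then show ?thesis by simp
qed

lemma phi_double: "phi (2 * t) \<le> 4 * phi t"
proof (cases "0 < t")
  case True
  then show ?thesis using mult_left_mono[OF gauge_ratio_double[OF True], of "2*t"]
    by (simp add: phi_eq_gauge_ratio)
qed (simp add: phi_def)

lemma phi_dilate: "phi (2 ^ n * t) \<le> 4 ^ n * phi t"
proof (induction n)
  case (Suc n)
  have "phi (2 ^ Suc n * t) \<le> 4 * phi (2 ^ n * t)"
    using phi_double[of "2 ^ n * t"] by (simp add: mult.assoc)
  then show ?case using Suc by simp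
qed simp

lemma gauge_ratio_two_power:
  assumes "1 \<le> k" shows "gauge_ratio ((1/2) ^ k) \<le> 2 / real k"
proof (cases "(1/2::real) ^ k \<le> exp (-1)")
  case True
  have "ln (1 / (1/2::real) ^ k) = real k * ln 2"
    by (simp add: power_divide ln_realpow)
  moreover have "ln 2 \<ge> (1/2::real)" using ln_add_one_self_le_self2[of "-(1/2)"] by (simp add: ln_div)
  ultimately have "real k / 2 \<le> ln (1 / (1/2::real) ^ k)" using assms
    by (simp add: mult_left_mono[of "1/2" "ln 2" "real k", simplified])
  then show ?thesis using True assms
    by (simp add: gauge_ratio_def field_simps)
next
  case False
  have "k \<le> 2"
  proof (rule ccontr)
    assume "\<not> k \<le> 2"
    then have "(1/2::real) ^ k \<le> (1/2) ^ 3" by (intro power_decreasing) auto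
    moreover have "exp (1::real) \<le> 8"
      using exp_le by linarith
    ultimately show False using False by (simp add: exp_minus field_simps)
  qed
  then show ?thesis using False assms by (simp add: gauge_ratio_def field_simps)
qed

lemma gauge_ratio_small: assumes "0 < e" obtains d :: real where "0 < d" "gauge_ratio d < e" "d < 1/4"
proof -
  obtain k :: nat where k: "real k > max (2 / e) 3" using reals_Archimedean2 by blast
  have "gauge_ratio ((1/2) ^ k) \<le> 2 / real k" using k by (intro gauge_ratio_two_power) linarith
  also have "\<dots> < e" using k assms by (simp add: field_simps)
  finally have "gauge_ratio ((1/2) ^ k) < e" .
  moreover have "(1/2::real) ^ k \<le> (1/2)^3" using k by (intro power_decreasing) auto
  ultimately show ?thesis using that[of "(1/2) ^ k"] by (simp add: power3_eq_cube)
qed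

lemma gauge_ratio_dilate: assumes "0 < t" shows "gauge_ratio (2 ^ n * t) \<le> 2 ^ n * gauge_ratio t"
proof (induction n)
  case (Suc n)
  have "gauge_ratio (2 ^ Suc n * t) \<le> 2 * gauge_ratio (2 ^ n * t)"
    using gauge_ratio_double[of "2 ^ n * t"] assms by (simp add: mult.assoc)
  then show ?case using Suc by simp
qed simp

text \<open>
  Growth of order \<open>phi\<close> is used as linear growth whose constant is small at small scales; the
  constant at the largest scale \<open>T\<close> serves for all smaller ones.
\<close>

lemma le_gauge_ratio_mult:
  assumes "0 \<le> N" "0 < R" "R \<le> T" "m \<le> N * phi R"
  shows "m \<le> N * gauge_ratio T * R"
proof -
  have "N * phi R \<le> N * (R * gauge_ratio T)"
    unfolding phi_eq_gauge_ratio[OF assms(2)]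
    using assms by (intro mult_left_mono gauge_ratio_mono) auto
  then show ?thesis using assms(4) by (simp add: mult_ac)
qed

lemma dyadic_multiple_between:
  fixes r d :: real
  assumes "0 < r" "r \<le> 2 * d"
  obtains n where "d \<le> 2 ^ n * r" "2 ^ n * r \<le> 2 * d"
proof -
  define n where "n = (LEAST n. d \<le> 2 ^ n * r)"
  obtain m where "d / r < 2 ^ m" using real_arch_pow[of 2 "d / r"] by auto
  then have "d \<le> 2 ^ m * r" using assms(1) by (simp add: pos_divide_less_eq)
  then have "d \<le> 2 ^ n * r" unfolding n_def by (rule LeastI)
  moreover have "2 ^ n * r \<le> 2 * d"
  proof (cases n)
    case 0
    then show ?thesis using assms by simp
  next
    case (Suc m)
    then have "m < n" by simp
    then have "\<not> d \<le> 2 ^ m * r" unfolding n_def by (rule not_less_Least)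
    then show ?thesis unfolding Suc by simp
  qed
  ultimately show ?thesis by (rule that)
qed


section \<open>Contents and null sets\<close>

text \<open>
  Coverings by balls of arbitrary size, radii \<open>\<le> 0\<close> giving empty balls. Sets of content zero are
  what matters: a small sum forces every radius to be small, so they are also null for the Hausdorff
  measure, while the content is far easier to estimate from above.
\<close>

definition phi_content :: "complex set \<Rightarrow> ennreal" where
  "phi_content S =
     (INF (a, r)\<in>{(a :: nat \<Rightarrow> complex, r). S \<subseteq> (\<Union>i. ball (a i) (r i))}. \<Sum>i. ennreal (phi (r i)))"

lemma phi_content_le_nat:
  assumes "S \<subseteq> (\<Union>i::nat. ball (a i) (r i))"
  shows "phi_content S \<le> (\<Sum>i. ennreal (phi (r i)))"
  unfolding phi_content_def using assms by (intro INF_lower2[of "(a, r)"]) auto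

lemma phi_content_mono: "S \<subseteq> T \<Longrightarrow> phi_content S \<le> phi_content T"
  unfolding phi_content_def by (intro INF_superset_mono) auto

lemma phi_content_le_countable:
  assumes I: "countable I" and S: "S \<subseteq> (\<Union>i\<in>I. ball (a i) (r i))"
  shows "phi_content S \<le> (\<integral>\<^sup>+ i. ennreal (phi (r i)) \<partial>count_space I)"
proof -
  define f where "f = to_nat_on I"
  have inj: "inj_on f I" using I by (simp add: f_def inj_on_to_nat_on)
  define r' where "r' n = (if n \<in> f ` I then r (the_inv_into I f n) else 0)" for n
  define a' where "a' n = a (the_inv_into I f n)" for n
  have "S \<subseteq> (\<Union>n. ball (a' n) (r' n))"
  proof
    fix x assume "x \<in> S"
    then obtain i where i: "i \<in> I" "x \<in> ball (a i) (r i)" using S by blast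
    then have "x \<in> ball (a' (f i)) (r' (f i))"
      by (simp add: a'_def r'_def the_inv_into_f_f[OF inj])
    then show "x \<in> (\<Union>n. ball (a' n) (r' n))" by blast
  qed
  then have "phi_content S \<le> (\<Sum>n. ennreal (phi (r' n)))"
    by (rule phi_content_le_nat)
  also have "\<dots> = (\<integral>\<^sup>+ n. ennreal (phi (r' n)) \<partial>count_space UNIV)"
    by (simp add: nn_integral_count_space_nat)
  also have "\<dots> = (\<integral>\<^sup>+ n. ennreal (phi (r' n)) * indicator (f ` I) n \<partial>count_space UNIV)"
    by (intro nn_integral_cong) (auto simp: r'_def split: split_indicator)
  also have "\<dots> = (\<integral>\<^sup>+ n. ennreal (phi (r' n)) \<partial>count_space (f ` I))"
    by (simp add: nn_integral_count_space_indicator)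
  also have "\<dots> = (\<integral>\<^sup>+ i. ennreal (phi (r' (f i))) \<partial>count_space I)"
    by (rule nn_integral_bij_count_space[symmetric]) (simp add: inj inj_on_imp_bij_betw)
  also have "\<dots> = (\<integral>\<^sup>+ i. ennreal (phi (r i)) \<partial>count_space I)"
    by (intro nn_integral_cong) (simp add: r'_def the_inv_into_f_f[OF inj])
  finally show ?thesis .
qed

lemma phi_content_le_finite:
  assumes "finite I" "S \<subseteq> (\<Union>i\<in>I. ball (a i) (r i))"
  shows "phi_content S \<le> ennreal (\<Sum>i\<in>I. phi (r i))"
  using phi_content_le_countable[OF countable_finite[OF assms(1)] assms(2)] assms(1)
  by (simp add: nn_integral_count_space_finite sum_ennreal)

lemma phi_content_empty [simp]: "phi_content {} = 0"
  using phi_content_le_finite[of "{}" "{}" "\<lambda>_. 0" "\<lambda>_. 0"] by simp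

lemma phi_content_UN_le:
  fixes S :: "nat \<Rightarrow> complex set"
  shows "phi_content (\<Union>n. S n) \<le> (\<Sum>n. phi_content (S n))"
proof (cases "(\<Sum>n. phi_content (S n)) = \<infinity>")
  case False
  show ?thesis
  proof (rule ennreal_le_epsilon)
    fix e :: real assume e: "0 < e"
    have fin: "phi_content (S n) \<noteq> \<infinity>" for n
    proof
      assume "phi_content (S n) = \<infinity>"
      then have "(\<Sum>i\<in>{n}. phi_content (S i)) = \<infinity>" by simp
      moreover have "(\<Sum>i\<in>{n}. phi_content (S i)) \<le> (\<Sum>n. phi_content (S n))"
        by (rule sum_le_suminf) auto
      ultimately show False using False by (simp add: top_unique)
    qed
    have "\<exists>a r. S n \<subseteq> (\<Union>i::nat. ball (a i) (r i)) \<and>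
        (\<Sum>i. ennreal (phi (r i))) \<le> phi_content (S n) + ennreal (e * (1/2) ^ Suc n)" for n
    proof -
      obtain c where c: "0 \<le> c" "phi_content (S n) = ennreal c"
        using fin[of n] by (cases "phi_content (S n)") auto
      define q where "q = e * (1/2) ^ Suc n"
      have "0 < q" using e by (simp add: q_def)
      then have "ennreal c < ennreal (c + q)" using c(1) by (intro ennreal_lessI) auto
      also have "\<dots> = ennreal c + ennreal q"
        using c(1) \<open>0 < q\<close> by (intro ennreal_plus) auto
      finally have "phi_content (S n) < phi_content (S n) + ennreal (e * (1/2) ^ Suc n)"
        unfolding c(2) q_def .
      then have "\<exists>p\<in>{(a :: nat \<Rightarrow> complex, r). S n \<subseteq> (\<Union>i. ball (a i) (r i))}.
          (case p of (a, r) \<Rightarrow> \<Sum>i. ennreal (phi (r i))) < phi_content (S n) + ennreal (e * (1/2) ^ Suc n)"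
        unfolding phi_content_def by (subst (asm) INF_less_iff)
      then show ?thesis by (auto intro: less_imp_le)
    qed
    then obtain a r where ar: "\<And>n. S n \<subseteq> (\<Union>i::nat. ball (a n i) (r n i))"
      "\<And>n. (\<Sum>i. ennreal (phi (r n i))) \<le> phi_content (S n) + ennreal (e * (1/2) ^ Suc n)"
      by metis
    have "(\<Union>n. S n) \<subseteq> (\<Union>p\<in>UNIV. ball (case p of (n, i) \<Rightarrow> a n i) (case p of (n, i) \<Rightarrow> r n i))"
    proof
      fix x assume "x \<in> (\<Union>n. S n)"
      then obtain n i where "x \<in> ball (a n i) (r n i)" using ar(1) by blast
      then show "x \<in> (\<Union>p\<in>UNIV. ball (case p of (n, i) \<Rightarrow> a n i) (case p of (n, i) \<Rightarrow> r n i))"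
        by (intro UN_I[of "(n, i)"]) auto
    qed
    then have "phi_content (\<Union>n. S n) \<le>
        (\<integral>\<^sup>+ p. ennreal (phi (case p of (n, i) \<Rightarrow> r n i)) \<partial>count_space UNIV)"
      by (rule phi_content_le_countable[rotated]) simp
    also have "\<dots> = (\<integral>\<^sup>+ n. \<integral>\<^sup>+ i. ennreal (phi (r n i)) \<partial>count_space UNIV \<partial>count_space UNIV)"
      by (subst nn_integral_fst_count_space[symmetric]) simp
    also have "\<dots> = (\<Sum>n. \<Sum>i. ennreal (phi (r n i)))"
      by (simp add: nn_integral_count_space_nat)
    also have "\<dots> \<le> (\<Sum>n. phi_content (S n) + ennreal (e * (1/2) ^ Suc n))"
      by (intro suminf_le ar) auto
    also have "\<dots> = (\<Sum>n. phi_content (S n)) + (\<Sum>n. ennreal (e * (1/2) ^ Suc n))"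
      by (rule suminf_add[symmetric]) auto
    also have "(\<Sum>n. ennreal (e * (1/2) ^ Suc n)) = ennreal e"
      using sums_mult[OF power_half_series, of e] e
      by (intro sums_unique[symmetric] sums_ennreal[THEN iffD2]) auto
    finally show "phi_content (\<Union>n. S n) \<le> (\<Sum>n. phi_content (S n)) + ennreal e" .
  qed
qed (simp add: top_unique)

lemma phi_content_UN_null:
  fixes S :: "nat \<Rightarrow> complex set"
  assumes "\<And>n. phi_content (S n) = 0"
  shows "phi_content (\<Union>n. S n) = 0"
  using phi_content_UN_le[of S] assms by simp

lemma phi_content_Un_null:
  assumes "phi_content S = 0" "phi_content T = 0"
  shows "phi_content (S \<union> T) = 0"
proof -
  have "S \<union> T = (\<Union>n::nat. if n = 0 then S else T)" by (auto split: if_splits)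
  then show ?thesis
    using assms phi_content_UN_null[of "\<lambda>n. if n = 0 then S else T"] by simp
qed

lemma phi_content_null_subset: "phi_content T = 0 \<Longrightarrow> S \<subseteq> T \<Longrightarrow> phi_content S = 0"
  using phi_content_mono[of S T] by simp

lemma hausdorff_measure_phi_null:
  assumes "phi_content S = 0"
  shows "hausdorff_measure phi S = 0"
proof -
  have le: "hausdorff_content phi d S \<le> ennreal e" if d: "0 < d" and e: "0 < e" for d e :: real
  proof -
    \<comment> \<open>the second term forces all radii to be at most \<open>d / 2\<close>\<close>
    define e' where "e' = min (e / 4) (phi (d / 2))"
    have e': "0 < e'" using d e by (simp add: e'_def phi_pos)
    then have "phi_content S < ennreal e'" using assms by simp
    then obtain a r where ar: "S \<subseteq> (\<Union>i::nat. ball (a i) (r i))"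
        "(\<Sum>i. ennreal (phi (r i))) < ennreal e'"
      unfolding phi_content_def INF_less_iff by auto
    have r: "r i \<le> d / 2" for i
    proof (rule ccontr)
      assume "\<not> r i \<le> d / 2"
      then have "phi (d/2) \<le> phi (r i)" by (intro phi_mono) simp
      then have "ennreal e' \<le> ennreal (phi (r i))" by (auto simp: e'_def intro: ennreal_leI)
      also have "\<dots> = (\<Sum>i\<in>{i}. ennreal (phi (r i)))" by simp
      also have "\<dots> \<le> (\<Sum>i. ennreal (phi (r i)))" by (rule sum_le_suminf) auto
      finally show False using ar(2) by simp
    qed
    have diam: "diameter (ball (a i) (r i)) \<le> 2 * max 0 (r i)" for i
      by (cases "r i \<le> 0") (auto simp: ball_empty)
    have "hausdorff_content phi d S \<le> (\<Sum>i. ennreal (phi (diameter (ball (a i) (r i)))))"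
      unfolding hausdorff_content_def
    proof (rule INF_lower, safe)
      fix x assume "x \<in> S" then show "x \<in> (\<Union>i. ball (a i) (r i))" using ar(1) by blast
    next
      fix i show "diameter (ball (a i) (r i)) \<le> d" using diam[of i] r[of i] d by auto
    qed simp
    also have "\<dots> \<le> (\<Sum>i. ennreal (phi (2 * r i)))"
    proof (intro suminf_le ennreal_leI)
      fix i show "phi (diameter (ball (a i) (r i))) \<le> phi (2 * r i)"
      proof (cases "0 \<le> r i")
        case True then show ?thesis using diam[of i] by (intro phi_mono) auto
      next
        case False then show ?thesis by (simp add: ball_empty)
      qed
    qed auto
    also have "\<dots> \<le> (\<Sum>i. ennreal 4 * ennreal (phi (r i)))"
      by (intro suminf_le) (auto simp: ennreal_mult[symmetric] simp del: ennreal_numeral intro!: ennreal_leI phi_double)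
    also have "\<dots> = ennreal 4 * (\<Sum>i. ennreal (phi (r i)))" by (rule ennreal_suminf_cmult)
    also have "\<dots> \<le> ennreal 4 * ennreal e'" using ar(2) by (intro mult_left_mono) auto
    also have "\<dots> = ennreal (4 * e')" using e' by (simp only: ennreal_mult[symmetric])
    also have "\<dots> \<le> ennreal e" by (intro ennreal_leI) (simp add: e'_def)
    finally show ?thesis .
  qed
  have "hausdorff_content phi d S \<le> 0" if "0 < d" for d
    by (rule ennreal_le_epsilon) (simp only: add_0 le[OF that])
  then have "hausdorff_measure phi S \<le> 0"
    unfolding hausdorff_measure_def by (intro SUP_least) simp
  then show ?thesis by simp
qed

text \<open>
  By Vitali's lemma the balls in which \<open>M\<close> has large density contain a disjoint family whose fivefold
  dilates still cover \<open>S\<close>; doubling of \<open>phi\<close> absorbs the dilation and disjointness bounds the total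
  by the mass of \<open>U\<close>.
\<close>

lemma phi_content_le_of_density:
  fixes M :: "complex measure"
  assumes M: "sets M = sets borel" "finite_measure M" and \<eta>: "0 < \<eta>" and U: "U \<in> sets borel"
    and S: "\<And>a. a \<in> S \<Longrightarrow> \<exists>r. 0 < r \<and> r \<le> 1 \<and> ball a r \<subseteq> U \<and> \<eta> * phi r < measure M (ball a r)"
  shows "phi_content S \<le> ennreal (64 / \<eta> * measure M U)"
proof -
  interpret finite_measure M by fact
  obtain r where r: "\<And>a. a \<in> S \<Longrightarrow> 0 < r a \<and> r a \<le> 1"
      "\<And>a. a \<in> S \<Longrightarrow> ball a (r a) \<subseteq> U" "\<And>a. a \<in> S \<Longrightarrow> \<eta> * phi (r a) < measure M (ball a (r a))"
    using S by metis
  have "S \<subseteq> (\<Union>a\<in>S. ball a (r a))" using r(1) by force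
  then obtain C where C: "countable C" "C \<subseteq> S"
     "pairwise (\<lambda>i j. disjnt (ball i (r i)) (ball j (r j))) C"
     "S \<subseteq> (\<Union>i\<in>C. ball i (5 * r i))"
    by (rule Vitali_covering_lemma_balls[of S "\<lambda>a. a" r S 1]) (use r in auto)
  have "phi_content S \<le> (\<integral>\<^sup>+ i. ennreal (phi (5 * r i)) \<partial>count_space C)"
    using C by (intro phi_content_le_countable) auto
  also have "\<dots> \<le> (\<integral>\<^sup>+ i. ennreal (64 / \<eta>) * emeasure M (ball i (r i)) \<partial>count_space C)"
  proof (rule nn_integral_mono)
    fix i assume "i \<in> space (count_space C)"
    then have i: "i \<in> S" using C by auto
    have "phi (5 * r i) \<le> phi (2 ^ 3 * r i)" using r(1)[OF i] by (intro phi_mono) auto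
    also have "\<dots> \<le> 64 * phi (r i)" using phi_dilate[of 3 "r i"] by simp
    also have "\<dots> \<le> 64 / \<eta> * measure M (ball i (r i))"
      using r(3)[OF i] \<eta> by (simp add: field_simps)
    finally show "ennreal (phi (5 * r i)) \<le> ennreal (64 / \<eta>) * emeasure M (ball i (r i))"
      using \<eta> by (simp add: emeasure_eq_measure ennreal_mult[symmetric] ennreal_leI)
  qed
  also have "\<dots> = ennreal (64 / \<eta>) * (\<integral>\<^sup>+ i. emeasure M (ball i (r i)) \<partial>count_space C)"
    by (rule nn_integral_cmult) simp
  also have "(\<integral>\<^sup>+ i. emeasure M (ball i (r i)) \<partial>count_space C) = emeasure M (\<Union>i\<in>C. ball i (r i))"
    by (rule emeasure_UN_countable[symmetric])
       (use C M in \<open>auto simp: disjoint_family_on_def pairwise_def disjnt_def\<close>)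
  also have "\<dots> \<le> emeasure M U"
    using C r(2) U M(1) by (intro emeasure_mono) auto
  finally show ?thesis
    using \<eta> by (simp add: emeasure_eq_measure ennreal_mult[symmetric] mult_left_mono)
qed


section \<open>Finiteness of the variations of a signed measure\<close>

lemma emeasure_pos_variation_less_iff:
  assumes \<mu>: "finite_signed_borel_measure \<mu>" and A: "A \<in> sets borel"
    and c: "ennreal c < emeasure (pos_variation \<mu>) A"
  obtains B where "B \<in> sets borel" "B \<subseteq> A" "c < \<mu> B"
proof -
  obtain B where B: "B \<in> sets borel" "B \<subseteq> A" "ennreal c < ennreal (\<mu> B)"
    using c unfolding emeasure_pos_variation[OF \<mu> A] less_SUP_iff by auto
  then have "c < \<mu> B" by (meson ennreal_leI not_le)
  with B that show ?thesis by blast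
qed

text \<open>
  A set on which one of the variations is infinite contains \<open>B\<close> with \<open>\<bar>\<mu> B\<bar> > \<bar>\<mu> A\<bar> + 1\<close>, so that both
  \<open>B\<close> and its complement in \<open>A\<close> have measure at least \<open>1\<close> in absolute value, and one of them is again such a
  set. Iterating peels off disjoint sets whose measures do not tend to \<open>0\<close>, against countable additivity.
\<close>

lemma finite_pos_variation:
  fixes \<mu> :: "complex set \<Rightarrow> real"
  assumes \<mu>: "finite_signed_borel_measure \<mu>"
  shows "finite_measure (pos_variation \<mu>)"
proof (rule ccontr)
  let ?P = "\<lambda>A. emeasure (pos_variation \<mu>) A" and ?N = "\<lambda>A. emeasure (neg_variation \<mu>) A"
  note \<mu>' = finite_signed_borel_measure_uminus[OF \<mu>]
  define bad where "bad A \<longleftrightarrow> A \<in> sets borel \<and> (?P A = \<infinity> \<or> ?N A = \<infinity>)" for A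
  assume "\<not> finite_measure (pos_variation \<mu>)"
  then have bad_UNIV: "bad UNIV"
    using finite_measureI[of "pos_variation \<mu>"] by (auto simp: bad_def)
  have step: "\<exists>A'. A' \<subseteq> A \<and> bad A' \<and> 1 \<le> \<bar>\<mu> (A - A')\<bar>" if A: "bad A" for A
  proof -
    have Ab: "A \<in> sets borel" using A by (simp add: bad_def)
    have "\<exists>B. B \<in> sets borel \<and> B \<subseteq> A \<and> \<bar>\<mu> A\<bar> + 1 < \<bar>\<mu> B\<bar>"
    proof (cases "?P A = \<infinity>")
      case True
      then have "ennreal (\<bar>\<mu> A\<bar> + 1) < ?P A" by simp
      then obtain B where "B \<in> sets borel" "B \<subseteq> A" "\<bar>\<mu> A\<bar> + 1 < \<mu> B"
        by (rule emeasure_pos_variation_less_iff[OF \<mu> Ab])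
      then show ?thesis by (intro exI[of _ B]) auto
    next
      case False
      then have "ennreal (\<bar>\<mu> A\<bar> + 1) < ?N A" using A by (simp add: bad_def)
      then obtain B where "B \<in> sets borel" "B \<subseteq> A" "\<bar>\<mu> A\<bar> + 1 < - \<mu> B"
        unfolding neg_variation_def by (rule emeasure_pos_variation_less_iff[OF \<mu>' Ab])
      then show ?thesis by (intro exI[of _ B]) auto
    qed
    then obtain B where B: "B \<in> sets borel" "B \<subseteq> A" "\<bar>\<mu> A\<bar> + 1 < \<bar>\<mu> B\<bar>" by blast
    have split: "\<mu> A = \<mu> B + \<mu> (A - B)"
      using finite_signed_borel_measure_Un[OF \<mu>, of B "A - B"] B Ab by (auto simp: Un_absorb1)
    have "?P A = ?P B + ?P (A - B)" "?N A = ?N B + ?N (A - B)"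
      using plus_emeasure[of B "pos_variation \<mu>" "A - B"] plus_emeasure[of B "neg_variation \<mu>" "A - B"] B Ab
      by (auto simp: Un_absorb1)
    then have "bad B \<or> bad (A - B)"
      using A B Ab by (auto simp: bad_def)
    then show ?thesis
    proof
      assume "bad B"
      then show ?thesis using B split by (intro exI[of _ B]) auto
    next
      assume "bad (A - B)"
      then show ?thesis using B split by (intro exI[of _ "A - B"]) (auto simp: double_diff)
    qed
  qed
  then obtain f where f: "\<And>A. bad A \<Longrightarrow> f A \<subseteq> A \<and> bad (f A) \<and> 1 \<le> \<bar>\<mu> (A - f A)\<bar>"
    by metis
  define D where "D n = (f ^^ n) UNIV" for n
  have D: "bad (D n)" for n
    by (induction n) (use bad_UNIV f in \<open>auto simp: D_def\<close>)
  have D_Suc: "D (Suc n) = f (D n)" for n by (simp add: D_def)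
  have D_anti: "D n \<subseteq> D m" if "m \<le> n" for m n
    using that by (induction n rule: dec_induct) (use f D D_Suc in \<open>auto\<close>)
  define A where "A n = D n - D (Suc n)" for n
  have disj: "disjoint_family A"
    unfolding disjoint_family_on_def
  proof (intro ballI impI)
    fix m n :: nat assume "m \<noteq> n"
    then have "m < n \<or> n < m" by auto
    then show "A m \<inter> A n = {}"
      using D_anti[of "Suc m" n] D_anti[of "Suc n" m] unfolding A_def by auto
  qed
  have "range A \<subseteq> sets borel" using D by (auto simp: A_def bad_def)
  with disj \<mu> have "(\<lambda>n. \<mu> (A n)) sums \<mu> (\<Union>n. A n)"
    by (simp add: finite_signed_borel_measure_def)
  then have "(\<lambda>n. \<mu> (A n)) \<longlonglongrightarrow> 0" by (meson summable_LIMSEQ_zero sums_summable)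
  then have "\<forall>\<^sub>F n in sequentially. \<bar>\<mu> (A n)\<bar> < 1"
    using tendstoD[of _ 0 sequentially 1] by (force simp: dist_real_def)
  then obtain n where "\<bar>\<mu> (A n)\<bar> < 1" by (meson eventually_happens' sequentially_bot)
  moreover have "1 \<le> \<bar>\<mu> (A n)\<bar>" using f[OF D[of n]] by (simp add: A_def D_Suc)
  ultimately show False by simp
qed


section \<open>Points of controlled growth\<close>

definition growth_set :: "complex measure \<Rightarrow> real \<Rightarrow> complex set" where
  "growth_set M N = {a. \<forall>r>0. measure M (ball a r) \<le> N * phi r}"

lemma growth_setD: "a \<in> growth_set M N \<Longrightarrow> 0 < r \<Longrightarrow> measure M (ball a r) \<le> N * phi r"
  by (simp add: growth_set_def)

lemma ball_in_sets: "sets M = sets borel \<Longrightarrow> ball a r \<in> sets M" for a :: "'a::metric_space"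
  by (metis borel_open open_ball)

text \<open>
  The measure of an open ball is lower semicontinuous in the centre.
\<close>

lemma closed_growth_set:
  assumes M: "sets M = sets borel" "finite_measure M"
  shows "closed (growth_set M N)"
  unfolding closed_def open_contains_ball
proof
  interpret finite_measure M by fact
  fix b assume "b \<in> - growth_set M N"
  then have "\<not> (\<forall>r>0. measure M (ball b r) \<le> N * phi r)" unfolding growth_set_def by simp
  then have "\<exists>r. 0 < r \<and> N * phi r < measure M (ball b r)" by (meson not_le)
  then obtain r where r: "0 < r" "N * phi r < measure M (ball b r)" by (elim exE conjE)
  have "(\<lambda>n. measure M (ball b (r - 1 / real (Suc n)))) \<longlonglongrightarrow> measure M (\<Union>n. ball b (r - 1 / real (Suc n)))"
  proof (rule finite_Lim_measure_incseq)
    show "range (\<lambda>n. ball b (r - 1 / real (Suc n))) \<subseteq> sets M"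
      using ball_in_sets[OF M(1)] by blast
    show "incseq (\<lambda>n. ball b (r - 1 / real (Suc n)))"
    proof (rule incseq_SucI)
      fix n :: nat
      have "1 / real (Suc (Suc n)) \<le> 1 / real (Suc n)" by (rule frac_le) auto
      then show "ball b (r - 1 / real (Suc n)) \<subseteq> ball b (r - 1 / real (Suc (Suc n)))"
        by (metis subset_ball diff_left_mono)
    qed
  qed
  also have "(\<Union>n. ball b (r - 1 / real (Suc n))) = ball b r"
  proof (rule set_eqI, rule iffI)
    fix x assume "x \<in> (\<Union>n. ball b (r - 1 / real (Suc n)))"
    then obtain n :: nat where "dist b x < r - 1 / real (Suc n)" by (auto simp only: UN_iff mem_ball)
    moreover have "0 \<le> 1 / real (Suc n)" by simp
    ultimately have "dist b x < r" by linarith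
    then show "x \<in> ball b r" by simp
  next
    fix x assume "x \<in> ball b r"
    then have "0 < r - dist b x" by simp
    then obtain n where "1 / real (Suc n) < r - dist b x" by (rule nat_approx_posE)
    then have "dist b x < r - 1 / real (Suc n)" by linarith
    then show "x \<in> (\<Union>n. ball b (r - 1 / real (Suc n)))" unfolding UN_iff mem_ball by blast
  qed
  finally have "\<forall>\<^sub>F n in sequentially. N * phi r < measure M (ball b (r - 1 / real (Suc n)))"
    using r(2) by (rule order_tendstoD)
  then obtain n where n0: "N * phi r < measure M (ball b (r - 1 / real (Suc n)))"
    using eventually_happens'[OF sequentially_bot] by blast
  define q where "q = 1 / real (Suc n)"
  have q: "0 < q" by (simp add: q_def)
  have n: "N * phi r < measure M (ball b (r - q))" using n0 by (simp only: q_def)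
  have "ball b q \<subseteq> - growth_set M N"
  proof (rule subsetI)
    fix a assume "a \<in> ball b q"
    then have a: "dist b a < q" by simp
    have "ball b (r - q) \<subseteq> ball a r"
    proof
      fix x assume "x \<in> ball b (r - q)"
      then have "dist b x < r - q" by simp
      then have "dist a x < r" using a dist_triangle3[of a x b] by linarith
      then show "x \<in> ball a r" by simp
    qed
    then have "measure M (ball b (r - q)) \<le> measure M (ball a r)"
      by (rule finite_measure_mono) (simp add: M)
    with n have "\<not> measure M (ball a r) \<le> N * phi r" by linarith
    then have "a \<notin> growth_set M N" using growth_setD[of a M N r] r(1) by blast
    then show "a \<in> - growth_set M N" by simp
  qed
  then show "\<exists>e>0. ball b e \<subseteq> - growth_set M N" using q by blast
qed

lemma phi_1 [simp]: "phi 1 = 1"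
  by (simp add: phi_def)

lemma phi_content_eq_0I:
  assumes "\<And>e::real. 0 < e \<Longrightarrow> phi_content S \<le> ennreal e"
  shows "phi_content S = 0"
proof -
  have "phi_content S \<le> 0"
    by (rule ennreal_le_epsilon) (simp only: add_0 assms)
  then show ?thesis by simp
qed

lemma growth_sets_exhaust:
  assumes M: "sets M = sets borel" "finite_measure M"
  shows "phi_content (- (\<Union>N::nat. growth_set M (real N))) = 0"
proof -
  interpret finite_measure M by fact
  let ?S = "- (\<Union>N::nat. growth_set M (real N))"
  have "phi_content ?S \<le> ennreal e" if e: "0 < e" for e :: real
  proof -
    obtain N :: nat where N: "real N > max (max 1 (measure M UNIV)) (64 * measure M UNIV / e)"
      using reals_Archimedean2 by blast
    have "\<exists>r. 0 < r \<and> r \<le> 1 \<and> ball a r \<subseteq> UNIV \<and> real N * phi r < measure M (ball a r)" if a: "a \<in> ?S" for a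
    proof -
      obtain r where r: "0 < r" "real N * phi r < measure M (ball a r)"
        using a unfolding growth_set_def Compl_iff UN_iff mem_Collect_eq by (meson UNIV_I not_le)
      have "r \<le> 1"
      proof (rule ccontr)
        assume "\<not> r \<le> 1"
        then have "1 \<le> phi r" using phi_mono[of 1 r] by simp
        then have "real N * 1 \<le> real N * phi r" by (intro mult_left_mono) simp_all
        moreover have "measure M (ball a r) \<le> measure M UNIV"
          by (rule finite_measure_mono) (simp_all add: M)
        ultimately show False using N r(2) by linarith
      qed
      with r(1,2) show ?thesis by blast
    qed
    moreover have N0: "0 < real N" using N by linarith
    ultimately have "phi_content ?S \<le> ennreal (64 / real N * measure M UNIV)"
      using M by (intro phi_content_le_of_density) simp_all
    moreover have "64 / real N * measure M UNIV \<le> e"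
    proof -
      have "64 * measure M UNIV / e < real N" using N by linarith
      then have "64 * measure M UNIV < real N * e" using e by (simp only: pos_divide_less_eq)
      then show ?thesis using N0 by (simp add: pos_divide_le_eq mult.commute)
    qed
    ultimately show ?thesis by (meson ennreal_leI order_trans)
  qed
  then show ?thesis by (rule phi_content_eq_0I)
qed

text \<open>
  The mass of the shrinking neighbourhoods of \<open>E\<close>, taken off \<open>E\<close>, tends to \<open>0\<close>; small balls around points of \<open>E\<close>
  lie inside these neighbourhoods, so the Vitali estimate applies with arbitrarily small total mass.
\<close>

lemma density_outside_closed:
  assumes M: "sets M = sets borel" "finite_measure M" and E: "closed E"
  shows "phi_content {a \<in> E. \<not> (\<forall>e>0. \<exists>d>0. \<forall>r. 0 < r \<and> r \<le> d \<longrightarrow> measure M (ball a r - E) \<le> e * phi r)} = 0"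
proof -
  interpret finite_measure M by fact
  define S where "S e = {a \<in> E. \<forall>d>0. \<exists>r. 0 < r \<and> r \<le> d \<and> e * phi r < measure M (ball a r - E)}" for e
  define \<tau> where "\<tau> = density M (indicator (- E))"
  have E_sets: "- E \<in> sets M" using E M by auto
  have \<tau>_sets: "sets \<tau> = sets borel" by (simp add: \<tau>_def M)
  have em: "emeasure \<tau> A = emeasure M (A - E)" if "A \<in> sets borel" for A
    using that E_sets M(1) emeasure_restricted[of "- E" M A]
    by (simp add: \<tau>_def Diff_eq Int_commute)
  have me: "measure \<tau> A = measure M (A - E)" if "A \<in> sets borel" for A
    using em[OF that] by (simp add: measure_def)
  have fin: "finite_measure \<tau>"
    using em[of UNIV] \<tau>_sets sets_eq_imp_space_eq[OF \<tau>_sets] by (intro finite_measureI) auto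
  define U where "U n = {w. infdist w E < 1 / real (Suc n)}" for n
  have U_open: "open (U n)" for n
    unfolding U_def by (intro open_Collect_less continuous_intros)
  have null: "phi_content (S e) = 0" if e: "0 < e" for e
  proof (cases "E = {}")
    case True
    then show ?thesis by (simp add: S_def)
  next
    case False
    have le: "phi_content (S e) \<le> ennreal (64 / e * measure \<tau> (U n))" for n
    proof (rule phi_content_le_of_density[OF \<tau>_sets fin e])
      show "U n \<in> sets borel" using U_open by simp
      fix a assume a: "a \<in> S e"
      then have aE: "a \<in> E" by (simp add: S_def)
      obtain r where r: "0 < r" "r \<le> 1 / real (Suc n)" "e * phi r < measure M (ball a r - E)"
        using a unfolding S_def by (smt (verit) mem_Collect_eq divide_pos_pos of_nat_0_less_iff zero_less_Suc)
      have "ball a r \<subseteq> U n"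
      proof
        fix x assume "x \<in> ball a r"
        then have "infdist x E < r" using infdist_le[OF aE, of x] by (simp add: dist_commute)
        then show "x \<in> U n" using r by (simp add: U_def)
      qed
      moreover have "r \<le> 1" using r(2) by (rule order_trans) simp
      ultimately show "\<exists>r. 0 < r \<and> r \<le> 1 \<and> ball a r \<subseteq> U n \<and> e * phi r < measure \<tau> (ball a r)"
        using r me[of "ball a r"] by auto
    qed
    have "(\<lambda>n. measure \<tau> (U n)) \<longlonglongrightarrow> measure \<tau> (\<Inter>n. U n)"
    proof (rule finite_measure.finite_Lim_measure_decseq[OF fin])
      show "range U \<subseteq> sets \<tau>" using U_open \<tau>_sets by auto
      show "decseq U" unfolding decseq_Suc_iff U_def
        by (auto intro: less_le_trans simp: frac_le)
    qed
    also have "(\<Inter>n. U n) = E"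
    proof (rule set_eqI, rule iffI)
      fix x assume x: "x \<in> (\<Inter>n. U n)"
      have "infdist x E = 0"
      proof (rule ccontr)
        assume "infdist x E \<noteq> 0"
        then have "0 < infdist x E" using infdist_nonneg[of x E] by linarith
        then obtain n where "inverse (real (Suc n)) < infdist x E" using reals_Archimedean by blast
        moreover have "x \<in> U n" using x by blast
        ultimately show False by (simp add: U_def inverse_eq_divide)
      qed
      then show "x \<in> E" using E False by (simp add: in_closed_iff_infdist_zero)
    next
      fix x assume "x \<in> E"
      then have "infdist x E = 0" by (rule infdist_zero)
      moreover have "0 < 1 / real (Suc n)" for n by simp
      ultimately show "x \<in> (\<Inter>n. U n)" unfolding U_def INT_iff mem_Collect_eq by metis
    qed
    also have "measure \<tau> E = 0" using me[of E] E by simp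
    finally have lim: "(\<lambda>n. ennreal (64 / e * measure \<tau> (U n))) \<longlonglongrightarrow> ennreal (64 / e * 0)"
      by (intro tendsto_ennrealI tendsto_mult tendsto_const)
    have "phi_content (S e) \<le> ennreal (64 / e * 0)"
      by (rule LIMSEQ_le_const[OF lim]) (use le in auto)
    then show ?thesis by simp
  qed
  have "phi_content (\<Union>n. S (1 / real (Suc n))) = 0"
    by (rule phi_content_UN_null) (simp add: null)
  moreover have "{a \<in> E. \<not> (\<forall>e>0. \<exists>d>0. \<forall>r. 0 < r \<and> r \<le> d \<longrightarrow> measure M (ball a r - E) \<le> e * phi r)}
      \<subseteq> (\<Union>n. S (1 / real (Suc n)))"
  proof (rule subsetI)
    fix a assume "a \<in> {a \<in> E. \<not> (\<forall>e>0. \<exists>d>0. \<forall>r. 0 < r \<and> r \<le> d \<longrightarrow> measure M (ball a r - E) \<le> e * phi r)}"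
    then obtain e :: real where a: "a \<in> E" and e: "0 < e"
      and bad: "\<not> (\<exists>d>0. \<forall>r. 0 < r \<and> r \<le> d \<longrightarrow> measure M (ball a r - E) \<le> e * phi r)"
      unfolding mem_Collect_eq not_all not_imp by (elim conjE exE)
    obtain n where n: "inverse (real (Suc n)) < e" using reals_Archimedean[OF e] by blast
    have "a \<in> S (1 / real (Suc n))"
      unfolding S_def
    proof (intro CollectI conjI allI impI a)
      fix d :: real assume "0 < d"
      then obtain r where r: "0 < r" "r \<le> d" "e * phi r < measure M (ball a r - E)"
        using bad by (meson not_le)
      have "1 / real (Suc n) * phi r \<le> e * phi r"
        using n by (intro mult_right_mono) (auto simp: inverse_eq_divide)
      with r show "\<exists>r>0. r \<le> d \<and> 1 / real (Suc n) * phi r < measure M (ball a r - E)"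
        by (intro exI[of _ r]) auto
    qed
    then show "a \<in> (\<Union>n. S (1 / real (Suc n)))" by blast
  qed
  ultimately show ?thesis by (rule phi_content_null_subset)
qed


section \<open>Frostman weights on finite sets\<close>

text \<open>
  Handle the points one after another and give each the largest weight that keeps every capacity
  constraint valid. This saturates some constraint through the point, and later steps only add weight, so it
  stays saturated. This takes the place of the top-down mass redistribution in Frostman's lemma.
\<close>

lemma greedy_weights:
  fixes S :: "'j \<Rightarrow> 'a set" and c :: "'j \<Rightarrow> real"
  assumes "finite X" "finite J" "\<And>j. j \<in> J \<Longrightarrow> 0 \<le> c j" "X \<subseteq> (\<Union>j\<in>J. S j)"
  shows "\<exists>w. (\<forall>x. 0 \<le> w x) \<and> (\<forall>j\<in>J. sum w (X \<inter> S j) \<le> c j) \<and>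
             (\<forall>x\<in>X. \<exists>j\<in>J. x \<in> S j \<and> sum w (X \<inter> S j) = c j)"
  using assms(1,4)
proof (induction X rule: finite_induct)
  case empty
  show ?case using assms(3) by (intro exI[of _ "\<lambda>_. 0"]) auto
next
  case (insert x X)
  then obtain w where w: "\<And>x. 0 \<le> w x" "\<And>j. j \<in> J \<Longrightarrow> sum w (X \<inter> S j) \<le> c j"
      "\<And>y. y \<in> X \<Longrightarrow> \<exists>j\<in>J. y \<in> S j \<and> sum w (X \<inter> S j) = c j"
    by blast
  define Jx where "Jx = {j \<in> J. x \<in> S j}"
  have Jx: "finite Jx" "Jx \<noteq> {}" using insert.prems assms(2) by (auto simp: Jx_def)
  define v where "v = Min ((\<lambda>j. c j - sum w (X \<inter> S j)) ` Jx)"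
  have v_le: "v \<le> c j - sum w (X \<inter> S j)" if "j \<in> Jx" for j
    unfolding v_def using that Jx by (intro Min_le) auto
  have "v \<in> (\<lambda>j. c j - sum w (X \<inter> S j)) ` Jx" unfolding v_def using Jx by (intro Min_in) auto
  then obtain jx where jx: "jx \<in> Jx" "v = c jx - sum w (X \<inter> S jx)" by blast
  have v0: "0 \<le> v" using jx w(2)[of jx] by (simp add: Jx_def)
  define w' where "w' = w(x := v)"
  have sum': "sum w' (insert x X \<inter> S j) = (if x \<in> S j then v else 0) + sum w (X \<inter> S j)" for j
  proof -
    have "sum w' (X \<inter> S j) = sum w (X \<inter> S j)"
      using insert.hyps(2) by (intro sum.cong) (auto simp: w'_def)
    then show ?thesis using insert.hyps by (auto simp: w'_def)
  qed
  show ?case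
  proof (intro exI[of _ w'] conjI allI ballI)
    fix y show "0 \<le> w' y" using w(1) v0 by (simp add: w'_def)
  next
    fix j assume "j \<in> J" then show "sum w' (insert x X \<inter> S j) \<le> c j"
      unfolding sum' using w(2)[of j] v_le[of j] by (auto simp: Jx_def)
  next
    fix y assume y: "y \<in> insert x X"
    show "\<exists>j\<in>J. y \<in> S j \<and> sum w' (insert x X \<inter> S j) = c j"
    proof (cases "y = x")
      case True
      have "sum w' (insert x X \<inter> S jx) = c jx" unfolding sum' using jx by (simp add: Jx_def)
      then show ?thesis using True jx(1) unfolding Jx_def by blast
    next
      case False
      then obtain j where j: "j \<in> J" "y \<in> S j" "sum w (X \<inter> S j) = c j" using w(3)[of y] y by blast
      then have "x \<in> S j \<Longrightarrow> v \<le> 0" using v_le[of j] by (simp add: Jx_def)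
      then have "sum w' (insert x X \<inter> S j) = c j" unfolding sum' using j(3) v0 by auto
      then show ?thesis using j(1,2) by blast
    qed
  qed
qed

text \<open>
  A discrete Frostman lemma at resolution \<open>2\<^sup>-\<^sup>l\<close>: the balls that are saturated by the greedy
  weights cover \<open>X\<close>, hence their dilates cover \<open>F\<close>, and a disjoint subfamily shows that the sum of
  \<open>phi\<close> over them is at most a multiple of the total weight.
\<close>

lemma finite_frostman:
  fixes F :: "complex set" and l :: nat
  assumes "bounded F"
  obtains X w where "finite X" "X \<subseteq> F" "\<And>x. 0 \<le> w x"
    "\<And>y j. y \<in> X \<Longrightarrow> j \<le> l \<Longrightarrow> sum w (X \<inter> ball y ((1/2) ^ j)) \<le> phi ((1/2) ^ j)"
    "phi_content F \<le> ennreal (64 * sum w X)"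
proof -
  have "closure F \<subseteq> (\<Union>x\<in>F. ball x ((1/2) ^ l))"
  proof
    fix z assume "z \<in> closure F"
    then obtain x where "x \<in> F" "dist x z < (1/2) ^ l"
      unfolding closure_approachable by (meson zero_less_power half_gt_zero zero_less_one)
    then show "z \<in> (\<Union>x\<in>F. ball x ((1/2) ^ l))" by auto
  qed
  moreover have "compact (closure F)" using assms by simp
  ultimately obtain X where X: "X \<subseteq> F" "finite X" "closure F \<subseteq> (\<Union>x\<in>X. ball x ((1/2) ^ l))"
    by (elim compactE_image) auto
  define J where "J = X \<times> {..l}"
  define c where "c p = phi ((1/2) ^ snd p)" for p :: "complex \<times> nat"
  define S where "S p = ball (fst p) ((1/2) ^ snd p)" for p :: "complex \<times> nat"
  have "X \<subseteq> (\<Union>j\<in>J. S j)"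
  proof
    fix x assume "x \<in> X" then show "x \<in> (\<Union>j\<in>J. S j)"
      by (intro UN_I[of "(x, 0)"]) (auto simp: J_def S_def)
  qed
  then obtain w where w: "\<And>x. 0 \<le> w x" "\<And>j. j \<in> J \<Longrightarrow> sum w (X \<inter> S j) \<le> c j"
      "\<And>x. x \<in> X \<Longrightarrow> \<exists>j\<in>J. x \<in> S j \<and> sum w (X \<inter> S j) = c j"
  proof -
    have "\<exists>w. (\<forall>x. 0 \<le> w x) \<and> (\<forall>j\<in>J. sum w (X \<inter> S j) \<le> c j) \<and>
             (\<forall>x\<in>X. \<exists>j\<in>J. x \<in> S j \<and> sum w (X \<inter> S j) = c j)"
      using X(2) \<open>X \<subseteq> (\<Union>j\<in>J. S j)\<close> by (intro greedy_weights) (simp_all add: J_def c_def)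
    then show thesis using that by blast
  qed
  define K where "K = {j \<in> J. sum w (X \<inter> S j) = c j}"
  have finK: "finite K" using X by (auto simp: K_def J_def)
  have "X \<subseteq> (\<Union>p\<in>K. ball (fst p) ((1/2) ^ snd p))"
    using w(3) unfolding K_def S_def by blast
  then obtain C where C: "countable C" "C \<subseteq> K"
      "pairwise (\<lambda>i j. disjnt (ball (fst i) ((1/2) ^ snd i)) (ball (fst j) ((1/2) ^ snd j))) C"
      "X \<subseteq> (\<Union>i\<in>C. ball (fst i) (5 * (1/2) ^ snd i))"
    by (rule Vitali_covering_lemma_balls[of X fst "\<lambda>p. (1/2) ^ snd p" K 1]) (auto simp: power_le_one)
  have finC: "finite C" using finK C(2) by (rule rev_finite_subset)
  define \<rho> where "\<rho> i = (1/2::real) ^ snd i" for i :: "complex \<times> nat"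
  have "F \<subseteq> (\<Union>i\<in>C. ball (fst i) (8 * \<rho> i))"
  proof
    fix z assume "z \<in> F"
    then have "z \<in> (\<Union>x\<in>X. ball x ((1/2) ^ l))" using X(3) closure_subset by blast
    then obtain x where x: "x \<in> X" "dist x z < (1/2) ^ l" unfolding UN_iff mem_ball by blast
    have "x \<in> (\<Union>i\<in>C. ball (fst i) (5 * (1/2) ^ snd i))" using x(1) C(4) by blast
    then obtain i where i: "i \<in> C" "dist (fst i) x < 5 * \<rho> i"
      unfolding UN_iff mem_ball \<rho>_def by blast
    have "snd i \<le> l" using i(1) C(2) by (auto simp: K_def J_def)
    then have "(1/2::real) ^ l \<le> \<rho> i"
      unfolding \<rho>_def by (rule power_decreasing) simp_all
    then have "dist (fst i) z < 8 * \<rho> i"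
      using x(2) i(2) dist_triangle[of "fst i" z x] zero_le_dist[of "fst i" x] by linarith
    then show "z \<in> (\<Union>i\<in>C. ball (fst i) (8 * \<rho> i))" using i(1) unfolding UN_iff mem_ball by blast
  qed
  then have "phi_content F \<le> ennreal (\<Sum>i\<in>C. phi (8 * \<rho> i))"
    by (rule phi_content_le_finite[OF finC])
  also have "(\<Sum>i\<in>C. phi (8 * \<rho> i)) \<le> (\<Sum>i\<in>C. 64 * sum w (X \<inter> S i))"
  proof (rule sum_mono)
    fix i assume "i \<in> C"
    then have "sum w (X \<inter> S i) = phi (\<rho> i)" using C(2) unfolding K_def c_def \<rho>_def by blast
    then show "phi (8 * \<rho> i) \<le> 64 * sum w (X \<inter> S i)"
      using phi_dilate[of 3 "\<rho> i"] by simp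
  qed
  also have "\<dots> = 64 * sum w (\<Union>i\<in>C. X \<inter> S i)"
  proof -
    have "\<forall>i\<in>C. \<forall>j\<in>C. i \<noteq> j \<longrightarrow> (X \<inter> S i) \<inter> (X \<inter> S j) = {}"
      using C(3) unfolding pairwise_def disjnt_def S_def by blast
    then have "sum w (\<Union>i\<in>C. X \<inter> S i) = (\<Sum>i\<in>C. sum w (X \<inter> S i))"
      using X(2) finC by (intro sum.UNION_disjoint) simp_all
    then show ?thesis by (simp add: sum_distrib_left)
  qed
  also have "\<dots> \<le> 64 * sum w X"
    using X(2) w(1) by (intro mult_left_mono sum_mono2) auto
  finally have "phi_content F \<le> ennreal (64 * sum w X)" by (simp add: ennreal_leI)
  moreover have "sum w (X \<inter> ball y ((1/2) ^ j)) \<le> phi ((1/2) ^ j)" if "y \<in> X" "j \<le> l" for y j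
    using w(2)[of "(y, j)"] that by (simp add: J_def S_def c_def)
  ultimately show ?thesis using that[of X w] X w(1) by blast
qed

lemma dyadic_radius:
  fixes r :: real
  assumes "(1/2) ^ l \<le> r" "r \<le> 1/2"
  obtains j where "j \<le> l" "2 * r \<le> (1/2) ^ j" "(1/2) ^ j \<le> 4 * r"
proof -
  define j where "j = (LEAST j. (1/2) ^ j \<le> 4 * r)"
  have "0 < r" using assms(1) by (rule less_le_trans[rotated]) simp
  then have l: "(1/2) ^ l \<le> 4 * r" using assms(1) by linarith
  have j: "(1/2) ^ j \<le> 4 * r" "j \<le> l" unfolding j_def using l by (auto intro: LeastI Least_le)
  have "2 * r \<le> (1/2) ^ j"
  proof (cases j)
    case 0 then show ?thesis using assms(2) by simp
  next
    case (Suc i)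
    then have "i < j" by simp
    then have "\<not> (1/2) ^ i \<le> 4 * r" unfolding j_def by (rule not_less_Least)
    then show ?thesis using Suc by simp
  qed
  with j that show ?thesis by blast
qed

lemma weight_growth_everywhere:
  assumes X: "finite X" and w: "\<And>x. 0 \<le> w x"
    and g: "\<And>y j. y \<in> X \<Longrightarrow> j \<le> l \<Longrightarrow> sum w (X \<inter> ball y ((1/2) ^ j)) \<le> phi ((1/2) ^ j)"
    and r: "(1/2) ^ l \<le> r" "r \<le> 1/2"
  shows "sum w (X \<inter> ball x r) \<le> 16 * phi r"
proof (cases "X \<inter> ball x r = {}")
  case False
  then obtain y where y: "y \<in> X" "dist x y < r" by auto
  obtain j where j0: "j \<le> l" "2 * r \<le> (1/2) ^ j" "(1/2) ^ j \<le> 4 * r"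
    using r by (rule dyadic_radius)
  define \<rho> where "\<rho> = (1/2::real) ^ j"
  have j: "2 * r \<le> \<rho>" "\<rho> \<le> 4 * r" using j0(2,3) unfolding \<rho>_def .
  have "ball x r \<subseteq> ball y \<rho>"
  proof
    fix z assume "z \<in> ball x r"
    then have "dist x z < r" by simp
    then have "dist y z < \<rho>"
      using y(2) j(1) dist_triangle3[of y z x] by linarith
    then show "z \<in> ball y \<rho>" by simp
  qed
  then have "sum w (X \<inter> ball x r) \<le> sum w (X \<inter> ball y \<rho>)"
    using X w by (intro sum_mono2) auto
  moreover have "sum w (X \<inter> ball y \<rho>) \<le> phi \<rho>" unfolding \<rho>_def by (rule g[OF y(1) j0(1)])
  moreover have "phi \<rho> \<le> phi (2 ^ 2 * r)" using j by (intro phi_mono) simp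
  moreover have "phi (2 ^ 2 * r) \<le> 16 * phi r" using phi_dilate[of 2 r] by simp
  ultimately show ?thesis by linarith
qed simp


section \<open>Sums of measures and discrete measures\<close>

text \<open>
  The \<open>L\<^sup>2\<close> bound for truncated Cauchy integrals is a statement about a single measure; it will be applied to
  the sum of a given measure and a discrete one.
\<close>

definition add_measure :: "'a measure \<Rightarrow> 'a measure \<Rightarrow> 'a measure" where
  "add_measure M N = measure_of (space M) (sets M) (\<lambda>A. emeasure M A + emeasure N A)"

lemma sets_add_measure [simp, measurable_cong]: "sets (add_measure M N) = sets M"
  and space_add_measure [simp]: "space (add_measure M N) = space M"
  by (simp_all add: add_measure_def)

lemma emeasure_add_measure:
  assumes "sets M = sets N" "A \<in> sets M"
  shows "emeasure (add_measure M N) A = emeasure M A + emeasure N A"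
proof (rule emeasure_measure_of[OF add_measure_def])
  show "countably_additive (sets (add_measure M N)) (\<lambda>A. emeasure M A + emeasure N A)"
    unfolding countably_additive_def sets_add_measure
  proof (intro allI impI)
    fix F :: "nat \<Rightarrow> 'a set" assume F: "range F \<subseteq> sets M" "disjoint_family F"
    have "(\<Sum>i. emeasure M (F i) + emeasure N (F i)) = (\<Sum>i. emeasure M (F i)) + (\<Sum>i. emeasure N (F i))"
      by (rule suminf_add[symmetric]) auto
    also have "\<dots> = emeasure M (\<Union>i. F i) + emeasure N (\<Union>i. F i)"
      using F assms(1) by (simp add: suminf_emeasure)
    finally show "(\<Sum>i. emeasure M (F i) + emeasure N (F i)) = emeasure M (\<Union>i. F i) + emeasure N (\<Union>i. F i)" .
  qed
qed (use assms sets.space_closed in \<open>auto simp: positive_def\<close>)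

lemma finite_measure_add_measure:
  assumes "sets M = sets N" "finite_measure M" "finite_measure N"
  shows "finite_measure (add_measure M N)"
  using assms sets_eq_imp_space_eq[OF assms(1)]
  by (intro finite_measureI)
     (simp add: emeasure_add_measure finite_measure.emeasure_finite)

lemma measure_add_measure:
  assumes "sets M = sets N" "A \<in> sets M" "finite_measure M" "finite_measure N"
  shows "measure (add_measure M N) A = measure M A + measure N A"
  using assms
  by (simp add: measure_def emeasure_add_measure enn2real_plus less_top[symmetric] finite_measure.emeasure_finite)

lemma nn_integral_add_measure:
  assumes MN: "sets M = sets N" and f: "f \<in> borel_measurable M"
  shows "(\<integral>\<^sup>+ x. f x \<partial>add_measure M N) = (\<integral>\<^sup>+ x. f x \<partial>M) + (\<integral>\<^sup>+ x. f x \<partial>N)"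
  using f
proof (induction f rule: borel_measurable_induct)
  case (cong f g)
  have "(\<integral>\<^sup>+ x. f x \<partial>K) = (\<integral>\<^sup>+ x. g x \<partial>K)" if "space K = space M" for K
    using cong that by (intro nn_integral_cong) auto
  then show ?case using cong sets_eq_imp_space_eq[OF MN] by simp
next
  case (set A)
  then show ?case using MN by (simp add: emeasure_add_measure)
next
  case (mult u c)
  then show ?case using MN by (simp add: nn_integral_cmult distrib_left measurable_cong_sets[OF MN refl])
next
  case (add u v)
  then show ?case using MN by (simp add: nn_integral_add measurable_cong_sets[OF MN refl] add_ac)
next
  case (seq U)
  have [measurable]: "U i \<in> borel_measurable N" for i using seq measurable_cong_sets[OF MN refl] by blast
  have [measurable]: "U i \<in> borel_measurable M" for i using seq by blast
  have inc: "incseq (\<lambda>i. \<integral>\<^sup>+ x. U i x \<partial>K)" for K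
    using \<open>incseq U\<close> unfolding incseq_def le_fun_def by (intro allI impI nn_integral_mono) blast
  have "(\<integral>\<^sup>+ x. (SUP i. U i x) \<partial>add_measure M N) = (SUP i. \<integral>\<^sup>+ x. U i x \<partial>add_measure M N)"
    by (rule nn_integral_monotone_convergence_SUP) (use seq in auto)
  also have "\<dots> = (SUP i. (\<integral>\<^sup>+ x. U i x \<partial>M) + (\<integral>\<^sup>+ x. U i x \<partial>N))" using seq by simp
  also have "\<dots> = (SUP i. \<integral>\<^sup>+ x. U i x \<partial>M) + (SUP i. \<integral>\<^sup>+ x. U i x \<partial>N)"
    by (rule ennreal_SUP_add) (rule inc)+
  also have "(SUP i. \<integral>\<^sup>+ x. U i x \<partial>M) = (\<integral>\<^sup>+ x. (SUP i. U i x) \<partial>M)"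
    by (rule nn_integral_monotone_convergence_SUP[symmetric]) (use seq in auto)
  also have "(SUP i. \<integral>\<^sup>+ x. U i x \<partial>N) = (\<integral>\<^sup>+ x. (SUP i. U i x) \<partial>N)"
    by (rule nn_integral_monotone_convergence_SUP[symmetric]) (use seq in auto)
  finally show ?case by (simp add: image_comp)
qed

lemma integrable_add_measure_iff:
  fixes f :: "'a \<Rightarrow> 'b::{banach, second_countable_topology}"
  assumes MN: "sets M = sets N"
  shows "integrable (add_measure M N) f \<longleftrightarrow> integrable M f \<and> integrable N f"
proof -
  have "f \<in> borel_measurable (add_measure M N) \<longleftrightarrow> f \<in> borel_measurable M"
    by (rule arg_cong[of _ _ "\<lambda>X. f \<in> X"], rule measurable_cong_sets) auto
  moreover have "f \<in> borel_measurable N \<longleftrightarrow> f \<in> borel_measurable M"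
    by (rule arg_cong[of _ _ "\<lambda>X. f \<in> X"], rule measurable_cong_sets) (use MN in auto)
  ultimately show ?thesis
    by (auto simp: integrable_iff_bounded nn_integral_add_measure[OF MN])
qed

lemma integral_add_measure:
  fixes f :: "'a \<Rightarrow> 'b::{banach, second_countable_topology}"
  assumes MN: "sets M = sets N" and "integrable M f" "integrable N f"
  shows "(LINT x|add_measure M N. f x) = (LINT x|M. f x) + (LINT x|N. f x)"
proof -
  have "integrable (add_measure M N) f" using assms by (simp add: integrable_add_measure_iff)
  then show ?thesis
  proof (induction rule: integrable_induct)
    case (base A c)
    then have fin: "emeasure M A < \<infinity>" "emeasure N A < \<infinity>"
      using MN by (auto simp: emeasure_add_measure)
    then have "measure (add_measure M N) A = measure M A + measure N A"
      using MN base by (simp add: measure_def emeasure_add_measure enn2real_plus)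
    then show ?case using base MN fin sets.sets_into_space[of A M] sets_eq_imp_space_eq[OF MN]
      by (simp add: scaleR_add_left Int_absorb2)
  next
    case (add f g)
    then show ?case using MN by (simp add: integrable_add_measure_iff)
  next
    case (lim f s)
    have int: "integrable K f \<and> (\<forall>i. integrable K (s i)) \<and> space K = space (add_measure M N)"
      if "K \<in> {M, N, add_measure M N}" for K
      using lim that MN sets_eq_imp_space_eq[OF MN] by (auto simp: integrable_add_measure_iff)
    have conv: "(\<lambda>i. LINT x|K. s i x) \<longlonglongrightarrow> (LINT x|K. f x)" if K: "K \<in> {M, N, add_measure M N}" for K
    proof (rule integral_dominated_convergence[where w = "\<lambda>x. 2 * norm (f x)"])
      show "integrable K (\<lambda>x. 2 * norm (f x))" using int[OF K] by simp
      show "f \<in> borel_measurable K" "\<And>i. s i \<in> borel_measurable K"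
        using int[OF K] by (blast intro: borel_measurable_integrable)+
      show "AE x in K. (\<lambda>i. s i x) \<longlonglongrightarrow> f x" using lim int[OF K] by (intro AE_I2) auto
      show "\<And>i. AE x in K. norm (s i x) \<le> 2 * norm (f x)" using lim int[OF K] by (intro AE_I2) auto
    qed
    have "(\<lambda>i. (LINT x|M. s i x) + (LINT x|N. s i x)) \<longlonglongrightarrow> (LINT x|M. f x) + (LINT x|N. f x)"
      by (intro tendsto_add conv) auto
    moreover have "(\<lambda>i. (LINT x|M. s i x) + (LINT x|N. s i x)) \<longlonglongrightarrow> (LINT x|add_measure M N. f x)"
      using conv[of "add_measure M N"] lim by simp
    ultimately show ?case using LIMSEQ_unique by blast
  qed
qed

definition atomic_measure :: "complex set \<Rightarrow> (complex \<Rightarrow> real) \<Rightarrow> complex measure" where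
  "atomic_measure X w = distr (point_measure X (\<lambda>x. ennreal (w x))) borel (\<lambda>x. x)"

lemma sets_atomic_measure [simp, measurable_cong]: "sets (atomic_measure X w) = sets borel"
  and space_atomic_measure [simp]: "space (atomic_measure X w) = UNIV"
  by (simp_all add: atomic_measure_def)

lemma emeasure_atomic_measure:
  assumes "finite X" "\<And>x. 0 \<le> w x" "A \<in> sets borel"
  shows "emeasure (atomic_measure X w) A = ennreal (sum w (X \<inter> A))"
proof -
  have "emeasure (atomic_measure X w) A = emeasure (point_measure X (\<lambda>x. ennreal (w x))) (X \<inter> A)"
    unfolding atomic_measure_def using assms
    by (subst emeasure_distr) (auto simp: space_point_measure Int_commute)
  then show ?thesis using assms by (simp add: emeasure_point_measure_finite sum_ennreal)
qed

lemma finite_measure_atomic_measure: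
  assumes "finite X" "\<And>x. 0 \<le> w x"
  shows "finite_measure (atomic_measure X w)"
  using emeasure_atomic_measure[OF assms, of UNIV] by (intro finite_measureI) auto

lemma measure_atomic_measure:
  assumes "finite X" "\<And>x. 0 \<le> w x" "A \<in> sets borel"
  shows "measure (atomic_measure X w) A = sum w (X \<inter> A)"
  using emeasure_atomic_measure[OF assms] assms(2) by (simp add: measure_def sum_nonneg)

lemma integral_atomic_measure:
  fixes f :: "complex \<Rightarrow> 'b::{banach, second_countable_topology}"
  assumes "finite X" "\<And>x. 0 \<le> w x" "f \<in> borel_measurable borel"
  shows "(LINT x|atomic_measure X w. f x) = (\<Sum>x\<in>X. w x *\<^sub>R f x)"
  using assms by (simp add: atomic_measure_def integral_distr lebesgue_integral_point_measure_finite)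


section \<open>Truncated Cauchy integrals and Menger curvature\<close>

definition cutoff_kernel :: "real \<Rightarrow> real \<Rightarrow> complex \<Rightarrow> complex" where
  "cutoff_kernel s t z = (if s \<le> cmod z \<and> cmod z < t then 1 / z else 0)"

definition trunc_cauchy :: "complex measure \<Rightarrow> real \<Rightarrow> real \<Rightarrow> complex \<Rightarrow> complex" where
  "trunc_cauchy M s t x = (LINT y|M. cutoff_kernel s t (x - y))"

lemma cutoff_kernel_measurable [measurable]: "cutoff_kernel s t \<in> borel_measurable borel"
  unfolding cutoff_kernel_def by measurable

lemma norm_cutoff_kernel_le: "0 < s \<Longrightarrow> cmod (cutoff_kernel s t z) \<le> 1 / s"
  by (auto simp: cutoff_kernel_def norm_divide intro!: divide_left_mono mult_pos_pos)

lemma integrable_cutoff_kernel: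
  assumes "sets M = sets borel" "finite_measure M" "0 < s"
  shows "integrable M (\<lambda>y. cutoff_kernel s t (x - y))"
proof -
  note assms(1)[measurable_cong]
  show ?thesis
    by (rule finite_measure.integrable_const_bound[OF assms(2), of _ "1 / s"])
       (use norm_cutoff_kernel_le[OF assms(3)] in auto)
qed

lemma measurable_trunc_cauchy:
  assumes "sets M = sets borel" "finite_measure M"
  shows "trunc_cauchy M s t \<in> borel_measurable borel"
proof -
  note assms(1)[measurable_cong]
  interpret finite_measure M by fact
  show ?thesis unfolding trunc_cauchy_def by measurable
qed

lemma integral_annulus_le:
  fixes x :: complex
  assumes M: "sets M = sets borel" "finite_measure M" and s: "0 < s" and g: "0 \<le> g"
    and growth: "\<And>i. i < n \<Longrightarrow> measure M (ball x (2 ^ Suc i * s)) \<le> g * (2 ^ Suc i * s)"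
  shows "(LINT y|M. (if s \<le> cmod (x - y) \<and> cmod (x - y) < 2 ^ n * s then 1 / cmod (x - y) else 0)) \<le> 2 * g * real n"
  using growth
proof (induction n)
  case 0
  have "(LINT y|M. (if s \<le> cmod (x - y) \<and> cmod (x - y) < 2 ^ 0 * s then 1 / cmod (x - y) else 0)) = (LINT y|M. 0)"
    by (intro Bochner_Integration.integral_cong) auto
  then show ?case by simp
next
  case (Suc n)
  note M(1)[measurable_cong]
  interpret finite_measure M by fact
  have [measurable]: "ball x r \<in> sets M" for r unfolding M(1) by simp
  define r where "r = 2 ^ n * s"
  have r: "0 < r" "s \<le> r" using s by (auto simp: r_def)
  have r2: "2 ^ Suc n * s = 2 * r" by (simp add: r_def)
  let ?f = "\<lambda>a b y. if a \<le> cmod (x - y) \<and> cmod (x - y) < b then 1 / cmod (x - y) else 0"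
  have int: "integrable M (?f a b)" if "0 < a" for a b
    by (rule integrable_const_bound[of _ "1 / a"]) (use that in \<open>auto intro!: frac_le\<close>)
  have "(LINT y|M. ?f s (2 * r) y) = (LINT y|M. ?f s r y + ?f r (2 * r) y)"
    using r by (intro Bochner_Integration.integral_cong) auto
  also have "\<dots> = (LINT y|M. ?f s r y) + (LINT y|M. ?f r (2 * r) y)"
    by (intro Bochner_Integration.integral_add int s r)
  also have "(LINT y|M. ?f r (2 * r) y) \<le> (LINT y|M. 1 / r * indicator (ball x (2 * r)) y)"
  proof (rule integral_mono[OF int[OF r(1)]])
    show "integrable M (\<lambda>y. 1 / r * indicator (ball x (2 * r)) y)"
      by (rule integrable_const_bound[of _ "1 / r"]) (use r in \<open>auto split: split_indicator\<close>)
    show "?f r (2 * r) y \<le> 1 / r * indicator (ball x (2 * r)) y" for y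
      using r by (auto simp: dist_norm indicator_def intro!: frac_le)
  qed
  also have "(LINT y|M. 1 / r * indicator (ball x (2 * r)) y) = 1 / r * measure M (ball x (2 * r))"
    using M by (simp add: sets_eq_imp_space_eq[OF M(1)])
  also have "\<dots> \<le> 1 / r * (g * (2 * r))"
    using Suc.prems[of n] r by (intro mult_left_mono) (auto simp: r2[symmetric] simp del: power_Suc)
  also have "\<dots> = 2 * g" using r by simp
  finally have "(LINT y|M. ?f s (2 * r) y) \<le> (LINT y|M. ?f s r y) + 2 * g" by simp
  moreover have "(LINT y|M. ?f s r y) \<le> 2 * g * real n"
    unfolding r_def by (rule Suc.IH) (use Suc.prems in auto)
  ultimately show ?case unfolding r2 by (simp add: algebra_simps)
qed

lemma Re_inverse_mult_cnj:
  fixes p q r :: complex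
  assumes "p + q + r = 0" "p \<noteq> 0" "r \<noteq> 0"
  shows "Re (1 / p * cnj (1 / r)) = ((cmod q)\<^sup>2 - (cmod p)\<^sup>2 - (cmod r)\<^sup>2) / (2 * (cmod p)\<^sup>2 * (cmod r)\<^sup>2)"
proof -
  have q: "q = - p - r" using assms(1) by (simp add: eq_neg_iff_add_eq_0 algebra_simps)
  have nz: "(cmod p)\<^sup>2 \<noteq> 0" "(cmod r)\<^sup>2 \<noteq> 0" using assms by auto
  have "1 / p = cnj p / of_real ((cmod p)\<^sup>2)" "cnj (1 / r) = r / of_real ((cmod r)\<^sup>2)"
    using assms by (simp_all add: complex_norm_square field_simps del: of_real_power)
  then have "Re (1 / p * cnj (1 / r)) = Re (cnj p * r) / ((cmod p)\<^sup>2 * (cmod r)\<^sup>2)"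
    by (simp add: Re_divide_of_real flip: of_real_mult of_real_power)
  also have "Re (cnj p * r) = ((cmod q)\<^sup>2 - (cmod p)\<^sup>2 - (cmod r)\<^sup>2) / 2"
    unfolding cmod_power2 q by (simp add: power2_eq_square algebra_simps)
  finally show ?thesis by (simp add: field_simps)
qed

text \<open>
  For the differences \<open>p\<close>, \<open>q\<close>, \<open>r\<close> of three points the left-hand side is half the squared Menger curvature,
  that is, half the inverse square of the circumradius. The cancellation over the three vertices leaves a bound by
  the inverse square of any one side, whereas each single term is only bounded by the inverse product of two sides.
\<close>

lemma curvature_bound:
  fixes p q r :: complex
  assumes "p + q + r = 0" and nz: "p \<noteq> 0" "q \<noteq> 0" "r \<noteq> 0"
  shows "- Re (1 / p * cnj (1 / r)) - Re (1 / q * cnj (1 / p)) - Re (1 / r * cnj (1 / q)) \<le> 2 / (cmod p)\<^sup>2"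
proof -
  define P Q R where "P = (cmod p)\<^sup>2" "Q = (cmod q)\<^sup>2" "R = (cmod r)\<^sup>2"
  have pos: "0 < P" "0 < Q" "0 < R" using nz by (auto simp: P_Q_R_def)
  have "Re (1 / p * cnj (1 / r)) = (Q - P - R) / (2 * P * R)"
    using Re_inverse_mult_cnj[of p q r] assms by (simp add: P_Q_R_def)
  moreover have "Re (1 / q * cnj (1 / p)) = (R - Q - P) / (2 * Q * P)"
    using Re_inverse_mult_cnj[of q r p] assms by (simp add: P_Q_R_def add_ac)
  moreover have "Re (1 / r * cnj (1 / q)) = (P - R - Q) / (2 * R * Q)"
    using Re_inverse_mult_cnj[of r p q] assms by (simp add: P_Q_R_def add_ac)
  moreover have "2 / P - (- ((Q - P - R) / (2 * P * R)) - (R - Q - P) / (2 * Q * P) - (P - R - Q) / (2 * R * Q))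
      = (Q + R - P)\<^sup>2 / (2 * P * Q * R)"
    using pos by (simp add: field_simps power2_eq_square)
  moreover have "0 \<le> (Q + R - P)\<^sup>2 / (2 * P * Q * R)" using pos by simp
  ultimately have "- Re (1 / p * cnj (1 / r)) - Re (1 / q * cnj (1 / p)) - Re (1 / r * cnj (1 / q)) \<le> 2 / P"
    by linarith
  then show ?thesis by (simp only: P_Q_R_def)
qed


section \<open>Symmetrization\<close>

text \<open>
  The integrand of the triple integral that expands the square of the \<open>L\<^sup>2\<close> norm of a truncated Cauchy integral.
\<close>

definition triple_kernel :: "real \<Rightarrow> real \<Rightarrow> complex \<Rightarrow> complex \<Rightarrow> complex \<Rightarrow> real" where
  "triple_kernel s t x y z = Re (cutoff_kernel s t (x - y) * cnj (cutoff_kernel s t (x - z)))"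

text \<open>
  Two majorants. The first one handles triples in which all distances that occur are in the range of the cutoff or
  below it: there the sum over the vertices is at most a multiple of the inverse square of the
  largest distance. The second one handles the triples in which the sharp outer cutoff removes exactly one of the three
  distances and so destroys the cancellation.
\<close>

definition near_majorant :: "real \<Rightarrow> real \<Rightarrow> complex \<Rightarrow> complex \<Rightarrow> complex \<Rightarrow> real" where
  "near_majorant s t x y z =
     (if s \<le> cmod (x - y) \<and> cmod (x - y) < t \<and> cmod (x - z) \<le> cmod (x - y) then 2 / (cmod (x - y))\<^sup>2 else 0)"

definition far_majorant :: "real \<Rightarrow> real \<Rightarrow> complex \<Rightarrow> complex \<Rightarrow> complex \<Rightarrow> real" where
  "far_majorant s t x y z =
     (if s \<le> cmod (x - y) \<and> cmod (x - y) < t \<and> cmod (x - z) < t then 2 / (t * cmod (x - y)) else 0)"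

definition triple_majorant :: "real \<Rightarrow> real \<Rightarrow> complex \<Rightarrow> complex \<Rightarrow> complex \<Rightarrow> real" where
  "triple_majorant s t x y z =
     near_majorant s t x y z + near_majorant s t x z y + far_majorant s t x y z + far_majorant s t x z y"

lemma near_majorant_nonneg [simp]: "0 \<le> near_majorant s t x y z"
  by (simp add: near_majorant_def)

lemma far_majorant_nonneg [simp]: "0 < t \<Longrightarrow> 0 \<le> far_majorant s t x y z"
  by (simp add: far_majorant_def)

lemma triple_majorant_nonneg: "0 < t \<Longrightarrow> 0 \<le> triple_majorant s t x y z"
  by (simp add: triple_majorant_def)

lemma triple_kernel_sum_all_in_range:
  assumes s: "0 < s" and t: "0 < t"
    and rng: "s \<le> cmod (x - y)" "cmod (x - y) < t" "s \<le> cmod (y - z)" "cmod (y - z) < t"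
      "s \<le> cmod (z - x)" "cmod (z - x) < t"
  shows "triple_kernel s t x y z + triple_kernel s t y z x + triple_kernel s t z x y
     \<le> triple_majorant s t x y z + triple_majorant s t y z x + triple_majorant s t z x y"
proof -
  define p q r where "p = x - y" "q = y - z" "r = z - x"
  have sum0: "p + q + r = 0" "q + r + p = 0" "r + p + q = 0" by (simp_all add: p_q_r_def)
  have nz: "p \<noteq> 0" "q \<noteq> 0" "r \<noteq> 0" using rng s by (auto simp: p_q_r_def)
  have neg: "x - z = - r" "y - x = - p" "z - y = - q" by (simp_all add: p_q_r_def)
  let ?S = "triple_kernel s t x y z + triple_kernel s t y z x + triple_kernel s t z x y"
  have k: "cutoff_kernel s t p = 1 / p" "cutoff_kernel s t q = 1 / q" "cutoff_kernel s t r = 1 / r"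
       "cutoff_kernel s t (- p) = - (1 / p)" "cutoff_kernel s t (- q) = - (1 / q)" "cutoff_kernel s t (- r) = - (1 / r)"
    using rng unfolding p_q_r_def[symmetric] by (simp_all add: cutoff_kernel_def)
  have "triple_kernel s t x y z = - Re (1 / p * cnj (1 / r))"
       "triple_kernel s t y z x = - Re (1 / q * cnj (1 / p))"
       "triple_kernel s t z x y = - Re (1 / r * cnj (1 / q))"
    unfolding triple_kernel_def neg p_q_r_def[symmetric] k by simp_all
  then have S: "?S = - Re (1 / p * cnj (1 / r)) - Re (1 / q * cnj (1 / p)) - Re (1 / r * cnj (1 / q))"
    by linarith
  have le: "?S \<le> 2 / (cmod p)\<^sup>2" "?S \<le> 2 / (cmod q)\<^sup>2" "?S \<le> 2 / (cmod r)\<^sup>2"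
    using curvature_bound[of p q r] curvature_bound[of q r p] curvature_bound[of r p q] sum0 nz
    unfolding S by linarith+
  have nn: "0 \<le> triple_majorant s t u v w" for u v w using t by (rule triple_majorant_nonneg)
  have ge: "near_majorant s t u v w \<le> triple_majorant s t u v w" "near_majorant s t u w v \<le> triple_majorant s t u v w" for u v w
    using t by (simp_all add: triple_majorant_def)
  have sym: "cmod (x - z) = cmod r" "cmod (y - x) = cmod p" "cmod (z - y) = cmod q"
    unfolding neg by simp_all
  consider "cmod q \<le> cmod p" "cmod r \<le> cmod p" | "cmod p \<le> cmod q" "cmod r \<le> cmod q" | "cmod p \<le> cmod r" "cmod q \<le> cmod r"
    by linarith
  then show ?thesis
  proof cases
    case 1
    then have "near_majorant s t x y z = 2 / (cmod p)\<^sup>2"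
      using rng unfolding near_majorant_def sym p_q_r_def[symmetric] by simp
    then show ?thesis using le(1) ge(1)[of x y z] nn[of y z x] nn[of z x y] by linarith
  next
    case 2
    then have "near_majorant s t y z x = 2 / (cmod q)\<^sup>2"
      using rng unfolding near_majorant_def sym p_q_r_def[symmetric] by simp
    then show ?thesis using le(2) ge(1)[of y z x] nn[of x y z] nn[of z x y] by linarith
  next
    case 3
    then have "near_majorant s t z x y = 2 / (cmod r)\<^sup>2"
      using rng unfolding near_majorant_def sym p_q_r_def[symmetric] by simp
    then show ?thesis using le(3) ge(1)[of z x y] nn[of y z x] nn[of x y z] by linarith
  qed
qed

text \<open>
  If the side opposite to \<open>x\<close> is cut off, only the term with vertex \<open>x\<close> survives. If that side is
  short, the inverse of the product of the other two is at most the sum of their inverse squares, each of which is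
  part of a majorant; if it is long, the other two have sum at least \<open>t\<close>.
\<close>

lemma triple_kernel_sum_out_of_range:
  assumes s: "0 < s" and t: "0 < t" and out: "\<not> (s \<le> cmod (y - z) \<and> cmod (y - z) < t)"
  shows "triple_kernel s t x y z + triple_kernel s t y z x + triple_kernel s t z x y
     \<le> triple_majorant s t x y z + triple_majorant s t y z x + triple_majorant s t z x y"
proof -
  have "cutoff_kernel s t (y - z) = 0" "cutoff_kernel s t (z - y) = 0"
    using out by (auto simp: cutoff_kernel_def norm_minus_commute)
  then have S: "triple_kernel s t x y z + triple_kernel s t y z x + triple_kernel s t z x y = triple_kernel s t x y z"
    by (simp add: triple_kernel_def)
  have nn: "0 \<le> triple_majorant s t u v w" for u v w using t by (rule triple_majorant_nonneg)
  have sym: "cmod (y - x) = cmod (x - y)" "cmod (z - x) = cmod (x - z)" "cmod (z - y) = cmod (y - z)"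
    by (simp_all add: norm_minus_commute)
  define b c a where "b = cmod (x - z)" "c = cmod (x - y)" "a = cmod (y - z)"
  note defs = b_c_a_def[symmetric]
  show ?thesis
  proof (cases "s \<le> c \<and> c < t \<and> s \<le> b \<and> b < t")
    case False
    then have "triple_kernel s t x y z = 0"
      by (auto simp: triple_kernel_def cutoff_kernel_def b_c_a_def)
    then show ?thesis unfolding S using nn[of x y z] nn[of y z x] nn[of z x y] by linarith
  next
    case True
    then have pos: "0 < b" "0 < c" using s by auto
    have "triple_kernel s t x y z \<le> cmod (cutoff_kernel s t (x - y) * cnj (cutoff_kernel s t (x - z)))"
      unfolding triple_kernel_def by (rule complex_Re_le_cmod)
    also have "\<dots> = 1 / (c * b)"
      using True unfolding norm_mult complex_mod_cnj
      by (simp add: cutoff_kernel_def norm_divide b_c_a_def)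
    finally have Q: "triple_kernel s t x y z \<le> 1 / (c * b)" .
    show ?thesis
    proof (cases "a < s")
      case a: True
      have "near_majorant s t y x z = 2 / c\<^sup>2"
        using True a unfolding near_majorant_def sym defs by simp
      moreover have "near_majorant s t y x z \<le> triple_majorant s t y z x"
        using t by (simp add: triple_majorant_def)
      moreover have "near_majorant s t z x y = 2 / b\<^sup>2"
        using True a unfolding near_majorant_def sym defs by simp
      moreover have "near_majorant s t z x y \<le> triple_majorant s t z x y"
        using t by (simp add: triple_majorant_def)
      moreover have "1 / (c * b) \<le> 2 / c\<^sup>2 + 2 / b\<^sup>2"
      proof -
        have "0 \<le> (1 / c - 1 / b)\<^sup>2" by simp
        then have "2 * (1 / c * (1 / b)) \<le> 1 / c\<^sup>2 + 1 / b\<^sup>2"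
          by (simp add: power2_diff power_divide)
        moreover have "0 \<le> 1 / c\<^sup>2" "0 \<le> 1 / b\<^sup>2" "0 \<le> 1 / c * (1 / b)" using pos by simp_all
        moreover have "2 / c\<^sup>2 = 2 * (1 / c\<^sup>2)" "2 / b\<^sup>2 = 2 * (1 / b\<^sup>2)" "1 / (c * b) = 1 / c * (1 / b)" by simp_all
        ultimately show ?thesis by linarith
      qed
      ultimately show ?thesis unfolding S using Q nn[of x y z] by linarith
    next
      case False
      then have a: "t \<le> a" using out unfolding defs by simp
      have "a \<le> b + c"
        unfolding b_c_a_def using norm_triangle_ineq[of "y - x" "x - z"] by (simp add: sym)
      then have bc: "t \<le> b + c" using a by linarith
      have "far_majorant s t x y z = 2 / (t * c)" "far_majorant s t x z y = 2 / (t * b)"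
        using True unfolding far_majorant_def defs by simp_all
      then have "2 / (t * c) + 2 / (t * b) \<le> triple_majorant s t x y z"
        using t by (simp add: triple_majorant_def)
      moreover have "2 / (t * c) + 2 / (t * b) = 2 * (b + c) / t * (1 / (c * b))"
        using pos t by (simp add: field_simps)
      moreover have "1 * (1 / (c * b)) \<le> 2 * (b + c) / t * (1 / (c * b))"
      proof (rule mult_right_mono)
        have "t \<le> 2 * (b + c)" by (rule order_trans[OF bc]) (use pos in simp)
        then show "1 \<le> 2 * (b + c) / t" using t by simp
      qed (use pos in simp)
      ultimately show ?thesis unfolding S using Q nn[of y z x] nn[of z x y] by linarith
    qed
  qed
qed

text \<open>
  Only the sum over the three rotations is controlled, never the triple kernel itself.
\<close>

lemma triple_kernel_sum_le:
  assumes s: "0 < s" and t: "0 < t"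
  shows "triple_kernel s t x y z + triple_kernel s t y z x + triple_kernel s t z x y
     \<le> triple_majorant s t x y z + triple_majorant s t y z x + triple_majorant s t z x y"
proof -
  define rng where "rng u \<longleftrightarrow> s \<le> cmod u \<and> cmod u < t" for u
  consider "rng (x - y)" "rng (y - z)" "rng (z - x)" | "\<not> rng (y - z)" | "\<not> rng (z - x)" | "\<not> rng (x - y)" by blast
  then show ?thesis
  proof cases
    case 1
    then show ?thesis using triple_kernel_sum_all_in_range[OF s t, of x y z] by (simp add: rng_def)
  next
    case 2
    then show ?thesis using triple_kernel_sum_out_of_range[OF s t, of y z x] by (simp add: rng_def)
  next
    case 3
    then show ?thesis using triple_kernel_sum_out_of_range[OF s t, of z x y] by (simp add: rng_def)
  next
    case 4
    then show ?thesis using triple_kernel_sum_out_of_range[OF s t, of x y z] by (simp add: rng_def)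
  qed
qed

lemma measurable_triple_compose:
  fixes F :: "complex \<Rightarrow> complex \<Rightarrow> complex \<Rightarrow> real"
  assumes F: "(\<lambda>p. F (fst p) (fst (snd p)) (snd (snd p))) \<in> borel_measurable (borel \<Otimes>\<^sub>M (borel \<Otimes>\<^sub>M borel))"
    and [measurable]: "f \<in> borel_measurable N" "g \<in> borel_measurable N" "h \<in> borel_measurable N"
  shows "(\<lambda>p. F (f p) (g p) (h p)) \<in> borel_measurable N"
proof -
  have "(\<lambda>p. (f p, g p, h p)) \<in> N \<rightarrow>\<^sub>M borel \<Otimes>\<^sub>M (borel \<Otimes>\<^sub>M borel)" by measurable
  from measurable_compose[OF this F] show ?thesis by simp
qed

lemma triple_integral:
  fixes F :: "complex \<Rightarrow> complex \<Rightarrow> complex \<Rightarrow> real"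
  assumes M: "sets M = sets borel" "finite_measure M"
    and F: "(\<lambda>p. F (fst p) (fst (snd p)) (snd (snd p))) \<in> borel_measurable (borel \<Otimes>\<^sub>M (borel \<Otimes>\<^sub>M borel))"
    and B: "\<And>x y z. \<bar>F x y z\<bar> \<le> B"
  shows "integrable (M \<Otimes>\<^sub>M (M \<Otimes>\<^sub>M M)) (\<lambda>p. F (fst p) (fst (snd p)) (snd (snd p)))"
    and "(LINT p|(M \<Otimes>\<^sub>M (M \<Otimes>\<^sub>M M)). F (fst p) (fst (snd p)) (snd (snd p))) = (LINT x|M. LINT y|M. LINT z|M. F x y z)"
    and "(LINT x|M. LINT y|M. LINT z|M. F x z y) = (LINT x|M. LINT y|M. LINT z|M. F x y z)"
    and "(LINT x|M. LINT y|M. LINT z|M. F y x z) = (LINT x|M. LINT y|M. LINT z|M. F x y z)"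
proof -
  interpret finite_measure M by fact
  note M(1)[measurable_cong]
  interpret P2: pair_sigma_finite M M ..
  interpret F2: finite_measure "M \<Otimes>\<^sub>M M" by (rule finite_measure_pair_measure) unfold_locales
  interpret P3: pair_sigma_finite M "M \<Otimes>\<^sub>M M" ..
  interpret F3: finite_measure "M \<Otimes>\<^sub>M (M \<Otimes>\<^sub>M M)" by (rule finite_measure_pair_measure) unfold_locales
  note Fx [measurable] = measurable_triple_compose[OF F]
  show int3: "integrable (M \<Otimes>\<^sub>M (M \<Otimes>\<^sub>M M)) (\<lambda>p. F (fst p) (fst (snd p)) (snd (snd p)))"
    by (rule F3.integrable_const_bound[of _ B]) (use B in auto)
  have int2: "integrable (M \<Otimes>\<^sub>M M) (\<lambda>(y, z). F x y z)" for x
    by (rule F2.integrable_const_bound[of _ B]) (use B in auto)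
  have inner: "(LINT q|(M \<Otimes>\<^sub>M M). F x (fst q) (snd q)) = (LINT y|M. LINT z|M. F x y z)" for x
    using P2.integral_fst'[OF int2[of x]] by (simp add: split_beta')
  show "(LINT p|(M \<Otimes>\<^sub>M (M \<Otimes>\<^sub>M M)). F (fst p) (fst (snd p)) (snd (snd p))) = (LINT x|M. LINT y|M. LINT z|M. F x y z)"
    using P3.integral_fst'[OF int3] by (simp add: inner)
  show "(LINT x|M. LINT y|M. LINT z|M. F x z y) = (LINT x|M. LINT y|M. LINT z|M. F x y z)"
    by (intro Bochner_Integration.integral_cong refl P2.Fubini_integral[of "F _"] int2)
  have bound: "\<bar>LINT z|M. F x y z\<bar> \<le> B * measure M (space M)" for x y
  proof -
    have "norm (LINT z|M. F x y z) \<le> (LINT z|M. B)"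
      by (rule Bochner_Integration.integral_norm_bound_integral)
         (auto intro!: integrable_const_bound[of _ B] simp: B)
    then show ?thesis by (simp add: mult.commute)
  qed
  have "integrable (M \<Otimes>\<^sub>M M) (\<lambda>(x, y). LINT z|M. F x y z)"
    by (rule F2.integrable_const_bound[of _ "B * measure M (space M)"]) (use bound in auto)
  then show "(LINT x|M. LINT y|M. LINT z|M. F y x z) = (LINT x|M. LINT y|M. LINT z|M. F x y z)"
    by (rule P2.Fubini_integral)
qed

lemma measurable_triple_kernel:
  "(\<lambda>p. triple_kernel s t (fst p) (fst (snd p)) (snd (snd p))) \<in> borel_measurable (borel \<Otimes>\<^sub>M (borel \<Otimes>\<^sub>M borel))"
  unfolding triple_kernel_def times_complex.sel cnj.sel by measurable

lemma measurable_near_majorant: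
  "(\<lambda>p. near_majorant s t (fst p) (fst (snd p)) (snd (snd p))) \<in> borel_measurable (borel \<Otimes>\<^sub>M (borel \<Otimes>\<^sub>M borel))"
  unfolding near_majorant_def by measurable

lemma measurable_far_majorant:
  "(\<lambda>p. far_majorant s t (fst p) (fst (snd p)) (snd (snd p))) \<in> borel_measurable (borel \<Otimes>\<^sub>M (borel \<Otimes>\<^sub>M borel))"
  unfolding far_majorant_def by measurable

lemma abs_triple_kernel_le: assumes "0 < s" shows "\<bar>triple_kernel s t x y z\<bar> \<le> (1 / s)\<^sup>2"
proof -
  have "\<bar>triple_kernel s t x y z\<bar> \<le> cmod (cutoff_kernel s t (x - y)) * cmod (cutoff_kernel s t (x - z))"
    unfolding triple_kernel_def using abs_Re_le_cmod[of "cutoff_kernel s t (x - y) * cnj (cutoff_kernel s t (x - z))"]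
    by (simp only: norm_mult complex_mod_cnj)
  also have "\<dots> \<le> 1 / s * (1 / s)"
    using assms by (intro mult_mono norm_cutoff_kernel_le) auto
  finally show ?thesis by (simp add: power2_eq_square)
qed

lemma abs_near_majorant_le: assumes "0 < s" shows "\<bar>near_majorant s t x y z\<bar> \<le> 2 / s\<^sup>2"
  using assms by (auto simp: near_majorant_def intro!: divide_left_mono power_mono mult_pos_pos)

lemma abs_far_majorant_le: assumes "0 < s" "0 < t" shows "\<bar>far_majorant s t x y z\<bar> \<le> 2 / (t * s)"
proof -
  have "2 / (t * cmod (x - y)) \<le> 2 / (t * s)" if "s \<le> cmod (x - y)"
    using assms that by (intro divide_left_mono mult_left_mono mult_pos_pos) auto
  then show ?thesis using assms by (auto simp: far_majorant_def)
qed

lemma norm_trunc_cauchy_sq: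
  assumes M: "sets M = sets borel" "finite_measure M" and s: "0 < s"
  shows "(cmod (trunc_cauchy M s t x))\<^sup>2 = (LINT y|M. LINT z|M. triple_kernel s t x y z)"
proof -
  interpret finite_measure M by fact
  note M(1)[measurable_cong]
  note int = integrable_cutoff_kernel[OF M s]
  have intc: "integrable M (\<lambda>z. cnj (cutoff_kernel s t (x - z)))"
    using int by simp
  have "complex_of_real ((cmod (trunc_cauchy M s t x))\<^sup>2) = trunc_cauchy M s t x * cnj (trunc_cauchy M s t x)"
    by (rule complex_norm_square)
  also have "\<dots> = (LINT y|M. cutoff_kernel s t (x - y) * cnj (trunc_cauchy M s t x))"
    unfolding trunc_cauchy_def by (rule integral_mult_left_zero[symmetric])
  finally have "(cmod (trunc_cauchy M s t x))\<^sup>2 = Re (LINT y|M. cutoff_kernel s t (x - y) * cnj (trunc_cauchy M s t x))"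
    by (metis Re_complex_of_real)
  also have "\<dots> = (LINT y|M. Re (cutoff_kernel s t (x - y) * cnj (trunc_cauchy M s t x)))"
    by (rule integral_Re[symmetric]) (rule integrable_mult_left, rule int)
  also have "\<dots> = (LINT y|M. LINT z|M. triple_kernel s t x y z)"
  proof (rule Bochner_Integration.integral_cong[OF refl])
    fix y
    have "cutoff_kernel s t (x - y) * cnj (trunc_cauchy M s t x) = (LINT z|M. cutoff_kernel s t (x - y) * cnj (cutoff_kernel s t (x - z)))"
      unfolding trunc_cauchy_def by simp
    also have "Re \<dots> = (LINT z|M. Re (cutoff_kernel s t (x - y) * cnj (cutoff_kernel s t (x - z))))"
      by (rule integral_Re[symmetric]) (rule integrable_mult_right, rule intc)
    finally show "Re (cutoff_kernel s t (x - y) * cnj (trunc_cauchy M s t x)) = (LINT z|M. triple_kernel s t x y z)"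
      by (simp add: triple_kernel_def)
  qed
  finally show ?thesis .
qed

text \<open>
  A triple integral does not change when the variables are permuted, so it is one third of the
  integral of the sum over the rotations, to which the pointwise bound applies.
\<close>

lemma triple_kernel_integral_le:
  assumes M: "sets M = sets borel" "finite_measure M" and s: "0 < s" and t: "0 < t"
  shows "(LINT x|M. LINT y|M. LINT z|M. triple_kernel s t x y z)
    \<le> 2 * (LINT x|M. LINT y|M. LINT z|M. near_majorant s t x y z)
     + 2 * (LINT x|M. LINT y|M. LINT z|M. far_majorant s t x y z)"
proof -
  let ?P = "M \<Otimes>\<^sub>M (M \<Otimes>\<^sub>M M)"
  let ?I = "\<lambda>F :: complex \<Rightarrow> complex \<Rightarrow> complex \<Rightarrow> real. LINT p|?P. F (fst p) (fst (snd p)) (snd (snd p))"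
  let ?J = "\<lambda>F :: complex \<Rightarrow> complex \<Rightarrow> complex \<Rightarrow> real. LINT x|M. LINT y|M. LINT z|M. F x y z"
  let ?m = "\<lambda>F. (\<lambda>p. F (fst p) (fst (snd p)) (snd (snd p))) \<in> borel_measurable (borel \<Otimes>\<^sub>M (borel \<Otimes>\<^sub>M borel))"
  define adm where "adm F \<longleftrightarrow> ?m F \<and> (\<exists>B. \<forall>x y z. \<bar>F x y z\<bar> \<le> B)" for F :: "complex \<Rightarrow> complex \<Rightarrow> complex \<Rightarrow> real"
  have admE: "integrable ?P (\<lambda>p. F (fst p) (fst (snd p)) (snd (snd p)))" "?I F = ?J F"
      "?J (\<lambda>x y z. F x z y) = ?J F" "?J (\<lambda>x y z. F y x z) = ?J F" if F: "adm F" for F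
  proof -
    obtain B where B: "?m F" "\<And>x y z. \<bar>F x y z\<bar> \<le> B" using F unfolding adm_def by blast
    show "integrable ?P (\<lambda>p. F (fst p) (fst (snd p)) (snd (snd p)))" "?I F = ?J F"
      "?J (\<lambda>x y z. F x z y) = ?J F" "?J (\<lambda>x y z. F y x z) = ?J F"
      using triple_integral[OF M B] by blast+
  qed
  have adm_swap: "adm (\<lambda>x y z. F x z y)" if "adm F" for F
  proof -
    have "?m (\<lambda>x y z. F x z y)"
      using measurable_triple_compose[of F, where N = "borel \<Otimes>\<^sub>M (borel \<Otimes>\<^sub>M borel)" and f = fst and g = "\<lambda>p. snd (snd p)" and h = "\<lambda>p. fst (snd p)"] that
      by (simp add: adm_def)
    then show ?thesis using that unfolding adm_def by blast
  qed
  have adm_rot: "adm (\<lambda>x y z. F y z x)" if "adm F" for F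
  proof -
    have "?m (\<lambda>x y z. F y z x)"
      using measurable_triple_compose[of F, where N = "borel \<Otimes>\<^sub>M (borel \<Otimes>\<^sub>M borel)" and h = fst and g = "\<lambda>p. snd (snd p)" and f = "\<lambda>p. fst (snd p)"] that
      by (simp add: adm_def)
    then show ?thesis using that unfolding adm_def by blast
  qed
  have J_swap: "?J (\<lambda>x y z. F x z y) = ?J F" if "adm F" for F using admE(3)[OF that] .
  have J_rot: "?J (\<lambda>x y z. F y z x) = ?J F" if "adm F" for F
    using admE(4)[OF adm_swap[OF that]] admE(3)[OF that] by simp
  have I_rot: "?I (\<lambda>x y z. F y z x) = ?I F" if "adm F" for F
    using admE(2)[OF that] admE(2)[OF adm_rot[OF that]] J_rot[OF that] by simp
  have aK: "adm (triple_kernel s t)"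
    using measurable_triple_kernel abs_triple_kernel_le[OF s] unfolding adm_def by blast
  have aN: "adm (near_majorant s t)"
    using measurable_near_majorant abs_near_majorant_le[OF s] unfolding adm_def by blast
  have aF: "adm (far_majorant s t)"
    using measurable_far_majorant abs_far_majorant_le[OF s t] unfolding adm_def by blast
  note aN' = adm_swap[OF aN] and aF' = adm_swap[OF aF]
  have aM: "adm (triple_majorant s t)"
  proof -
    have "?m (triple_majorant s t)"
      using aN aN' aF aF' unfolding adm_def triple_majorant_def
      by (auto intro!: borel_measurable_add)
    moreover have "\<bar>triple_majorant s t x y z\<bar> \<le> 2 / s\<^sup>2 + 2 / s\<^sup>2 + 2 / (t * s) + 2 / (t * s)" for x y z
      unfolding triple_majorant_def
      using abs_near_majorant_le[OF s, of t x y z] abs_near_majorant_le[OF s, of t x z y]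
        abs_far_majorant_le[OF s t, of x y z] abs_far_majorant_le[OF s t, of x z y] by (simp only: abs_le_iff) linarith
    ultimately show ?thesis unfolding adm_def by blast
  qed
  have IM: "?I (triple_majorant s t) = 2 * ?J (near_majorant s t) + 2 * ?J (far_majorant s t)"
  proof -
    have "?I (triple_majorant s t) = ?I (near_majorant s t) + ?I (\<lambda>x y z. near_majorant s t x z y)
        + ?I (far_majorant s t) + ?I (\<lambda>x y z. far_majorant s t x z y)"
      unfolding triple_majorant_def
      using admE(1)[OF aN] admE(1)[OF aN'] admE(1)[OF aF] admE(1)[OF aF'] by simp
    then show ?thesis using admE(2)[OF aN] admE(2)[OF aN'] admE(2)[OF aF] admE(2)[OF aF']
        J_swap[OF aN] J_swap[OF aF] by simp
  qed
  have sum3: "?I (\<lambda>x y z. F x y z + F y z x + F z x y) = 3 * ?I F \<and>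
      integrable ?P (\<lambda>p. F (fst p) (fst (snd p)) (snd (snd p)) + F (fst (snd p)) (snd (snd p)) (fst p) + F (snd (snd p)) (fst p) (fst (snd p)))" if F: "adm F" for F
  proof -
    note F1 = adm_rot[OF F] note F2 = adm_rot[OF F1]
    have "?I (\<lambda>x y z. F x y z + F y z x + F z x y) = ?I F + ?I (\<lambda>x y z. F y z x) + ?I (\<lambda>x y z. F z x y)"
      using admE(1)[OF F] admE(1)[OF F1] admE(1)[OF F2] by simp
    also have "?I (\<lambda>x y z. F z x y) = ?I F" using I_rot[OF F1] I_rot[OF F] by simp
    finally show ?thesis using I_rot[OF F] admE(1)[OF F] admE(1)[OF F1] admE(1)[OF F2]
      by simp
  qed
  have "3 * ?I (triple_kernel s t) \<le> 3 * ?I (triple_majorant s t)"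
    unfolding sum3[OF aK, THEN conjunct1, symmetric] sum3[OF aM, THEN conjunct1, symmetric]
    using sum3[OF aK] sum3[OF aM] triple_kernel_sum_le[OF s t]
    by (intro integral_mono) auto
  then show ?thesis using admE(2)[OF aK] IM by simp
qed


section \<open>The quadratic estimate and its weak type consequence\<close>

lemma integral_near_majorant_le:
  assumes M: "sets M = sets borel" "finite_measure M" and s: "0 < s" and g: "0 \<le> g" and t: "t = 2 ^ n * s"
    and growth: "\<And>x r. s \<le> r \<Longrightarrow> r \<le> 2 * t \<Longrightarrow> measure M (ball x r) \<le> g * r"
  shows "(LINT x|M. LINT y|M. LINT z|M. near_majorant s t x y z) \<le> 8 * g\<^sup>2 * real n * measure M UNIV"
    and "(LINT x|M. LINT y|M. LINT z|M. far_majorant s t x y z) \<le> 4 * g\<^sup>2 * real n * measure M UNIV"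
proof -
  interpret finite_measure M by fact
  note M(1)[measurable_cong]
  have sp: "space M = UNIV" using sets_eq_imp_space_eq[OF M(1)] by simp
  have t0: "0 < t" "s \<le> t" using s by (auto simp: t)
  define R where "R x y = (if s \<le> cmod (x - y) \<and> cmod (x - y) < t then 1 / cmod (x - y) else 0)" for x y
  have R0: "0 \<le> R x y" for x y by (simp add: R_def)
  have R_meas [measurable]: "(\<lambda>y. R x y) \<in> borel_measurable M" for x unfolding R_def by measurable
  have R_int: "integrable M (\<lambda>y. R x y)" for x
    by (rule integrable_const_bound[of _ "1 / s"]) (use s in \<open>auto simp: R_def intro!: frac_le\<close>)
  have R_le: "(LINT y|M. R x y) \<le> 2 * g * real n" for x
    unfolding R_def t
  proof (rule integral_annulus_le[OF M s g])
    fix i assume i: "i < n"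
    have "(2::real) ^ Suc i \<le> 2 ^ n" using i by (intro power_increasing) auto
    then have "2 ^ Suc i * s \<le> 2 * t" using s unfolding t by (simp add: mult_right_mono order_trans[of _ "2 ^ n * s"])
    moreover have "1 * s \<le> 2 ^ Suc i * s" by (intro mult_right_mono one_le_power) (use s in auto)
    ultimately show "measure M (ball x (2 ^ Suc i * s)) \<le> g * (2 ^ Suc i * s)" by (intro growth) auto
  qed
  have c_int: "integrable M (\<lambda>x. c * indicator A x)" if "A \<in> sets M" for c :: real and A
    using that by (intro integrable_mult_right integrable_real_indicator) (simp_all add: less_top[symmetric])
  have near: "(LINT z|M. near_majorant s t x y z) \<le> 4 * g * R x y" for x y
  proof (cases "s \<le> cmod (x - y) \<and> cmod (x - y) < t")
    case True
    define \<rho> where "\<rho> = cmod (x - y)"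
    have \<rho>: "0 < \<rho>" "s \<le> \<rho>" "\<rho> < t" using True s by (auto simp: \<rho>_def)
    have "(LINT z|M. near_majorant s t x y z) = (LINT z|M. 2 / \<rho>\<^sup>2 * indicator (cball x \<rho>) z)"
      using True unfolding near_majorant_def \<rho>_def[symmetric]
      by (intro Bochner_Integration.integral_cong) (auto simp: dist_norm split: split_indicator)
    also have "\<dots> = 2 / \<rho>\<^sup>2 * measure M (cball x \<rho>)"
      by (simp add: sp)
    also have "measure M (cball x \<rho>) \<le> measure M (ball x (2 * \<rho>))"
    proof (rule finite_measure_mono)
      show "cball x \<rho> \<subseteq> ball x (2 * \<rho>)" using \<rho> by (auto simp: subset_iff)
      show "ball x (2 * \<rho>) \<in> sets M" unfolding M(1) by simp
    qed
    also have "measure M (ball x (2 * \<rho>)) \<le> g * (2 * \<rho>)" using \<rho> by (intro growth) auto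
    finally have "(LINT z|M. near_majorant s t x y z) \<le> 2 / \<rho>\<^sup>2 * (g * (2 * \<rho>))"
      by (simp add: divide_right_mono)
    also have "\<dots> = 4 * g * (1 / \<rho>)" using \<rho> by (simp add: power2_eq_square)
    also have "1 / \<rho> = R x y" using True by (simp add: R_def \<rho>_def)
    finally show ?thesis .
  next
    case False
    then have "near_majorant s t x y z = 0" for z by (auto simp: near_majorant_def)
    then show ?thesis using g R0[of x y] by simp
  qed
  have far: "(LINT z|M. far_majorant s t x y z) \<le> 2 * g * R x y" for x y
  proof (cases "s \<le> cmod (x - y) \<and> cmod (x - y) < t")
    case True
    define \<rho> where "\<rho> = cmod (x - y)"
    have \<rho>: "0 < \<rho>" "s \<le> \<rho>" "\<rho> < t" using True s by (auto simp: \<rho>_def)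
    have "(LINT z|M. far_majorant s t x y z) = (LINT z|M. 2 / (t * \<rho>) * indicator (ball x t) z)"
      using True unfolding far_majorant_def \<rho>_def[symmetric]
      by (intro Bochner_Integration.integral_cong) (auto simp: dist_norm split: split_indicator)
    also have "\<dots> = 2 / (t * \<rho>) * measure M (ball x t)" by (simp add: sp)
    also have "\<dots> \<le> 2 / (t * \<rho>) * (g * t)"
      using \<rho> t0 by (intro mult_left_mono growth) auto
    also have "\<dots> = 2 * g * (1 / \<rho>)" using \<rho> t0 by simp
    also have "1 / \<rho> = R x y" using True by (simp add: R_def \<rho>_def)
    finally show ?thesis .
  next
    case False
    then have "far_majorant s t x y z = 0" for z by (auto simp: far_majorant_def)
    then show ?thesis using g R0[of x y] by simp
  qed
  have step: "(LINT x|M. LINT y|M. LINT z|M. F x y z) \<le> c * (2 * g * real n) * measure M UNIV"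
    if le: "\<And>x y. (LINT z|M. F x y z) \<le> c * R x y" and c: "0 \<le> c" for F :: "complex \<Rightarrow> complex \<Rightarrow> complex \<Rightarrow> real" and c
  proof -
    have "(LINT y|M. LINT z|M. F x y z) \<le> c * (2 * g * real n)" for x
    proof -
      have "(LINT y|M. LINT z|M. F x y z) \<le> (LINT y|M. c * R x y)"
        by (rule integral_mono') (use R_int le R0 c in auto)
      also have "\<dots> = c * (LINT y|M. R x y)" by simp
      also have "\<dots> \<le> c * (2 * g * real n)" by (intro mult_left_mono R_le c)
      finally show ?thesis .
    qed
    then have "(LINT x|M. LINT y|M. LINT z|M. F x y z) \<le> (LINT x|M. c * (2 * g * real n))"
      by (intro integral_mono') (use c g in auto)
    then show ?thesis by (simp add: sp mult_ac)
  qed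
  show "(LINT x|M. LINT y|M. LINT z|M. near_majorant s t x y z) \<le> 8 * g\<^sup>2 * real n * measure M UNIV"
    using step[of "near_majorant s t", OF near] g by (simp add: power2_eq_square mult_ac)
  show "(LINT x|M. LINT y|M. LINT z|M. far_majorant s t x y z) \<le> 4 * g\<^sup>2 * real n * measure M UNIV"
    using step[of "far_majorant s t", OF far] g by (simp add: power2_eq_square mult_ac)
qed

text \<open>
  The bound is quadratic in the density \<open>g\<close> and linear in the number \<open>n\<close> of dyadic scales. Estimating
  the kernel by its absolute value would give \<open>g\<^sup>2 * n\<^sup>2\<close>; with \<open>g\<close> of order \<open>1 / k\<close> this difference
  decides about convergence.
\<close>

lemma trunc_cauchy_L2:
  assumes M: "sets M = sets borel" "finite_measure M" and s: "0 < s" and g: "0 \<le> g" and t: "t = 2 ^ n * s"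
    and growth: "\<And>x r. s \<le> r \<Longrightarrow> r \<le> 2 * t \<Longrightarrow> measure M (ball x r) \<le> g * r"
  shows "(LINT x|M. (cmod (trunc_cauchy M s t x))\<^sup>2) \<le> 24 * g\<^sup>2 * real n * measure M UNIV"
proof -
  have t0: "0 < t" using s by (simp add: t)
  have "(LINT x|M. (cmod (trunc_cauchy M s t x))\<^sup>2) = (LINT x|M. LINT y|M. LINT z|M. triple_kernel s t x y z)"
    by (simp add: norm_trunc_cauchy_sq[OF M s])
  also have "\<dots> \<le> 2 * (8 * g\<^sup>2 * real n * measure M UNIV) + 2 * (4 * g\<^sup>2 * real n * measure M UNIV)"
    using triple_kernel_integral_le[OF M s t0] integral_near_majorant_le[OF M s g t growth] by linarith
  finally show ?thesis by (simp add: mult_ac)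
qed

lemma norm_trunc_cauchy_le:
  assumes M: "sets M = sets borel" "finite_measure M" and s: "0 < s"
  shows "cmod (trunc_cauchy M s t x) \<le> measure M UNIV / s"
proof -
  interpret finite_measure M by fact
  have sp: "space M = UNIV" using sets_eq_imp_space_eq[OF M(1)] by simp
  have "cmod (trunc_cauchy M s t x) \<le> (LINT y|M. 1 / s)"
    unfolding trunc_cauchy_def
    by (rule Bochner_Integration.integral_norm_bound_integral)
       (use integrable_cutoff_kernel[OF M s] norm_cutoff_kernel_le[OF s] in auto)
  then show ?thesis by (simp add: sp)
qed

text \<open>
  A weak type estimate. Let \<open>\<nu>\<close> be a discrete Frostman measure on \<open>F\<close>. The \<open>L\<^sup>2\<close> bound
  for \<open>M + \<nu>\<close> and for \<open>\<nu>\<close> alone bounds the \<open>L\<^sup>2(\<nu>)\<close> norm of the Cauchy integral of \<open>M\<close>, which on the other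
  hand is larger than \<open>\<eta>\<close> on the support of \<open>\<nu>\<close>. The smallness hypothesis absorbs the contribution of the mass of \<open>\<nu>\<close>.
\<close>

lemma trunc_cauchy_content:
  fixes k l :: nat
  assumes M: "sets M = sets borel" "finite_measure M" and K: "0 \<le> K"
    and growth: "\<And>x r. 0 < r \<Longrightarrow> measure M (ball x r) \<le> K * phi r"
    and F: "bounded F" and kl: "2 \<le> k" "k \<le> l" and \<eta>: "0 < \<eta>"
    and st: "s = (1/2) ^ l" "t = (1/2) ^ k"
    and large: "\<And>x. x \<in> F \<Longrightarrow> \<eta> < cmod (trunc_cauchy M s t x)"
    and g: "g = (K + 16) * gauge_ratio (2 * t)" and small: "192 * g\<^sup>2 * real (l - k) \<le> \<eta>\<^sup>2"
  shows "phi_content F \<le> ennreal (6144 * g\<^sup>2 * real (l - k) * measure M UNIV / \<eta>\<^sup>2)"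
proof -
  define n where "n = l - k"
  have s0: "0 < s" unfolding st by simp
  have "(1/2::real) ^ k = 2 ^ n * (1/2) ^ l"
    unfolding n_def using kl(2) by (simp add: power_diff power_divide field_simps)
  then have tn: "t = 2 ^ n * s" unfolding st .
  have t0: "0 < t" unfolding st by simp
  have "(1/2::real) ^ k \<le> (1/2) ^ 2" by (rule power_decreasing) (use kl in auto)
  then have t4: "t \<le> 1 / 4" unfolding st by (simp add: power2_eq_square)
  have g0: "0 \<le> g" using K gauge_ratio_pos[of "2 * t"] t0 unfolding g by simp
  obtain X w where X: "finite X" "X \<subseteq> F" and w: "\<And>x. 0 \<le> w x"
    and fr: "\<And>y j. y \<in> X \<Longrightarrow> j \<le> l \<Longrightarrow> sum w (X \<inter> ball y ((1/2) ^ j)) \<le> phi ((1/2) ^ j)"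
    and cont: "phi_content F \<le> ennreal (64 * sum w X)"
    using finite_frostman[OF F, where l = l] by blast
  define \<nu> where "\<nu> = atomic_measure X w"
  define W where "W = sum w X"
  have \<nu>: "sets \<nu> = sets borel" "finite_measure \<nu>"
    unfolding \<nu>_def using finite_measure_atomic_measure[OF X(1) w] by simp_all
  have \<nu>_UNIV: "measure \<nu> UNIV = W"
    unfolding \<nu>_def W_def using measure_atomic_measure[OF X(1) w, where A = UNIV] by simp
  have \<nu>_growth: "measure \<nu> (ball x r) \<le> 16 * phi r" if "s \<le> r" "r \<le> 2 * t" for x r
  proof -
    have "measure \<nu> (ball x r) = sum w (X \<inter> ball x r)"
      unfolding \<nu>_def using measure_atomic_measure[OF X(1) w, where A = "ball x r"] by simp
    also have "\<dots> \<le> 16 * phi r"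
      by (rule weight_growth_everywhere[OF X(1) w fr]) (use that t4 st in auto)
    finally show ?thesis .
  qed
  define \<omega> where "\<omega> = add_measure M \<nu>"
  have MN: "sets M = sets \<nu>" using M \<nu> by simp
  have \<omega>: "sets \<omega> = sets borel" "finite_measure \<omega>"
    unfolding \<omega>_def using finite_measure_add_measure[OF MN M(2) \<nu>(2)] M(1) by simp_all
  have \<omega>_eq: "measure \<omega> A = measure M A + measure \<nu> A" if "A \<in> sets borel" for A
    unfolding \<omega>_def using measure_add_measure[OF MN _ M(2) \<nu>(2)] that M(1) by simp
  have \<omega>_growth: "measure \<omega> (ball x r) \<le> g * r" if r: "s \<le> r" "r \<le> 2 * t" for x r
  proof -
    have "measure \<omega> (ball x r) \<le> (K + 16) * phi r"
      using \<omega>_eq[of "ball x r"] growth[of r x] \<nu>_growth[OF r, of x] s0 r(1) by (simp add: distrib_right)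
    then show ?thesis
      unfolding g using r s0 K by (intro le_gauge_ratio_mult) auto
  qed
  have \<nu>_growth': "measure \<nu> (ball x r) \<le> g * r" if r: "s \<le> r" "r \<le> 2 * t" for x r
    using \<omega>_growth[OF r, of x] \<omega>_eq[of "ball x r"] measure_nonneg[of M "ball x r"] unfolding \<omega>_eq[OF borel_open[OF open_ball]] by linarith
  define T where "T N x = cmod (trunc_cauchy N s t x)" for N x
  have L2\<omega>: "(LINT x|\<omega>. (T \<omega> x)\<^sup>2) \<le> 24 * g\<^sup>2 * real n * (measure M UNIV + W)"
    using trunc_cauchy_L2[OF \<omega> s0 g0 tn \<omega>_growth] \<omega>_eq[of UNIV] \<nu>_UNIV by (simp add: T_def)
  have L2\<nu>: "(LINT x|\<nu>. (T \<nu> x)\<^sup>2) \<le> 24 * g\<^sup>2 * real n * W"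
    using trunc_cauchy_L2[OF \<nu> s0 g0 tn \<nu>_growth'] \<nu>_UNIV by (simp add: T_def)
  have T_meas: "(\<lambda>x. (T N x)\<^sup>2) \<in> borel_measurable borel" if "sets N = sets borel" "finite_measure N" for N
    using measurable_trunc_cauchy[OF that, of s t] unfolding T_def by measurable
  have T_int: "integrable N (\<lambda>x. (T \<omega> x)\<^sup>2)" if N: "sets N = sets borel" "finite_measure N" for N
  proof (rule finite_measure.integrable_const_bound[OF N(2), of _ "(measure \<omega> UNIV / s)\<^sup>2"])
    show "(\<lambda>x. (T \<omega> x)\<^sup>2) \<in> borel_measurable N"
      using T_meas[OF \<omega>] measurable_cong_sets[OF N(1) refl] by blast
    show "AE x in N. norm ((T \<omega> x)\<^sup>2) \<le> (measure \<omega> UNIV / s)\<^sup>2"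
      using norm_trunc_cauchy_le[OF \<omega> s0, of t] by (intro AE_I2) (auto simp: T_def intro!: power_mono)
  qed
  have sum_T: "(LINT x|\<nu>. (T N x)\<^sup>2) = (\<Sum>x\<in>X. w x * (T N x)\<^sup>2)" if "sets N = sets borel" "finite_measure N" for N
    unfolding \<nu>_def using integral_atomic_measure[OF X(1) w T_meas[OF that]] by simp
  have "(LINT x|\<nu>. (T \<omega> x)\<^sup>2) \<le> (LINT x|M. (T \<omega> x)\<^sup>2) + (LINT x|\<nu>. (T \<omega> x)\<^sup>2)"
    by simp
  also have "\<dots> = (LINT x|\<omega>. (T \<omega> x)\<^sup>2)"
    unfolding \<omega>_def[of] by (rule integral_add_measure[symmetric, OF MN]) (use T_int[OF M] T_int[OF \<nu>] in \<open>simp_all add: \<omega>_def\<close>)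
  finally have \<nu>\<omega>: "(LINT x|\<nu>. (T \<omega> x)\<^sup>2) \<le> (LINT x|\<omega>. (T \<omega> x)\<^sup>2)" .
  have split: "trunc_cauchy \<omega> s t x = trunc_cauchy M s t x + trunc_cauchy \<nu> s t x" for x
    unfolding trunc_cauchy_def \<omega>_def
    by (rule integral_add_measure[OF MN]) (use integrable_cutoff_kernel[OF M s0] integrable_cutoff_kernel[OF \<nu> s0] in auto)
  have pt: "(T M x)\<^sup>2 \<le> 2 * (T \<omega> x)\<^sup>2 + 2 * (T \<nu> x)\<^sup>2" for x
  proof -
    have "T M x \<le> T \<omega> x + T \<nu> x"
      unfolding T_def using norm_triangle_ineq4[of "trunc_cauchy \<omega> s t x" "trunc_cauchy \<nu> s t x"]
      by (simp add: split)
    then have "(T M x)\<^sup>2 \<le> (T \<omega> x + T \<nu> x)\<^sup>2" by (intro power_mono) (auto simp: T_def)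
    also have "\<dots> \<le> 2 * (T \<omega> x)\<^sup>2 + 2 * (T \<nu> x)\<^sup>2"
      using zero_le_power2[of "T \<omega> x - T \<nu> x"] unfolding power2_sum power2_diff by linarith
    finally show ?thesis .
  qed
  \<comment> \<open>compare \<open>\<eta>\<^sup>2\<close> with the \<open>L\<^sup>2(\<nu>)\<close> norm and absorb half of \<open>\<eta>\<^sup>2 * W\<close>\<close>
  have "\<eta>\<^sup>2 * W = (\<Sum>x\<in>X. w x * \<eta>\<^sup>2)" unfolding W_def by (simp add: sum_distrib_right mult.commute)
  also have "\<dots> \<le> (\<Sum>x\<in>X. w x * (2 * (T \<omega> x)\<^sup>2 + 2 * (T \<nu> x)\<^sup>2))"
  proof (intro sum_mono mult_left_mono w)
    fix x assume "x \<in> X"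
    then have "\<eta> \<le> T M x" using large[of x] X(2) by (auto simp: T_def)
    then have "\<eta>\<^sup>2 \<le> (T M x)\<^sup>2" using \<eta> by (intro power_mono) auto
    then show "\<eta>\<^sup>2 \<le> 2 * (T \<omega> x)\<^sup>2 + 2 * (T \<nu> x)\<^sup>2" using pt[of x] by linarith
  qed
  also have "\<dots> = 2 * (LINT x|\<nu>. (T \<omega> x)\<^sup>2) + 2 * (LINT x|\<nu>. (T \<nu> x)\<^sup>2)"
    unfolding sum_T[OF \<omega>] sum_T[OF \<nu>] sum_distrib_left sum.distrib[symmetric]
    by (intro sum.cong refl) (simp add: algebra_simps)
  also have "\<dots> \<le> 2 * (24 * g\<^sup>2 * real n * (measure M UNIV + W)) + 2 * (24 * g\<^sup>2 * real n * W)"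
    using \<nu>\<omega> L2\<omega> L2\<nu> by linarith
  also have "\<dots> = 48 * g\<^sup>2 * real n * measure M UNIV + (96 * g\<^sup>2 * real n) * W"
    by (simp add: algebra_simps)
  also have "(96 * g\<^sup>2 * real n) * W \<le> (\<eta>\<^sup>2 / 2) * W"
    using small w unfolding W_def n_def by (intro mult_right_mono sum_nonneg) auto
  finally have "64 * W * \<eta>\<^sup>2 \<le> 6144 * g\<^sup>2 * real n * measure M UNIV" by (simp add: algebra_simps)
  then have "64 * W \<le> 6144 * g\<^sup>2 * real n * measure M UNIV / \<eta>\<^sup>2" using \<eta> by (simp add: pos_le_divide_eq)
  then show ?thesis using cont unfolding W_def n_def by (meson ennreal_leI order_trans)
qed


section \<open>A rotation invariant probability measure\<close>

definition unit_square_measure :: "complex measure" where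
  "unit_square_measure = density lborel (indicator (cbox 0 (Complex 1 1)))"

definition unit_interval_measure :: "real measure" where
  "unit_interval_measure = density lborel (indicator {0..1})"

text \<open>
  A uniformly distributed point of the unit square, rotated about the origin by an independent random angle. The square
  gives the quadratic bound for the measure of balls, the rotation gives the mean value property of
  holomorphic functions.
\<close>

definition spin_measure :: "complex measure" where
  "spin_measure =
     distr (unit_square_measure \<Otimes>\<^sub>M unit_interval_measure) borel (\<lambda>p. fst p * cis (2 * pi * snd p))"

lemma sets_unit_measures [simp, measurable_cong]:
  "sets unit_square_measure = sets borel" "sets unit_interval_measure = sets borel"
  and space_unit_measures [simp]: "space unit_square_measure = UNIV" "space unit_interval_measure = UNIV"
  by (simp_all add: unit_square_measure_def unit_interval_measure_def)

lemma sets_spin_measure [simp, measurable_cong]: "sets spin_measure = sets borel"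
  and space_spin_measure [simp]: "space spin_measure = UNIV"
  by (simp_all add: spin_measure_def)

lemma emeasure_unit_square_measure:
  "A \<in> sets borel \<Longrightarrow> emeasure unit_square_measure A = emeasure lborel (cbox 0 (Complex 1 1) \<inter> A)"
  unfolding unit_square_measure_def by (rule emeasure_restricted) auto

lemma emeasure_unit_interval_measure:
  "A \<in> sets borel \<Longrightarrow> emeasure unit_interval_measure A = emeasure lborel ({0..1} \<inter> A)"
  unfolding unit_interval_measure_def by (rule emeasure_restricted) auto

lemma emeasure_unit_measures_UNIV [simp]:
  "emeasure unit_square_measure UNIV = 1" "emeasure unit_interval_measure UNIV = 1"
  by (simp_all add: emeasure_unit_square_measure emeasure_unit_interval_measure
      emeasure_lborel_cbox_eq Basis_complex_def inner_complex_def)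

lemma finite_unit_square_measure: "finite_measure unit_square_measure"
  by (rule finite_measureI) simp

lemma finite_unit_interval_measure: "finite_measure unit_interval_measure"
  by (rule finite_measureI) simp

lemma AE_unit_square_measure: "AE v in unit_square_measure. cmod v \<le> 2"
proof -
  have "cmod v \<le> 2" if "v \<in> cbox 0 (Complex 1 1)" for v
    using cmod_le[of v] that by (auto simp: cbox_def Basis_complex_def inner_complex_def)
  then show ?thesis unfolding unit_square_measure_def
    by (subst AE_density) (auto split: split_indicator_asm)
qed

lemma integral_unit_interval_measure:
  fixes f :: "real \<Rightarrow> complex"
  assumes f: "continuous_on UNIV f" and I: "(f has_integral I) {0..1}"
  shows "(LINT \<theta>|unit_interval_measure. f \<theta>) = I"
proof -
  have eq: "unit_interval_measure = density lborel (\<lambda>x. ennreal (indicator {0..1} x))"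
    unfolding unit_interval_measure_def by (simp add: ennreal_indicator)
  have "f \<in> borel_measurable borel" using f by (rule borel_measurable_continuous_onI)
  then have "(LINT \<theta>|unit_interval_measure. f \<theta>) = (LINT \<theta>|lborel. indicator {0..1} \<theta> *\<^sub>R f \<theta>)"
    unfolding eq by (intro integral_density) auto
  also have "\<dots> = integral {0..1} f"
    using set_borel_integral_eq_integral(2)[OF borel_integrable_atLeastAtMost'[of 0 1 f]] f
    by (simp add: set_lebesgue_integral_def continuous_on_subset)
  also have "\<dots> = I" using I by (rule integral_unique)
  finally show ?thesis .
qed

lemma emeasure_lborel_complex_ball_le:
  fixes y :: complex
  assumes "0 \<le> r" shows "emeasure lborel (ball y r) \<le> ennreal (4 * r\<^sup>2)"
proof -
  have "ball y r \<subseteq> cbox (y - Complex r r) (y + Complex r r)"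
  proof
    fix z assume "z \<in> ball y r"
    then have "cmod (z - y) < r" by (simp add: dist_norm norm_minus_commute)
    then have "\<bar>Re (z - y)\<bar> < r" "\<bar>Im (z - y)\<bar> < r"
      using abs_Re_le_cmod[of "z - y"] abs_Im_le_cmod[of "z - y"] by linarith+
    then show "z \<in> cbox (y - Complex r r) (y + Complex r r)"
      by (auto simp: cbox_def Basis_complex_def inner_complex_def)
  qed
  then have "emeasure lborel (ball y r) \<le> emeasure lborel (cbox (y - Complex r r) (y + Complex r r))"
    by (intro emeasure_mono) auto
  also have "\<dots> = ennreal (4 * r\<^sup>2)"
    using assms by (simp add: emeasure_lborel_cbox_eq Basis_complex_def inner_complex_def power2_eq_square)
  finally show ?thesis .
qed

lemma measurable_spin [measurable]:
  "(\<lambda>p. fst p * cis (2 * pi * snd p)) \<in> unit_square_measure \<Otimes>\<^sub>M unit_interval_measure \<rightarrow>\<^sub>M borel"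
proof -
  have [measurable]: "cis \<in> borel_measurable borel"
    by (intro borel_measurable_continuous_onI continuous_on_cis continuous_on_id)
  show ?thesis by measurable
qed

lemma pair_sigma_finite_unit_measures: "pair_sigma_finite unit_square_measure unit_interval_measure"
  using finite_unit_square_measure finite_unit_interval_measure
  by (intro pair_sigma_finite.intro finite_measure.axioms(1))

lemma emeasure_spin_measure_UNIV [simp]: "emeasure spin_measure UNIV = 1"
proof -
  interpret pair_sigma_finite unit_square_measure unit_interval_measure by (rule pair_sigma_finite_unit_measures)
  have "emeasure spin_measure UNIV = emeasure (unit_square_measure \<Otimes>\<^sub>M unit_interval_measure) (UNIV \<times> UNIV)"
    unfolding spin_measure_def by (subst emeasure_distr) (auto simp: space_pair_measure)
  also have "\<dots> = 1" by (subst M2.emeasure_pair_measure_Times) auto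
  finally show ?thesis .
qed

lemma finite_spin_measure: "finite_measure spin_measure"
  by (rule finite_measureI) simp

lemma emeasure_spin_measure_ball_le:
  assumes r: "0 \<le> r" shows "emeasure spin_measure (ball y r) \<le> ennreal (4 * r\<^sup>2)"
proof -
  interpret P: pair_sigma_finite unit_square_measure unit_interval_measure by (rule pair_sigma_finite_unit_measures)
  define S where "S = (\<lambda>p. fst p * cis (2 * pi * snd p)) -` ball y r \<inter> space (unit_square_measure \<Otimes>\<^sub>M unit_interval_measure)"
  have S: "S \<in> sets (unit_square_measure \<Otimes>\<^sub>M unit_interval_measure)"
    unfolding S_def by (rule measurable_sets[OF measurable_spin]) simp
  have "emeasure spin_measure (ball y r) = emeasure (unit_square_measure \<Otimes>\<^sub>M unit_interval_measure) S"
    unfolding spin_measure_def S_def by (rule emeasure_distr[OF measurable_spin]) simp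
  also have "\<dots> = (\<integral>\<^sup>+ \<theta>. emeasure unit_square_measure ((\<lambda>v. (v, \<theta>)) -` S) \<partial>unit_interval_measure)"
    by (rule P.emeasure_pair_measure_alt2[OF S])
  also have "\<dots> \<le> (\<integral>\<^sup>+ \<theta>. ennreal (4 * r\<^sup>2) \<partial>unit_interval_measure)"
  proof (rule nn_integral_mono)
    fix \<theta> :: real
    define b where "b = y * cis (- (2 * pi * \<theta>))"
    have cc: "cis (2 * pi * \<theta>) * cis (- (2 * pi * \<theta>)) = 1" by (simp add: cis_mult)
    have "(\<lambda>v. (v, \<theta>)) -` S \<subseteq> ball b r"
    proof
      fix v assume "v \<in> (\<lambda>v. (v, \<theta>)) -` S"
      then have "cmod (y - v * cis (2 * pi * \<theta>)) < r" by (simp add: S_def dist_norm)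
      moreover have "b - v = (y - v * cis (2 * pi * \<theta>)) * cis (- (2 * pi * \<theta>))"
        using cc by (simp add: b_def algebra_simps)
      then have "cmod (b - v) = cmod (y - v * cis (2 * pi * \<theta>))" by (simp only: norm_mult norm_cis mult_1_right)
      ultimately show "v \<in> ball b r" by (simp add: dist_norm)
    qed
    then have "emeasure unit_square_measure ((\<lambda>v. (v, \<theta>)) -` S) \<le> emeasure unit_square_measure (ball b r)"
      by (rule emeasure_mono) simp
    also have "\<dots> = emeasure lborel (cbox 0 (Complex 1 1) \<inter> ball b r)"
      by (rule emeasure_unit_square_measure) simp
    also have "\<dots> \<le> emeasure lborel (ball b r)" by (rule emeasure_mono) auto
    also have "\<dots> \<le> ennreal (4 * r\<^sup>2)" by (rule emeasure_lborel_complex_ball_le[OF r])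
    finally show "emeasure unit_square_measure ((\<lambda>v. (v, \<theta>)) -` S) \<le> ennreal (4 * r\<^sup>2)" .
  qed
  also have "\<dots> = ennreal (4 * r\<^sup>2)" by simp
  finally show ?thesis .
qed

lemma AE_spin_measure: "AE v in spin_measure. cmod v \<le> 2"
proof -
  interpret P: pair_sigma_finite unit_square_measure unit_interval_measure by (rule pair_sigma_finite_unit_measures)
  have "AE p in unit_square_measure \<Otimes>\<^sub>M unit_interval_measure. cmod (fst p) \<le> 2"
  proof (rule P.AE_pair_measure)
    show "{p \<in> space (unit_square_measure \<Otimes>\<^sub>M unit_interval_measure). cmod (fst p) \<le> 2}
        \<in> sets (unit_square_measure \<Otimes>\<^sub>M unit_interval_measure)" by measurable
    show "AE v in unit_square_measure. AE \<theta> in unit_interval_measure. cmod (fst (v, \<theta>)) \<le> 2"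
      using AE_unit_square_measure by eventually_elim simp
  qed
  then show ?thesis unfolding spin_measure_def
    by (subst AE_distr_iff[OF measurable_spin]) (auto simp: norm_mult)
qed

text \<open>
  The mean value property of \<open>1 / (b - z)\<close> over a circle not enclosing \<open>b\<close>, from an explicit antiderivative: the
  argument of the logarithm stays in the right half plane and returns to its initial value.
\<close>

lemma circle_mean_inverse:
  assumes "cmod q < cmod b"
  shows "((\<lambda>\<theta>. 1 / (b - q * cis (2 * pi * \<theta>))) has_integral 1 / b) {0..1}"
proof -
  have b: "b \<noteq> 0" using assms by auto
  define e where "e z = exp (2 * of_real pi * \<i> * z)" for z :: complex
  have e_real: "e (of_real \<theta>) = cis (2 * pi * \<theta>)" for \<theta>
    unfolding e_def cis_conv_exp by (rule arg_cong[of _ _ exp]) (simp add: mult_ac)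
  define G where "G z = z / b - Ln (1 - (q / b) * e z) / (2 * of_real pi * \<i> * b)" for z
  have "((\<lambda>\<theta>. G (of_real \<theta>)) has_vector_derivative 1 / (b - q * cis (2 * pi * \<theta>))) (at \<theta> within {0..1})" for \<theta> :: real
  proof -
    define c where "c = e (of_real \<theta>)"
    have c1: "cmod c = 1" by (simp add: c_def e_real)
    have "cmod (q / b * c) < 1" using assms b c1 by (simp add: norm_mult norm_divide)
    then have "\<bar>Re (q / b * c)\<bar> < 1" using abs_Re_le_cmod[of "q / b * c"] by linarith
    then have Re: "0 < Re (1 - q / b * c)" by simp
    then have nn: "1 - q / b * c \<notin> \<real>\<^sub>\<le>\<^sub>0" by (simp add: complex_nonpos_Reals_iff)
    have nz: "b - q * c \<noteq> 0"
    proof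
      assume "b - q * c = 0"
      then have "cmod b = cmod q" using c1 by (metis eq_iff_diff_eq_0 mult.right_neutral norm_mult)
      with assms show False by simp
    qed
    have de: "(e has_field_derivative 2 * of_real pi * \<i> * c) (at (of_real \<theta>))"
      unfolding e_def c_def by (auto intro!: derivative_eq_intros)
    have "((\<lambda>z. 1 - (q / b) * e z) has_field_derivative - (q / b) * (2 * of_real pi * \<i> * c)) (at (of_real \<theta>))"
      using DERIV_diff[OF DERIV_const[of 1] DERIV_cmult[OF de, of "q / b"]] by simp
    from DERIV_chain'[OF this has_field_derivative_Ln[OF nn[unfolded c_def]]]
    have "((\<lambda>z. Ln (1 - (q / b) * e z)) has_field_derivative
        (- (q / b) * (2 * of_real pi * \<i> * c)) / (1 - q / b * c)) (at (of_real \<theta>))"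
      by (simp add: c_def field_simps)
    from DERIV_diff[OF DERIV_cdivide[OF DERIV_ident, of b] DERIV_cdivide[OF this, of "2 * of_real pi * \<i> * b"]]
    have "(G has_field_derivative 1 / b - ((- (q / b) * (2 * of_real pi * \<i> * c)) / (1 - q / b * c)) / (2 * of_real pi * \<i> * b)) (at (of_real \<theta>))"
      unfolding G_def by simp
    also have "1 / b - ((- (q / b) * (2 * of_real pi * \<i> * c)) / (1 - q / b * c)) / (2 * of_real pi * \<i> * b) = 1 / (b - q * c)"
    proof -
      have "1 - q / b * c = (b - q * c) / b" using b by (simp add: field_simps)
      then have "((- (q / b) * (2 * of_real pi * \<i> * c)) / (1 - q / b * c)) / (2 * of_real pi * \<i> * b) = - (q * c) / ((b - q * c) * b)"
        using b nz by (simp add: field_simps)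
      then show ?thesis using b nz by (simp add: field_simps)
    qed
    finally have "(G has_field_derivative 1 / (b - q * c)) (at (of_real \<theta>))" .
    then have "((\<lambda>\<theta>. G (of_real \<theta>)) has_vector_derivative 1 / (b - q * c)) (at \<theta> within {0..1})"
      by (rule has_vector_derivative_real_field)
    then show ?thesis by (simp add: c_def e_real)
  qed
  then have "((\<lambda>\<theta>. 1 / (b - q * cis (2 * pi * \<theta>))) has_integral (G (of_real 1) - G (of_real 0))) {0..1}"
    by (intro fundamental_theorem_of_calculus) auto
  also have "e (of_real 1) = e (of_real 0)" unfolding e_real by simp
  then have "G (of_real 1) - G (of_real 0) = 1 / b" by (simp add: G_def)
  finally show ?thesis .
qed

lemma mean_value_spin_measure:
  assumes \<rho>: "0 \<le> \<rho>" "2 * \<rho> < cmod b"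
  shows "(LINT v|spin_measure. 1 / (b - of_real \<rho> * v)) = 1 / b"
proof -
  interpret P: pair_sigma_finite unit_square_measure unit_interval_measure by (rule pair_sigma_finite_unit_measures)
  interpret F: finite_measure "unit_square_measure \<Otimes>\<^sub>M unit_interval_measure"
    by (rule finite_measure_pair_measure[OF finite_unit_interval_measure finite_unit_square_measure])
  define d where "d = cmod b - 2 * \<rho>"
  have d: "0 < d" using \<rho> by (simp add: d_def)
  define f where "f v = (if cmod v \<le> 2 then 1 / (b - of_real \<rho> * v) else 0)" for v
  have [measurable]: "f \<in> borel_measurable borel" unfolding f_def by measurable
  have small: "cmod (of_real \<rho> * v) \<le> 2 * \<rho>" if "cmod v \<le> 2" for v
    using mult_right_mono[OF that \<rho>(1)] \<rho>(1) by (simp add: norm_mult mult.commute)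
  have f_bound: "cmod (f v) \<le> 1 / d" for v
  proof (cases "cmod v \<le> 2")
    case True
    have "d \<le> cmod (b - of_real \<rho> * v)"
      using norm_triangle_ineq2[of b "of_real \<rho> * v"] small[OF True] unfolding d_def by linarith
    then show ?thesis using d True by (simp add: f_def norm_divide frac_le)
  qed (use d in \<open>simp add: f_def\<close>)
  have "(LINT v|spin_measure. 1 / (b - of_real \<rho> * v)) = (LINT v|spin_measure. f v)"
    by (rule integral_cong_AE) (use AE_spin_measure in \<open>auto simp: f_def\<close>)
  also have "\<dots> = (LINT p|(unit_square_measure \<Otimes>\<^sub>M unit_interval_measure). f (fst p * cis (2 * pi * snd p)))"
    unfolding spin_measure_def by (rule integral_distr[OF measurable_spin]) simp
  also have "\<dots> = (LINT v|unit_square_measure. LINT \<theta>|unit_interval_measure. f (v * cis (2 * pi * \<theta>)))"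
  proof -
    have "integrable (unit_square_measure \<Otimes>\<^sub>M unit_interval_measure) (\<lambda>p. f (fst p * cis (2 * pi * snd p)))"
      by (rule F.integrable_const_bound[of _ "1 / d"]) (use f_bound in auto)
    from P.integral_fst'[OF this] show ?thesis by simp
  qed
  also have "\<dots> = (LINT v|unit_square_measure. 1 / b)"
  proof (rule integral_cong_AE)
    show "AE v in unit_square_measure. (LINT \<theta>|unit_interval_measure. f (v * cis (2 * pi * \<theta>))) = 1 / b"
      using AE_unit_square_measure
    proof eventually_elim
      case (elim v)
      have lt: "cmod (of_real \<rho> * v) < cmod b" using small[OF elim] \<rho> by linarith
      have f_eq: "f (v * cis (2 * pi * \<theta>)) = 1 / (b - of_real \<rho> * v * cis (2 * pi * \<theta>))" for \<theta>
        using elim by (simp add: f_def norm_mult mult.assoc)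
      have "b - of_real \<rho> * v * cis (2 * pi * \<theta>) \<noteq> 0" for \<theta>
      proof
        assume "b - of_real \<rho> * v * cis (2 * pi * \<theta>) = 0"
        then have "cmod b = cmod (of_real \<rho> * v)" by (metis eq_iff_diff_eq_0 mult.right_neutral norm_mult norm_cis)
        with lt show False by simp
      qed
      then have "continuous_on UNIV (\<lambda>\<theta>. 1 / (b - of_real \<rho> * v * cis (2 * pi * \<theta>)))"
        by (intro continuous_intros continuous_on_cis) auto
      then show ?case unfolding f_eq
        by (rule integral_unit_interval_measure) (rule circle_mean_inverse[OF lt])
    qed
    show "(\<lambda>v. LINT \<theta>|unit_interval_measure. f (v * cis (2 * pi * \<theta>))) \<in> borel_measurable unit_square_measure"
      by (rule P.M2.borel_measurable_lebesgue_integral) (simp add: split_beta')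
  qed simp
  also have "\<dots> = 1 / b" by (simp add: measure_def)
  finally show ?thesis .
qed


section \<open>Smearing a measure away from a set\<close>

lemma gauge_ratio_over_id_antimono:
  assumes "0 < r" "r \<le> d" shows "gauge_ratio d * r \<le> 2 * gauge_ratio r * d"
proof -
  obtain n where n: "d \<le> 2 ^ n * r" "2 ^ n * r \<le> 2 * d"
    using dyadic_multiple_between[of r d] assms by auto
  have "gauge_ratio d \<le> gauge_ratio (2 ^ n * r)"
    using assms n by (intro gauge_ratio_mono) auto
  also have "\<dots> \<le> 2 ^ n * gauge_ratio r" by (rule gauge_ratio_dilate[OF assms(1)])
  finally have "gauge_ratio d * r \<le> 2 ^ n * gauge_ratio r * r"
    using assms(1) by (intro mult_right_mono) auto
  also have "\<dots> = gauge_ratio r * (2 ^ n * r)" by simp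
  also have "\<dots> \<le> gauge_ratio r * (2 * d)"
    using n(2) gauge_ratio_pos[OF assms(1)] by (intro mult_left_mono) auto
  finally show ?thesis by simp
qed

lemma phi_quadratic_decay:
  assumes "0 < r" "r \<le> d" shows "(r / d)\<^sup>2 * phi d \<le> 2 * phi r"
proof -
  have d: "0 < d" using assms by linarith
  have "(r / d)\<^sup>2 * phi d = r / d * (gauge_ratio d * r)"
    using d by (simp add: phi_eq_gauge_ratio power2_eq_square)
  also have "\<dots> \<le> r / d * (2 * gauge_ratio r * d)"
    using assms d gauge_ratio_over_id_antimono[OF assms] by (intro mult_left_mono) auto
  also have "\<dots> = 2 * phi r" using assms d by (simp add: phi_eq_gauge_ratio)
  finally show ?thesis .
qed

text \<open>
  The mass of \<open>M\<close> at a point \<open>w\<close> is spread over a neighbourhood of \<open>w\<close> of size comparable to, but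
  smaller than, the distance from \<open>w\<close> to \<open>E\<close>; the points of \<open>E\<close> keep their mass.
\<close>

definition smear :: "complex measure \<Rightarrow> complex set \<Rightarrow> complex measure" where
  "smear M E = distr (M \<Otimes>\<^sub>M spin_measure) borel (\<lambda>p. fst p + of_real (infdist (fst p) E / 8) * snd p)"

lemma sets_smear [simp, measurable_cong]: "sets (smear M E) = sets borel"
  and space_smear [simp]: "space (smear M E) = UNIV"
  by (simp_all add: smear_def)

lemma measurable_infdist [measurable]: "(\<lambda>w. infdist w E) \<in> borel_measurable borel"
  by (intro borel_measurable_continuous_onI continuous_intros)

lemma measurable_smear:
  assumes "sets M = sets borel"
  shows "(\<lambda>p. fst p + of_real (infdist (fst p) E / 8) * snd p) \<in> M \<Otimes>\<^sub>M spin_measure \<rightarrow>\<^sub>M (borel :: complex measure)"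
proof -
  note assms[measurable_cong]
  show ?thesis by measurable
qed

lemma emeasure_smear:
  assumes M: "sets M = sets borel" "finite_measure M" and A: "A \<in> sets borel"
  shows "emeasure (smear M E) A = (\<integral>\<^sup>+ w. emeasure spin_measure {v. w + of_real (infdist w E / 8) * v \<in> A} \<partial>M)"
proof -
  note M(1)[measurable_cong]
  have sp: "space M = UNIV" using sets_eq_imp_space_eq[OF M(1)] by simp
  interpret S: finite_measure spin_measure by (rule finite_spin_measure)
  define S where "S = (\<lambda>p. fst p + of_real (infdist (fst p) E / 8) * snd p) -` A \<inter> space (M \<Otimes>\<^sub>M spin_measure)"
  have S: "S \<in> sets (M \<Otimes>\<^sub>M spin_measure)"
    unfolding S_def by (rule measurable_sets[OF measurable_smear[OF M(1)] A])
  have "emeasure (smear M E) A = emeasure (M \<Otimes>\<^sub>M spin_measure) S"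
    unfolding smear_def S_def by (rule emeasure_distr[OF measurable_smear[OF M(1)] A])
  also have "\<dots> = (\<integral>\<^sup>+ w. emeasure spin_measure (Pair w -` S) \<partial>M)"
    by (rule S.emeasure_pair_measure_alt[OF S])
  also have "\<dots> = (\<integral>\<^sup>+ w. emeasure spin_measure {v. w + of_real (infdist w E / 8) * v \<in> A} \<partial>M)"
    by (intro nn_integral_cong arg_cong2[where f = emeasure]) (auto simp: S_def space_pair_measure sp)
  finally show ?thesis .
qed

lemma emeasure_smear_UNIV:
  assumes M: "sets M = sets borel" "finite_measure M"
  shows "emeasure (smear M E) UNIV = emeasure M UNIV"
  using emeasure_smear[OF M, of UNIV E] sets_eq_imp_space_eq[OF M(1)] by simp

lemma finite_smear:
  assumes M: "sets M = sets borel" "finite_measure M"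
  shows "finite_measure (smear M E)"
  using emeasure_smear_UNIV[OF M, of E] finite_measure.emeasure_finite[OF M(2)]
  by (intro finite_measureI) auto

lemma infdist_near_point:
  assumes "E \<noteq> {}" "infdist x E < R" obtains b where "b \<in> E" "dist x b < R"
proof -
  have "(INF a\<in>E. dist x a) < R" using assms by (simp add: infdist_def)
  then show ?thesis using assms(1) that by (subst (asm) cINF_less_iff) (auto intro!: bdd_belowI2[of _ 0])
qed

text \<open>
  Growth at the points of \<open>E\<close> turns into growth everywhere. A ball that is large compared with its distance to \<open>E\<close>
  lies in a comparable ball centred on \<open>E\<close>. In a ball that is small compared with its distance \<open>d\<close> to \<open>E\<close> the
  smeared measure has density of order \<open>phi d / d\<^sup>2\<close>, and \<open>phi\<close> decays more slowly than a quadratic function.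
\<close>

lemma smear_growth:
  assumes M: "sets M = sets borel" "finite_measure M" and E: "E \<noteq> {}" and N: "0 \<le> N"
    and growth: "\<And>a r. a \<in> E \<Longrightarrow> 0 < r \<Longrightarrow> measure M (ball a r) \<le> N * phi r"
    and r: "0 < r"
  shows "measure (smear M E) (ball x r) \<le> 73728 * N * phi r"
proof -
  interpret finite_measure M by fact
  note M(1)[measurable_cong]
  define d where "d = infdist x E"
  have d0: "0 \<le> d" by (simp add: d_def infdist_nonneg)
  define \<rho> where "\<rho> w = infdist w E / 8" for w
  have \<rho>0: "0 \<le> \<rho> w" for w by (simp add: \<rho>_def infdist_nonneg)
  define G where "G w = emeasure spin_measure {v. w + of_real (\<rho> w) * v \<in> ball x r}" for w
  have G1: "G w \<le> 1" for w
  proof -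
    have "G w \<le> emeasure spin_measure UNIV" unfolding G_def by (rule emeasure_mono) auto
    then show ?thesis by simp
  qed
  have lip: "infdist w E \<le> d + dist w x" "d \<le> infdist w E + dist w x" for w
    using infdist_triangle[of w E x] infdist_triangle[of x E w] by (simp_all add: d_def dist_commute)
  have G0: "G w = 0" if w: "4 * r + d \<le> 3 * dist w x" for w
  proof -
    have set: "{v. w + of_real (\<rho> w) * v \<in> ball x r} \<in> sets spin_measure"
    proof -
      have [measurable]: "ball x r \<in> sets borel" by simp
      have "{v \<in> space spin_measure. w + of_real (\<rho> w) * v \<in> ball x r} \<in> sets spin_measure" by measurable
      then show ?thesis by simp
    qed
    have "AE v in spin_measure. v \<notin> {v. w + of_real (\<rho> w) * v \<in> ball x r}"
      using AE_spin_measure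
    proof eventually_elim
      case (elim v)
      have "cmod (of_real (\<rho> w) * v) \<le> \<rho> w * 2"
        using mult_left_mono[OF elim \<rho>0[of w]] \<rho>0[of w] by (simp add: norm_mult)
      then have "cmod (of_real (\<rho> w) * v) \<le> infdist w E / 4" by (simp add: \<rho>_def)
      moreover have "dist w x \<le> dist x (w + of_real (\<rho> w) * v) + cmod (of_real (\<rho> w) * v)"
        using norm_triangle_ineq[of "w + of_real (\<rho> w) * v - x" "- (of_real (\<rho> w) * v)"]
        by (simp add: dist_norm norm_minus_commute)
      ultimately have "r \<le> dist x (w + of_real (\<rho> w) * v)" using lip(1)[of w] w by linarith
      then show ?case by simp
    qed
    then show ?thesis unfolding G_def using AE_iff_measurable[OF set, of "\<lambda>v. v \<notin> {v. w + of_real (\<rho> w) * v \<in> ball x r}"] by simp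
  qed
  \<comment> \<open>only points \<open>w\<close> with \<open>3 * dist w x < 4 * r + d\<close> send mass into \<open>ball x r\<close>; each sends a fraction at most \<open>c\<close>\<close>
  have bound: "emeasure (smear M E) (ball x r) \<le> ennreal (c * (N * phi R))"
    if b: "b \<in> E" and R: "0 < R" and sub: "\<And>w. 3 * dist w x < 4 * r + d \<Longrightarrow> dist b w < R \<and> G w \<le> ennreal c" and c: "0 \<le> c"
    for b R c
  proof -
    have ball: "ball b R \<in> sets M" unfolding M(1) by simp
    have "emeasure (smear M E) (ball x r) = (\<integral>\<^sup>+ w. G w \<partial>M)"
      using emeasure_smear[OF M, of "ball x r" E] by (simp add: G_def \<rho>_def)
    also have "\<dots> \<le> (\<integral>\<^sup>+ w. ennreal c * indicator (ball b R) w \<partial>M)"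
    proof (rule nn_integral_mono)
      fix w show "G w \<le> ennreal c * indicator (ball b R) w"
        using G0[of w] sub[of w] by (cases "3 * dist w x < 4 * r + d") auto
    qed
    also have "\<dots> = ennreal c * emeasure M (ball b R)" by (rule nn_integral_cmult_indicator[OF ball])
    also have "\<dots> = ennreal (c * measure M (ball b R))"
      using c by (simp add: emeasure_eq_measure ennreal_mult)
    also have "\<dots> \<le> ennreal (c * (N * phi R))"
      by (intro ennreal_leI mult_left_mono growth b R c)
    finally show ?thesis .
  qed
  have "emeasure (smear M E) (ball x r) \<le> ennreal (73728 * N * phi r)"
  \<comment> \<open>the constant \<open>73728 = 2304 * 16 * 2\<close> comes from the second case\<close>
  proof (cases "d \<le> 4 * r")
    case True
    obtain b where b: "b \<in> E" "dist x b < 5 * r"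
      using infdist_near_point[OF E, of x "5 * r"] True r by (auto simp: d_def)
    have "emeasure (smear M E) (ball x r) \<le> ennreal (1 * (N * phi (8 * r)))"
    proof (rule bound[OF b(1)])
      fix w assume "3 * dist w x < 4 * r + d"
      then have "dist w x < 3 * r" using True r by linarith
      then show "dist b w < 8 * r \<and> G w \<le> ennreal 1"
        using b(2) dist_triangle[of b w x] G1[of w] by (simp add: dist_commute)
    qed (use r in auto)
    also have "1 * (N * phi (8 * r)) \<le> 73728 * N * phi r"
    proof -
      have "N * phi (8 * r) \<le> N * (64 * phi r)"
        using phi_dilate[of 3 r] N by (intro mult_left_mono) auto
      moreover have "0 \<le> N * phi r" using N by simp
      ultimately show ?thesis by linarith
    qed
    finally show ?thesis by (simp add: ennreal_leI)
  next
    case False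
    then have d: "0 < d" "4 * r < d" using r by auto
    obtain b where b: "b \<in> E" "dist x b < 2 * d"
      using infdist_near_point[OF E, of x "2 * d"] d by (auto simp: d_def)
    have "emeasure (smear M E) (ball x r) \<le> ennreal (2304 * (r / d)\<^sup>2 * (N * phi (4 * d)))"
    proof (rule bound[OF b(1)])
      fix w assume "3 * dist w x < 4 * r + d"
      then have w: "3 * dist w x < 2 * d" using d by linarith
      then have "d / 3 < infdist w E" using lip(2)[of w] by linarith
      then have \<rho>w: "d / 24 < \<rho> w" by (simp add: \<rho>_def)
      then have \<rho>pos: "0 < \<rho> w" using d by linarith
      have sub: "{v. w + of_real (\<rho> w) * v \<in> ball x r} \<subseteq> ball ((x - w) / of_real (\<rho> w)) (r / \<rho> w)"
      proof
        fix v assume "v \<in> {v. w + of_real (\<rho> w) * v \<in> ball x r}"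
        then have "cmod (x - w - of_real (\<rho> w) * v) < r" by (simp add: dist_norm diff_diff_eq)
        moreover have "(x - w) / of_real (\<rho> w) - v = (x - w - of_real (\<rho> w) * v) / of_real (\<rho> w)"
          using \<rho>pos by (simp add: field_simps)
        ultimately show "v \<in> ball ((x - w) / of_real (\<rho> w)) (r / \<rho> w)"
          using \<rho>pos by (simp add: dist_norm norm_divide divide_strict_right_mono)
      qed
      have "G w \<le> emeasure spin_measure (ball ((x - w) / of_real (\<rho> w)) (r / \<rho> w))"
        unfolding G_def by (rule emeasure_mono[OF sub]) simp
      also have "\<dots> \<le> ennreal (4 * (r / \<rho> w)\<^sup>2)"
        by (rule emeasure_spin_measure_ball_le) (use r \<rho>pos in auto)
      also have "4 * (r / \<rho> w)\<^sup>2 \<le> 4 * (24 * (r / d))\<^sup>2"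
      proof -
        have "r / \<rho> w \<le> r / (d / 24)" using \<rho>w d r by (intro divide_left_mono mult_pos_pos \<rho>pos) auto
        then have "r / \<rho> w \<le> 24 * (r / d)" by (simp add: mult.commute)
        then show ?thesis using r \<rho>pos by (intro mult_left_mono power_mono) auto
      qed
      also have "4 * (24 * (r / d))\<^sup>2 = 2304 * (r / d)\<^sup>2" by (simp add: power_mult_distrib power_divide)
      finally have "G w \<le> ennreal (2304 * (r / d)\<^sup>2)" by (simp add: ennreal_leI)
      moreover have "dist b w < 4 * d" using b(2) w dist_triangle[of b w x] dist_commute[of b x] dist_commute[of x w] d by linarith
      ultimately show "dist b w < 4 * d \<and> G w \<le> ennreal (2304 * (r / d)\<^sup>2)" by blast
    qed (use d in auto)
    also have "2304 * (r / d)\<^sup>2 * (N * phi (4 * d)) \<le> 73728 * N * phi r"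
    proof -
      have "phi (4 * d) \<le> 16 * phi d" using phi_dilate[of 2 d] by simp
      then have "2304 * (r / d)\<^sup>2 * (N * phi (4 * d)) \<le> 2304 * (r / d)\<^sup>2 * (N * (16 * phi d))"
        using N by (intro mult_left_mono) auto
      also have "\<dots> = 36864 * N * ((r / d)\<^sup>2 * phi d)" by simp
      also have "\<dots> \<le> 36864 * N * (2 * phi r)"
        using N d r by (intro mult_left_mono phi_quadratic_decay) auto
      finally show ?thesis by simp
    qed
    finally show ?thesis by (simp add: ennreal_leI)
  qed
  then show ?thesis
    using N by (simp add: measure_def enn2real_leI)
qed

lemma trunc_cauchy_smear:
  assumes M: "sets M = sets borel" "finite_measure M" and s: "0 < s"
  shows "trunc_cauchy (smear M E) s t a = (LINT w|M. LINT v|spin_measure. cutoff_kernel s t (a - w - of_real (infdist w E / 8) * v))"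
    and "integrable M (\<lambda>w. LINT v|spin_measure. cutoff_kernel s t (a - w - of_real (infdist w E / 8) * v))"
proof -
  note M(1)[measurable_cong]
  interpret M: finite_measure M by fact
  interpret S: finite_measure spin_measure by (rule finite_spin_measure)
  interpret P: pair_sigma_finite M spin_measure ..
  interpret F: finite_measure "M \<Otimes>\<^sub>M spin_measure"
    by (rule finite_measure_pair_measure) (rule M.finite_measure_axioms S.finite_measure_axioms)+
  define h where "h p = cutoff_kernel s t (a - (fst p + of_real (infdist (fst p) E / 8) * snd p))" for p
  have [measurable]: "h \<in> borel_measurable (M \<Otimes>\<^sub>M spin_measure)" unfolding h_def[abs_def] by measurable
  have h: "integrable (M \<Otimes>\<^sub>M spin_measure) h"
    by (rule F.integrable_const_bound[of _ "1 / s"]) (use norm_cutoff_kernel_le[OF s] in \<open>auto simp: h_def\<close>)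
  have "trunc_cauchy (smear M E) s t a = (LINT p|(M \<Otimes>\<^sub>M spin_measure). h p)"
    unfolding trunc_cauchy_def smear_def h_def by (rule integral_distr[OF measurable_smear[OF M(1)]]) measurable
  also have "\<dots> = (LINT w|M. LINT v|spin_measure. h (w, v))" by (rule P.integral_fst'[OF h, symmetric])
  finally show "trunc_cauchy (smear M E) s t a = (LINT w|M. LINT v|spin_measure. cutoff_kernel s t (a - w - of_real (infdist w E / 8) * v))"
    by (simp add: h_def diff_diff_eq)
  show "integrable M (\<lambda>w. LINT v|spin_measure. cutoff_kernel s t (a - w - of_real (infdist w E / 8) * v))"
    using P.integrable_fst'[OF h] by (simp add: h_def diff_diff_eq)
qed

text \<open>
  The average over a region not containing the pole equals the value at its centre, unless the region
  meets the boundary of the cutoff annulus, which can happen only at distances near \<open>s\<close> and \<open>t\<close>.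
\<close>

lemma spin_average_cutoff_kernel:
  assumes s: "0 < s" and t: "0 < t" and \<rho>: "0 \<le> \<rho>" "8 * \<rho> \<le> cmod b"
  shows "cmod (cutoff_kernel s t b - (LINT v|spin_measure. cutoff_kernel s t (b - of_real \<rho> * v)))
    \<le> (if cmod b < 2 * s then 2 / s else 0) + (if cmod b < 2 * t then 5 / t else 0)"
proof -
  interpret S: finite_measure spin_measure by (rule finite_spin_measure)
  let ?I = "LINT v|spin_measure. cutoff_kernel s t (b - of_real \<rho> * v)"
  have int: "integrable spin_measure (\<lambda>v. cutoff_kernel s t (b - of_real \<rho> * v))"
    by (rule S.integrable_const_bound[of _ "1 / s"]) (use norm_cutoff_kernel_le[OF s] in auto)
  have near: "AE v in spin_measure. 3 / 4 * cmod b \<le> cmod (b - of_real \<rho> * v) \<and> cmod (b - of_real \<rho> * v) \<le> 5 / 4 * cmod b"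
    using AE_spin_measure
  proof eventually_elim
    case (elim v)
    have "cmod (of_real \<rho> * v) \<le> \<rho> * 2"
      using mult_left_mono[OF elim \<rho>(1)] \<rho>(1) by (simp add: norm_mult)
    then have "cmod (of_real \<rho> * v) \<le> cmod b / 4" using \<rho>(2) by linarith
    then show ?case
      using norm_triangle_ineq2[of b "of_real \<rho> * v"] norm_triangle_ineq4[of b "of_real \<rho> * v"] by linarith
  qed
  have bound: "cmod ?I \<le> B" if "AE v in spin_measure. cmod (cutoff_kernel s t (b - of_real \<rho> * v)) \<le> B" for B
  proof -
    have "cmod ?I \<le> (LINT v|spin_measure. cmod (cutoff_kernel s t (b - of_real \<rho> * v)))"
      by (rule integral_norm_bound)
    also have "\<dots> \<le> (LINT v|spin_measure. B)"
      by (rule integral_mono_AE) (use int that in auto)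
    finally show ?thesis by (simp add: measure_def)
  qed
  consider "cmod b < 2 * s" | "2 * s \<le> cmod b" "cmod b < t / 2" | "2 * s \<le> cmod b" "t / 2 \<le> cmod b" "cmod b < 2 * t" | "2 * s \<le> cmod b" "2 * t \<le> cmod b"
    by linarith
  then show ?thesis
  proof cases
    case 1
    have "cmod ?I \<le> 1 / s" by (rule bound) (use norm_cutoff_kernel_le[OF s] in auto)
    then have "cmod (cutoff_kernel s t b - ?I) \<le> 2 / s"
      using norm_triangle_ineq4[of "cutoff_kernel s t b" ?I] norm_cutoff_kernel_le[OF s, of t b] by simp
    then show ?thesis using 1 t by (simp add: add_increasing2)
  next
    case 2
    have "?I = (LINT v|spin_measure. 1 / (b - of_real \<rho> * v))"
    proof (rule integral_cong_AE)
      show "AE v in spin_measure. cutoff_kernel s t (b - of_real \<rho> * v) = 1 / (b - of_real \<rho> * v)"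
        using near by eventually_elim (use 2 in \<open>auto simp: cutoff_kernel_def\<close>)
    qed auto
    also have "\<dots> = 1 / b" by (rule mean_value_spin_measure) (use \<rho> 2 s in auto)
    also have "1 / b = cutoff_kernel s t b" using 2 s by (simp add: cutoff_kernel_def)
    finally show ?thesis using 2 s t by simp
  next
    case 3
    have b0: "0 < cmod b" using 3 s by linarith
    have "cmod ?I \<le> 8 / (3 * t)"
    proof (rule bound)
      show "AE v in spin_measure. cmod (cutoff_kernel s t (b - of_real \<rho> * v)) \<le> 8 / (3 * t)"
        using near
      proof eventually_elim
        case (elim v)
        have "3 * t / 8 \<le> cmod (b - of_real \<rho> * v)" using elim 3 by linarith
        then have "1 / cmod (b - of_real \<rho> * v) \<le> 1 / (3 * t / 8)" using t by (intro frac_le) auto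
        then show ?case using t by (auto simp: cutoff_kernel_def norm_divide)
      qed
    qed
    moreover have "cmod (cutoff_kernel s t b) \<le> 2 / t"
    proof -
      have "1 / cmod b \<le> 1 / (t / 2)" using 3 t by (intro frac_le) auto
      then show ?thesis using t by (auto simp: cutoff_kernel_def norm_divide)
    qed
    moreover have "8 / (3 * t) + 2 / t \<le> 5 / t" using t by (simp add: field_simps)
    ultimately have "cmod (cutoff_kernel s t b - ?I) \<le> 5 / t"
      using norm_triangle_ineq4[of "cutoff_kernel s t b" ?I] by linarith
    then show ?thesis using 3 s by simp
  next
    case 4
    have "cmod ?I \<le> 0"
      by (rule bound) (use near in eventually_elim, use 4 t in \<open>auto simp: cutoff_kernel_def\<close>)
    then show ?thesis using 4 t s by (simp add: cutoff_kernel_def)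
  qed
qed

text \<open>
  At points of \<open>E\<close> smearing does not change the truncated Cauchy integral except near the two ends of the annulus,
  and the mass there is small by the growth condition.
\<close>

lemma trunc_cauchy_smear_diff:
  assumes M: "sets M = sets borel" "finite_measure M" and a: "a \<in> E" and st: "0 < s" "s \<le> t" and N: "0 \<le> N"
    and growth: "\<And>r. 0 < r \<Longrightarrow> measure M (ball a r) \<le> N * phi r"
  shows "cmod (trunc_cauchy M s t a - trunc_cauchy (smear M E) s t a) \<le> 14 * N * gauge_ratio (2 * t)"
proof -
  interpret finite_measure M by fact
  note M(1)[measurable_cong]
  have sp: "space M = UNIV" using sets_eq_imp_space_eq[OF M(1)] by simp
  have t: "0 < t" using st by linarith
  have ball: "ball a r \<in> sets M" for r unfolding M(1) by simp
  let ?A = "\<lambda>w. LINT v|spin_measure. cutoff_kernel s t (a - w - of_real (infdist w E / 8) * v)"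
  have "trunc_cauchy M s t a - trunc_cauchy (smear M E) s t a = (LINT w|M. cutoff_kernel s t (a - w) - ?A w)"
    unfolding trunc_cauchy_smear(1)[OF M st(1)]
    unfolding trunc_cauchy_def
    by (rule Bochner_Integration.integral_diff[symmetric]) (rule integrable_cutoff_kernel[OF M st(1)] trunc_cauchy_smear(2)[OF M st(1)])+
  also have "cmod \<dots> \<le> (LINT w|M. 2 / s * indicator (ball a (2 * s)) w + 5 / t * indicator (ball a (2 * t)) w)"
  proof (rule Bochner_Integration.integral_norm_bound_integral)
    show "integrable M (\<lambda>w. cutoff_kernel s t (a - w) - ?A w)"
      by (intro Bochner_Integration.integrable_diff integrable_cutoff_kernel[OF M st(1)] trunc_cauchy_smear(2)[OF M st(1)])
    show "integrable M (\<lambda>w. 2 / s * indicator (ball a (2 * s)) w + 5 / t * indicator (ball a (2 * t)) w)"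
      using ball by (intro Bochner_Integration.integrable_add integrable_mult_right integrable_real_indicator) (auto simp: less_top[symmetric])
    fix w
    have "8 * (infdist w E / 8) \<le> cmod (a - w)"
      using infdist_le[OF a, of w] by (simp add: dist_norm norm_minus_commute)
    then have "cmod (cutoff_kernel s t (a - w) - ?A w)
      \<le> (if cmod (a - w) < 2 * s then 2 / s else 0) + (if cmod (a - w) < 2 * t then 5 / t else 0)"
      by (intro spin_average_cutoff_kernel st t) (auto simp: infdist_nonneg)
    also have "\<dots> = 2 / s * indicator (ball a (2 * s)) w + 5 / t * indicator (ball a (2 * t)) w"
      by (auto simp: indicator_def dist_norm)
    finally show "cmod (cutoff_kernel s t (a - w) - ?A w) \<le> 2 / s * indicator (ball a (2 * s)) w + 5 / t * indicator (ball a (2 * t)) w" .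
  qed
  also have "\<dots> = 2 / s * measure M (ball a (2 * s)) + 5 / t * measure M (ball a (2 * t))"
    using ball by (subst Bochner_Integration.integral_add) (auto simp: sp less_top[symmetric] intro!: integrable_mult_right integrable_real_indicator)
  also have "2 / s * measure M (ball a (2 * s)) \<le> 4 * N * gauge_ratio (2 * s)"
  proof -
    have "2 / s * measure M (ball a (2 * s)) \<le> 2 / s * (N * phi (2 * s))"
      using st by (intro mult_left_mono growth) auto
    then show ?thesis using st by (simp add: phi_eq_gauge_ratio)
  qed
  also have "4 * N * gauge_ratio (2 * s) \<le> 4 * N * gauge_ratio (2 * t)"
    using N st by (intro mult_left_mono gauge_ratio_mono) auto
  also have "5 / t * measure M (ball a (2 * t)) \<le> 10 * N * gauge_ratio (2 * t)"
  proof -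
    have "5 / t * measure M (ball a (2 * t)) \<le> 5 / t * (N * phi (2 * t))"
      using t by (intro mult_left_mono growth) auto
    then show ?thesis using t by (simp add: phi_eq_gauge_ratio)
  qed
  finally show ?thesis by simp
qed


section \<open>Existence of principal values\<close>

text \<open>
  Its limit as \<open>r\<close> tends to \<open>0\<close> is the principal value of the Cauchy integral at \<open>a\<close>; up to sign and
  conjugation it is the gradient of the logarithmic potential.
\<close>

definition cauchy_tail :: "complex measure \<Rightarrow> complex \<Rightarrow> real \<Rightarrow> complex" where
  "cauchy_tail M a r = (LINT w|M. (if r \<le> cmod (a - w) then 1 / (a - w) else 0))"

lemma integrable_cauchy_tail:
  assumes "sets M = sets borel" "finite_measure M" "0 < r"
  shows "integrable M (\<lambda>w. if r \<le> cmod (a - w) then 1 / (a - w) else 0)"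
proof -
  note assms(1)[measurable_cong]
  show ?thesis
    by (rule finite_measure.integrable_const_bound[OF assms(2), of _ "1 / r"])
       (use assms(3) in \<open>auto simp: norm_divide intro!: frac_le\<close>)
qed

lemma cauchy_tail_diff:
  assumes M: "sets M = sets borel" "finite_measure M" and "0 < s" "s \<le> t"
  shows "cauchy_tail M a s - cauchy_tail M a t = trunc_cauchy M s t a"
  unfolding cauchy_tail_def trunc_cauchy_def
  by (subst Bochner_Integration.integral_diff[symmetric])
     (use assms in \<open>auto intro!: integrable_cauchy_tail Bochner_Integration.integral_cong simp: cutoff_kernel_def\<close>)

text \<open>
  The Borel-Cantelli lemma for the content.
\<close>

lemma phi_content_limsup_null:
  fixes F :: "nat \<Rightarrow> complex set"
  assumes c: "summable c" "\<And>i. 0 \<le> c i" and F: "\<And>i. i0 \<le> i \<Longrightarrow> phi_content (F i) \<le> ennreal (c i)"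
  shows "phi_content {a. \<forall>n. \<exists>i\<ge>n. a \<in> F i} = 0"
proof (rule phi_content_eq_0I)
  fix e :: real assume "0 < e"
  then obtain N where N: "\<And>n. N \<le> n \<Longrightarrow> norm (\<Sum>i. c (i + n)) < e"
    using suminf_exist_split[OF _ c(1)] by blast
  define n where "n = max N i0"
  have "{a. \<forall>n. \<exists>i\<ge>n. a \<in> F i} \<subseteq> (\<Union>i. F (i + n))"
  proof
    fix a assume "a \<in> {a. \<forall>n. \<exists>i\<ge>n. a \<in> F i}"
    then obtain i where "n \<le> i" "a \<in> F i" by blast
    then show "a \<in> (\<Union>i. F (i + n))" by (intro UN_I[of "i - n"]) auto
  qed
  then have "phi_content {a. \<forall>n. \<exists>i\<ge>n. a \<in> F i} \<le> phi_content (\<Union>i. F (i + n))"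
    by (rule phi_content_mono)
  also have "\<dots> \<le> (\<Sum>i. phi_content (F (i + n)))" by (rule phi_content_UN_le)
  also have "\<dots> \<le> (\<Sum>i. ennreal (c (i + n)))"
    by (intro suminf_le F) (auto simp: n_def)
  also have "\<dots> = ennreal (\<Sum>i. c (i + n))"
    using c summable_ignore_initial_segment[OF c(1), of n] by (intro suminf_ennreal2) auto
  also have "\<dots> \<le> ennreal e" using N[of n] by (intro ennreal_leI) (auto simp: n_def)
  finally show "phi_content {a. \<forall>n. \<exists>i\<ge>n. a \<in> F i} \<le> ennreal e" .
qed

text \<open>
  Fifth powers are a compromise. There are about \<open>i\<^sup>4\<close> dyadic scales between consecutive members, each
  with density of order \<open>1 / i\<^sup>5\<close>. The trivial bound for the Cauchy integral in between is therefore
  of order \<open>1 / i\<close> and tends to \<open>0\<close>, while the \<open>L\<^sup>2\<close> bound is of order \<open>i\<^sup>4 / i\<^sup>1\<^sup>0 = 1 / i\<^sup>6\<close>; the threshold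
  \<open>1 / i\<^sup>2\<close> for the increments then is summable and is exceeded only on sets of content of order \<open>1 / i\<^sup>2\<close>.
\<close>

definition scale :: "nat \<Rightarrow> real" where
  "scale i = (1/2) ^ (i ^ 5)"

lemma scale_pos [simp]: "0 < scale i"
  by (simp add: scale_def)

lemma scale_nonneg [simp]: "0 \<le> scale i"
  by (simp add: scale_def)

lemma scale_antimono: "i \<le> j \<Longrightarrow> scale j \<le> scale i"
  unfolding scale_def by (intro power_decreasing power_mono) auto

lemma scale_step: "scale i = 2 ^ (Suc i ^ 5 - i ^ 5) * scale (Suc i)"
proof -
  have le: "i ^ 5 \<le> Suc i ^ 5" by (intro power_mono) auto
  define n where "n = Suc i ^ 5 - i ^ 5"
  have "Suc i ^ 5 = n + i ^ 5" unfolding n_def using le by linarith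
  then have "scale (Suc i) = (1/2) ^ n * scale i" unfolding scale_def by (simp only: power_add)
  moreover have "2 ^ n * (1/2::real) ^ n = 1" by (simp flip: power_mult_distrib)
  ultimately show ?thesis unfolding n_def[symmetric] by (simp flip: mult.assoc)
qed

lemma fifth_power_gap: "1 \<le> i \<Longrightarrow> real (Suc i ^ 5 - i ^ 5) \<le> 31 * real i ^ 4"
proof -
  assume i: "1 \<le> i"
  define x where "x = real i"
  have x: "1 \<le> x" using i by (simp add: x_def)
  have le: "i ^ 5 \<le> Suc i ^ 5" by (intro power_mono) auto
  have "real (Suc i ^ 5 - i ^ 5) = (x + 1) ^ 5 - x ^ 5"
    using le by (simp add: of_nat_diff x_def add.commute)
  also have "\<dots> = 5 * x ^ 4 + 10 * x ^ 3 + 10 * x ^ 2 + 5 * x + 1"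
    by (simp add: eval_nat_numeral algebra_simps)
  also have "\<dots> \<le> 31 * x ^ 4"
    using power_increasing[of 3 4 x] power_increasing[of 2 4 x] power_increasing[of 1 4 x] power_increasing[of 0 4 x] x
    by simp
  finally show ?thesis by (simp add: x_def)
qed

lemma gauge_ratio_scale: "1 \<le> i \<Longrightarrow> gauge_ratio (scale i) \<le> 2 / real i ^ 5"
  using gauge_ratio_two_power[of "i ^ 5"] by (simp add: scale_def)

lemma gauge_ratio_twice_scale: assumes "1 \<le> i" shows "gauge_ratio (2 * scale i) \<le> 4 / real i ^ 5"
  using gauge_ratio_double[of "scale i"] gauge_ratio_scale[OF assms] by simp

lemma scale_le: "scale i \<le> 1 / 2 ^ i"
proof -
  have "i \<le> i ^ 5" by (cases "i = 0") (auto intro: self_le_power)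
  then have "scale i \<le> (1/2) ^ i" unfolding scale_def by (intro power_decreasing) auto
  then show ?thesis by (simp add: power_divide)
qed

lemma scale_tendsto_0: "scale \<longlonglongrightarrow> 0"
proof (rule tendsto_sandwich[where f = "\<lambda>_. 0" and h = "\<lambda>i. (1/2) ^ i"])
  show "\<forall>\<^sub>F n in sequentially. scale n \<le> (1 / 2) ^ n"
    using scale_le by (intro always_eventually) (auto simp: power_divide)
  show "(\<lambda>i. (1/2::real) ^ i) \<longlonglongrightarrow> 0" by (rule LIMSEQ_power_zero) simp
qed (auto intro!: always_eventually less_imp_le)

text \<open>
  Convergence along the sequence of scales suffices, because the Cauchy integral varies by at most a
  multiple of \<open>1 / i\<close> between consecutive scales.
\<close>

lemma principal_value_criterion:
  assumes M: "sets M = sets borel" "finite_measure M" and N: "0 \<le> N"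
    and growth: "\<And>r. 0 < r \<Longrightarrow> measure M (ball a r) \<le> N * phi r"
    and small: "\<And>i. i0 \<le> i \<Longrightarrow> cmod (trunc_cauchy M (scale (Suc i)) (scale i) a) \<le> C / real i ^ 2"
  shows "\<exists>c. (cauchy_tail M a \<longlongrightarrow> c) (at_right 0)"
proof -
  define u where "u i = cauchy_tail M a (scale i)" for i
  have diff: "u (Suc i) - u i = trunc_cauchy M (scale (Suc i)) (scale i) a" for i
    unfolding u_def by (rule cauchy_tail_diff[OF M]) (auto intro: scale_antimono)
  have "summable (\<lambda>i. u (Suc i) - u i)"
  proof (rule summable_comparison_test')
    show "summable (\<lambda>i. C * (1 / real i ^ 2))"
      using inverse_power_summable[of 2] by (intro summable_mult) (simp add: inverse_eq_divide)
    fix i assume "i0 \<le> i"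
    then show "norm (u (Suc i) - u i) \<le> C * (1 / real i ^ 2)" unfolding diff using small by simp
  qed
  then have "convergent (\<lambda>n. \<Sum>i<n. u (Suc i) - u i)" by (simp add: summable_iff_convergent)
  then obtain l where "(\<lambda>n. \<Sum>i<n. u (Suc i) - u i) \<longlonglongrightarrow> l" by (auto simp: convergent_def)
  then have "(\<lambda>n. u n - u 0) \<longlonglongrightarrow> l" by (simp add: sum_lessThan_telescope)
  then have "(\<lambda>n. (u n - u 0) + u 0) \<longlonglongrightarrow> l + u 0" by (intro tendsto_add tendsto_const)
  then have u: "u \<longlonglongrightarrow> l + u 0" by simp
  define c where "c = l + u 0"
  have between: "cmod (cauchy_tail M a r - u i) \<le> 124 * N / real i"
    if i: "1 \<le> i" and r: "scale (Suc i) \<le> r" "r \<le> scale i" for i r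
  proof -
    define n where "n = Suc i ^ 5 - i ^ 5"
    have r0: "0 < r" using r(1) scale_pos[of "Suc i"] by linarith
    interpret finite_measure M by fact
    note M(1)[measurable_cong]
    have st: "scale i = 2 ^ n * scale (Suc i)" unfolding n_def by (rule scale_step)
    have "cauchy_tail M a r - u i = trunc_cauchy M r (scale i) a"
      unfolding u_def by (rule cauchy_tail_diff[OF M r0 r(2)])
    also have "cmod \<dots> \<le> (LINT y|M. cmod (cutoff_kernel r (scale i) (a - y)))"
      unfolding trunc_cauchy_def by (rule integral_norm_bound)
    also have "\<dots> \<le> (LINT y|M. (if scale (Suc i) \<le> cmod (a - y) \<and> cmod (a - y) < 2 ^ n * scale (Suc i) then 1 / cmod (a - y) else 0))"
    proof (rule integral_mono)
      show "integrable M (\<lambda>y. cmod (cutoff_kernel r (scale i) (a - y)))"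
        by (intro integrable_norm integrable_cutoff_kernel M r0)
      show "integrable M (\<lambda>y. if scale (Suc i) \<le> cmod (a - y) \<and> cmod (a - y) < 2 ^ n * scale (Suc i) then 1 / cmod (a - y) else 0)"
        by (rule integrable_const_bound[of _ "1 / scale (Suc i)"]) (rule AE_I2, auto intro: frac_le)
      show "cmod (cutoff_kernel r (scale i) (a - y)) \<le>
          (if scale (Suc i) \<le> cmod (a - y) \<and> cmod (a - y) < 2 ^ n * scale (Suc i) then 1 / cmod (a - y) else 0)" for y
        using r unfolding st[symmetric] by (auto simp: cutoff_kernel_def norm_divide)
    qed
    also have "\<dots> \<le> 2 * (N * gauge_ratio (scale i)) * real n"
    proof (rule integral_annulus_le[OF M])
      show "0 \<le> N * gauge_ratio (scale i)" using N gauge_ratio_pos[of "scale i"] by simp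
      fix j assume j: "j < n"
      define R where "R = 2 ^ Suc j * scale (Suc i)"
      have R: "0 < R" by (simp add: R_def)
      have "(2::real) ^ Suc j \<le> 2 ^ n" using j by (intro power_increasing) auto
      then have Rt: "R \<le> scale i" unfolding R_def st by (rule mult_right_mono) simp
      show "measure M (ball a (2 ^ Suc j * scale (Suc i))) \<le> N * gauge_ratio (scale i) * (2 ^ Suc j * scale (Suc i))"
        using le_gauge_ratio_mult[OF N R Rt growth[OF R]] unfolding R_def .
    qed simp
    also have "\<dots> \<le> 2 * (N * (2 / real i ^ 5)) * (31 * real i ^ 4)"
      unfolding n_def using N gauge_ratio_scale[OF i] fifth_power_gap[OF i] gauge_ratio_pos[of "scale i"]
      by (intro mult_mono mult_left_mono mult_nonneg_nonneg) auto
    also have "\<dots> = 124 * N / real i" using i by (simp add: field_simps eval_nat_numeral)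
    finally show ?thesis .
  qed
  have "(cauchy_tail M a \<longlongrightarrow> c) (at_right 0)"
  proof (rule tendstoI)
    fix e :: real assume e: "0 < e"
    have "\<forall>\<^sub>F i in sequentially. dist (u i) c < e / 2"
      using u e unfolding c_def by (intro tendstoD) auto
    then obtain i1 where i1: "\<And>i. i1 \<le> i \<Longrightarrow> dist (u i) c < e / 2" by (auto simp: eventually_sequentially)
    obtain i2 :: nat where i2: "248 * N / e < real i2" using reals_Archimedean2 by blast
    define m where "m = Suc (max i1 i2)"
    have "dist (cauchy_tail M a r) c < e" if r: "0 < r" "r < scale m" for r
    proof -
      have "\<forall>\<^sub>F i in sequentially. scale i < r" using scale_tendsto_0 r(1) by (rule order_tendstoD)
      then obtain j where j: "scale j < r" by (meson eventually_happens' sequentially_bot)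
      \<comment> \<open>locate \<open>r\<close> between two consecutive scales\<close>
      define k where "k = (LEAST k. scale k \<le> r)"
      have k: "scale k \<le> r" unfolding k_def
        by (rule LeastI[of "\<lambda>k. scale k \<le> r" j]) (rule less_imp_le[OF j])
      have km: "m < k"
      proof (rule ccontr)
        assume "\<not> m < k"
        then have "scale m \<le> scale k" by (intro scale_antimono) simp
        then show False using k r(2) by linarith
      qed
      then obtain i where i: "k = Suc i" by (cases k) auto
      then have "i < k" by simp
      then have "\<not> scale i \<le> r" unfolding k_def by (rule not_less_Least)
      then have ri: "r \<le> scale i" by simp
      have im: "m \<le> i" using km i by simp
      have i1': "1 \<le> i" "i1 \<le> i" "real i2 \<le> real i" using im by (auto simp: m_def)
      have "cmod (cauchy_tail M a r - u i) \<le> 124 * N / real i"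
        using between[OF i1'(1)] k ri unfolding i by blast
      also have "\<dots> < e / 2"
      proof -
        have "248 * N / e < real i" using i2 i1' by linarith
        then show ?thesis using e i1' by (simp add: field_simps)
      qed
      finally have "dist (cauchy_tail M a r) (u i) < e / 2" by (simp add: dist_norm)
      then show ?thesis using i1[OF i1'(2)] dist_triangle[of "cauchy_tail M a r" c "u i"] by linarith
    qed
    then show "\<forall>\<^sub>F r in at_right 0. dist (cauchy_tail M a r) c < e"
      unfolding eventually_at_right_field using scale_pos[of m] by blast
  qed
  then show ?thesis ..
qed

text \<open>
  The smeared measure has growth everywhere, so the weak type estimate and the Borel-Cantelli lemma make its
  increments summable at almost every point; at points of \<open>E\<close> the increments of \<open>M\<close> differ from these by a summable
  amount.
\<close>

lemma principal_values_exist: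
  assumes M: "sets M = sets borel" "finite_measure M" and N: "0 \<le> N"
    and growth: "\<And>a r. a \<in> E \<Longrightarrow> 0 < r \<Longrightarrow> measure M (ball a r) \<le> N * phi r"
  shows "phi_content {a \<in> E. \<not> (\<exists>c. (cauchy_tail M a \<longlongrightarrow> c) (at_right 0))} = 0"
proof (cases "E = {}")
  case True
  then show ?thesis by simp
next
  case E: False
  define K where "K = 73728 * N"
  have K: "0 \<le> K" using N by (simp add: K_def)
  define S where "S = smear M E"
  have S: "sets S = sets borel" "finite_measure S" unfolding S_def using finite_smear[OF M] by simp_all
  have S_growth: "measure S (ball x r) \<le> K * phi r" if "0 < r" for x r
    unfolding S_def K_def by (rule smear_growth[OF M E N growth that])
  define T where "T i a = trunc_cauchy S (scale (Suc i)) (scale i) a" for i a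
  define F where "F R i = {x \<in> ball 0 (real R). 1 / real i ^ 2 < cmod (T i x)}" for R i :: nat
  \<comment> \<open>with \<open>g \<le> 4 * (K + 16) / i\<^sup>5\<close> and at most \<open>31 * i\<^sup>4\<close> dyadic scales, \<open>g\<^sup>2\<close> times their number is at most \<open>B / i\<^sup>6\<close>\<close>
  define B where "B = 496 * (K + 16)\<^sup>2"
  have B: "0 < B" using K by (simp add: B_def)
  define C where "C = 6144 * B * measure S UNIV"
  have C: "0 \<le> C" using B by (simp add: C_def)
  \<comment> \<open>from \<open>i0\<close> on, the smallness hypothesis of the weak type estimate holds with threshold \<open>1 / i\<^sup>2\<close>\<close>
  obtain i0 :: nat where i0: "192 * B + 2 < real i0" using reals_Archimedean2 by blast
  have content: "phi_content (F R i) \<le> ennreal (C / real i ^ 2)" if i: "i0 \<le> i" for R i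
  proof -
    define x where "x = real i"
    have ix: "192 * B + 2 < x" using i i0 by (simp add: x_def)
    have x1: "1 \<le> x" "0 < x" using ix B by auto
    have i2: "2 \<le> i" using ix B by (simp add: x_def)
    define g where "g = (K + 16) * gauge_ratio (2 * scale i)"
    have g0: "0 \<le> g" using K gauge_ratio_pos[of "2 * scale i"] by (simp add: g_def)
    have "g \<le> (K + 16) * (4 / x ^ 5)"
      unfolding g_def x_def using K i2 by (intro mult_left_mono gauge_ratio_twice_scale) auto
    then have "g\<^sup>2 \<le> ((K + 16) * (4 / x ^ 5))\<^sup>2" using g0 by (intro power_mono) auto
    then have "g\<^sup>2 * real (Suc i ^ 5 - i ^ 5) \<le> ((K + 16) * (4 / x ^ 5))\<^sup>2 * (31 * x ^ 4)"
      unfolding x_def using fifth_power_gap[of i] i2 by (intro mult_mono) auto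
    also have "\<dots> = B / x ^ 6"
    proof -
      define P where "P = K + 16"
      show ?thesis unfolding B_def P_def[symmetric] using x1 by (simp add: field_simps eval_nat_numeral)
    qed
    finally have gn: "g\<^sup>2 * real (Suc i ^ 5 - i ^ 5) \<le> B / x ^ 6" .
    have "192 * B / x ^ 6 \<le> 1 / x ^ 4"
    proof -
      have "192 * B \<le> x * x"
      proof -
        have "192 * B \<le> 1 * x" using ix by linarith
        also have "1 * x \<le> x * x" using x1 by (intro mult_right_mono) auto
        finally show ?thesis .
      qed
      then have "192 * B * x ^ 4 \<le> x * x * x ^ 4" using x1 by (intro mult_right_mono) auto
      then show ?thesis using x1 by (simp add: field_simps eval_nat_numeral)
    qed
    then have small: "192 * g\<^sup>2 * real (Suc i ^ 5 - i ^ 5) \<le> (1 / real i ^ 2)\<^sup>2"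
      using gn unfolding x_def by (simp add: power_divide flip: power_mult)
    have "phi_content (F R i) \<le> ennreal (6144 * g\<^sup>2 * real (Suc i ^ 5 - i ^ 5) * measure S UNIV / (1 / real i ^ 2)\<^sup>2)"
    proof (rule trunc_cauchy_content[OF S K S_growth _ _ _ _ _ _ _ g_def small])
      show "bounded (F R i)" unfolding F_def by (rule bounded_subset[OF bounded_ball[of 0 "real R"]]) auto
      have "(2::nat) ^ 1 \<le> 2 ^ 5" by simp
      also have "(2::nat) ^ 5 \<le> i ^ 5" using i2 by (rule power_mono) simp
      finally show "2 \<le> i ^ 5" by simp
      show "i ^ 5 \<le> Suc i ^ 5" by (rule power_mono) auto
      show "0 < 1 / real i ^ 2" using x1 by (simp add: x_def)
    qed (auto simp: scale_def F_def T_def)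
    also have "6144 * g\<^sup>2 * real (Suc i ^ 5 - i ^ 5) * measure S UNIV / (1 / real i ^ 2)\<^sup>2
        = 6144 * measure S UNIV * x ^ 4 * (g\<^sup>2 * real (Suc i ^ 5 - i ^ 5))"
      by (simp add: x_def power_divide flip: power_mult)
    also have "\<dots> \<le> 6144 * measure S UNIV * x ^ 4 * (B / x ^ 6)"
      using gn x1 by (intro mult_left_mono) auto
    also have "\<dots> = C / real i ^ 2"
      using x1 unfolding C_def x_def[symmetric] by (simp add: field_simps eval_nat_numeral)
    finally show ?thesis by (simp add: ennreal_leI)
  qed
  have null: "phi_content {a. \<forall>n. \<exists>i\<ge>n. a \<in> F R i} = 0" for R
  proof (rule phi_content_limsup_null)
    show "summable (\<lambda>i. C / real i ^ 2)"
      using summable_mult[OF inverse_power_summable[of 2], of C] by (simp add: divide_inverse)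
  qed (use C content in auto)
  have sub: "{a \<in> E. \<not> (\<exists>c. (cauchy_tail M a \<longlongrightarrow> c) (at_right 0))} \<subseteq> (\<Union>R. {a. \<forall>n. \<exists>i\<ge>n. a \<in> F R i})"
  proof (rule subsetI, rule ccontr)
    fix a assume a: "a \<in> {a \<in> E. \<not> (\<exists>c. (cauchy_tail M a \<longlongrightarrow> c) (at_right 0))}"
      and "a \<notin> (\<Union>R. {a. \<forall>n. \<exists>i\<ge>n. a \<in> F R i})"
    then have nF: "\<not> (\<forall>n. \<exists>i\<ge>n. a \<in> F R i)" for R by blast
    obtain R :: nat where R: "cmod a < real R" using reals_Archimedean2 by blast
    obtain n where n: "\<And>i. n \<le> i \<Longrightarrow> a \<notin> F R i" using nF[of R] by blast
    have "\<exists>c. (cauchy_tail M a \<longlongrightarrow> c) (at_right 0)"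
    proof (rule principal_value_criterion[OF M N])
      show "measure M (ball a r) \<le> N * phi r" if "0 < r" for r using growth a that by blast
      fix i assume i: "max 1 n \<le> i"
      have "cmod (T i a) \<le> 1 / real i ^ 2" using n[of i] i R by (auto simp: F_def)
      moreover have "cmod (trunc_cauchy M (scale (Suc i)) (scale i) a - T i a) \<le> 14 * N * gauge_ratio (2 * scale i)"
        unfolding T_def S_def using a growth
        by (intro trunc_cauchy_smear_diff[OF M]) (auto intro: scale_antimono N)
      moreover have "14 * N * gauge_ratio (2 * scale i) \<le> 56 * N / real i ^ 2"
      proof -
        define x where "x = real i"
        have x: "1 \<le> x" using i by (simp add: x_def)
        have le: "gauge_ratio (2 * scale i) \<le> 4 / x ^ 5"
          unfolding x_def using i by (intro gauge_ratio_twice_scale) auto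
        have "x ^ 2 \<le> x ^ 5" using x by (intro power_increasing) auto
        then have "4 / x ^ 5 \<le> 4 / x ^ 2" using x by (intro divide_left_mono) auto
        with le have "gauge_ratio (2 * scale i) \<le> 4 / x ^ 2" by linarith
        then have "14 * N * gauge_ratio (2 * scale i) \<le> 14 * N * (4 / real i ^ 2)"
          unfolding x_def using N by (intro mult_left_mono) auto
        then show ?thesis by simp
      qed
      moreover have "cmod (trunc_cauchy M (scale (Suc i)) (scale i) a)
          \<le> cmod (trunc_cauchy M (scale (Suc i)) (scale i) a - T i a) + cmod (T i a)"
        by (metis diff_add_cancel norm_triangle_ineq)
      ultimately have "cmod (trunc_cauchy M (scale (Suc i)) (scale i) a) \<le> 56 * N / real i ^ 2 + 1 / real i ^ 2"
        by linarith
      then show "cmod (trunc_cauchy M (scale (Suc i)) (scale i) a) \<le> (56 * N + 1) / real i ^ 2"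
        by (simp add: add_divide_distrib)
    qed
    then show False using a by blast
  qed
  show ?thesis by (rule phi_content_null_subset[OF phi_content_UN_null sub]) (rule null)
qed


section \<open>Logarithmic kernels\<close>

text \<open>
  The kernel \<open>ln (\<rho> / d)\<close>, truncated below at \<open>0\<close> and with its true value \<open>\<infinity>\<close> on the diagonal,
  where \<open>ln (\<rho> / 0) = 0\<close> would be misleading.
\<close>

definition log_kernel :: "real \<Rightarrow> real \<Rightarrow> ennreal" where
  "log_kernel \<rho> d = (if d = 0 then \<infinity> else ennreal (ln (\<rho> / d)))"

lemma log_kernel_measurable [measurable]: "log_kernel \<rho> \<in> borel_measurable borel"
  unfolding log_kernel_def by measurable

text \<open>
  The right-hand side counts the dyadic balls around \<open>x\<close> that contain \<open>w\<close>, which is at least the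
  logarithm to base \<open>2\<close> of \<open>\<rho> / d\<close>. Summing the measures of these balls then bounds logarithmic potentials by a
  geometric series.
\<close>

lemma log_kernel_le_dyadic:
  assumes \<rho>: "0 < \<rho>"
  shows "log_kernel \<rho> (cmod (x - w)) \<le> (\<Sum>j. indicator (ball x (\<rho> / 2 ^ j)) w)"
proof -
  define d where "d = cmod (x - w)"
  have d0: "0 \<le> d" by (simp add: d_def)
  have ball: "w \<in> ball x R \<longleftrightarrow> d < R" for R by (simp add: d_def dist_norm)
  have count: "of_nat m \<le> (\<Sum>j. indicator (ball x (\<rho> / 2 ^ j)) w :: ennreal)"
    if "\<And>j. j < m \<Longrightarrow> d < \<rho> / 2 ^ j" for m
  proof -
    have "of_nat m = (\<Sum>j<m. indicator (ball x (\<rho> / 2 ^ j)) w :: ennreal)"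
      using that ball by (simp add: indicator_def)
    also have "\<dots> \<le> (\<Sum>j. indicator (ball x (\<rho> / 2 ^ j)) w)" by (rule sum_le_suminf) auto
    finally show ?thesis .
  qed
  show ?thesis
  proof (cases "d = 0")
    case True
    have "(\<Sum>j. indicator (ball x (\<rho> / 2 ^ j)) w :: ennreal) = \<infinity>"
    proof (rule ccontr)
      assume "(\<Sum>j. indicator (ball x (\<rho> / 2 ^ j)) w :: ennreal) \<noteq> \<infinity>"
      then obtain c where c: "0 \<le> c" "(\<Sum>j. indicator (ball x (\<rho> / 2 ^ j)) w) = ennreal c"
        by (cases "\<Sum>j. indicator (ball x (\<rho> / 2 ^ j)) w :: ennreal") auto
      obtain m :: nat where "c < real m" using reals_Archimedean2 by blast
      moreover have "of_nat m \<le> ennreal c" using count[of m] \<rho> True unfolding c(2) by simp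
      then have "ennreal (real m) \<le> ennreal c" by (simp add: ennreal_of_nat_eq_real_of_nat)
      then have "real m \<le> c" using c(1) by (simp add: ennreal_le_iff)
      ultimately show False by simp
    qed
    then show ?thesis by simp
  next
    case False
    then have d: "0 < d" using d0 by simp
    define m where "m = nat \<lceil>log 2 (\<rho> / d)\<rceil>"
    have "d < \<rho> / 2 ^ j" if "j < m" for j
    proof -
      have "real j < log 2 (\<rho> / d)" using that unfolding m_def by linarith
      then have "2 powr real j < \<rho> / d" using d \<rho> by (simp add: less_log_iff)
      then have "2 ^ j < \<rho> / d" by (simp add: powr_realpow)
      then show ?thesis using d by (simp add: field_simps)
    qed
    from count[OF this] have "of_nat m \<le> (\<Sum>j. indicator (ball x (\<rho> / 2 ^ j)) w :: ennreal)" .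
    moreover have "ln (\<rho> / d) \<le> real m"
    proof (cases "\<rho> / d \<le> 1")
      case True
      then have "ln (\<rho> / d) \<le> 0" using d \<rho> by simp
      then show ?thesis by linarith
    next
      case False
      then have "0 \<le> ln (\<rho> / d)" by simp
      moreover have "ln 2 \<le> (1::real)" "0 < ln (2::real)" using ln_2_less_1 by simp_all
      ultimately have "ln (\<rho> / d) \<le> ln (\<rho> / d) / ln 2" by (simp add: le_divide_eq mult_left_le)
      also have "\<dots> = log 2 (\<rho> / d)" by (simp add: log_def)
      also have "\<dots> \<le> real m" unfolding m_def by linarith
      finally show ?thesis .
    qed
    then have "ennreal (ln (\<rho> / d)) \<le> of_nat m"
      by (simp add: ennreal_of_nat_eq_real_of_nat ennreal_leI)
    ultimately have "ennreal (ln (\<rho> / d)) \<le> (\<Sum>j. indicator (ball x (\<rho> / 2 ^ j)) w)"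
      by (rule order_trans[rotated])
    then show ?thesis using False unfolding log_kernel_def d_def[symmetric] by simp
  qed
qed

lemma nn_integral_log_kernel_le:
  assumes M: "sets M = sets borel" "finite_measure M" and S: "S \<in> sets borel" and \<rho>: "0 < \<rho>" and g: "0 \<le> g"
    and growth: "\<And>j. measure M (S \<inter> ball x (\<rho> / 2 ^ j)) \<le> g * (\<rho> / 2 ^ j)"
  shows "(\<integral>\<^sup>+ w. log_kernel \<rho> (cmod (x - w)) * indicator S w \<partial>M) \<le> ennreal (2 * g * \<rho>)"
proof -
  interpret finite_measure M by fact
  note M(1)[measurable_cong]
  have [measurable]: "ball x R \<in> sets borel" for R by simp
  note S[measurable]
  have SM: "S \<inter> ball x R \<in> sets M" for R unfolding M(1) using S by simp
  have "(\<integral>\<^sup>+ w. log_kernel \<rho> (cmod (x - w)) * indicator S w \<partial>M)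
      \<le> (\<integral>\<^sup>+ w. (\<Sum>j. indicator (S \<inter> ball x (\<rho> / 2 ^ j)) w) \<partial>M)"
  proof (rule nn_integral_mono)
    fix w show "log_kernel \<rho> (cmod (x - w)) * indicator S w \<le> (\<Sum>j. indicator (S \<inter> ball x (\<rho> / 2 ^ j)) w)"
      using log_kernel_le_dyadic[OF \<rho>, of x w] by (cases "w \<in> S") (auto simp: indicator_def)
  qed
  also have "\<dots> = (\<Sum>j. \<integral>\<^sup>+ w. indicator (S \<inter> ball x (\<rho> / 2 ^ j)) w \<partial>M)"
    by (rule nn_integral_suminf) measurable
  also have "\<dots> = (\<Sum>j. emeasure M (S \<inter> ball x (\<rho> / 2 ^ j)))"
    using SM by simp
  also have "\<dots> \<le> (\<Sum>j. ennreal (2 * g * \<rho> * (1/2) ^ Suc j))"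
  proof (intro suminf_le)
    fix j
    have "measure M (S \<inter> ball x (\<rho> / 2 ^ j)) \<le> 2 * g * \<rho> * (1/2) ^ Suc j"
      using growth[of j] by (simp add: power_divide)
    then show "emeasure M (S \<inter> ball x (\<rho> / 2 ^ j)) \<le> ennreal (2 * g * \<rho> * (1/2) ^ Suc j)"
      by (simp only: emeasure_eq_measure ennreal_leI)
  qed auto
  also have "\<dots> = ennreal (2 * g * \<rho>)"
    using sums_mult[OF power_half_series, of "2 * g * \<rho>"] g \<rho>
    by (intro sums_unique[symmetric] sums_ennreal[THEN iffD2]) auto
  finally show ?thesis .
qed

text \<open>
  A single point of convergence already makes the logarithm integrable at infinity, and this does not depend on the point.
\<close>

lemma log_integrable_imp_far:
  assumes M: "sets M = sets borel" "finite_measure M" and z: "log_integrable M z"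
  shows "integrable M (\<lambda>w. ln (1 + cmod w))"
proof (rule Bochner_Integration.integrable_bound)
  interpret finite_measure M by fact
  note M(1)[measurable_cong]
  show "integrable M (\<lambda>w. \<bar>ln (1 / cmod (z - w))\<bar> + (ln 2 + ln (1 + cmod z)))"
    using z by (simp add: log_integrable_def)
  show "(\<lambda>w. ln (1 + cmod w)) \<in> borel_measurable M" by measurable
  show "AE w in M. norm (ln (1 + cmod w)) \<le> norm (\<bar>ln (1 / cmod (z - w))\<bar> + (ln 2 + ln (1 + cmod z)))"
  proof (rule AE_I2)
    fix w
    define d where "d = cmod (z - w)"
    have "cmod w \<le> cmod z + d" unfolding d_def using norm_triangle_ineq4[of z "z - w"] by simp
    moreover have "(1 + cmod z) * (1 + d) = 1 + cmod z + d + cmod z * d" by (simp add: algebra_simps)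
    moreover have "0 \<le> cmod z * d" by (simp add: d_def)
    ultimately have "1 + cmod w \<le> (1 + cmod z) * (1 + d)" by linarith
    then have "ln (1 + cmod w) \<le> ln ((1 + cmod z) * (1 + d))"
      by (intro ln_mono) (auto intro: add_pos_nonneg)
    also have "\<dots> = ln (1 + cmod z) + ln (1 + d)"
      by (rule ln_mult_pos) (auto simp: d_def intro: add_pos_nonneg)
    also have "ln (1 + d) \<le> \<bar>ln (1 / d)\<bar> + ln 2"
    proof (cases "d \<le> 1")
      case True
      then have "ln (1 + d) \<le> ln 2" by (intro ln_mono) (auto simp: d_def intro: add_pos_nonneg)
      then show ?thesis by simp
    next
      case False
      then have "ln (1 + d) \<le> ln (2 * d)" by (intro ln_mono) auto
      also have "\<dots> = ln 2 + ln d" using False by (intro ln_mult_pos) auto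
      finally show ?thesis using False by (simp add: ln_div)
    qed
    finally have "ln (1 + cmod w) \<le> \<bar>ln (1 / d)\<bar> + (ln 2 + ln (1 + cmod z))" by simp
    then show "norm (ln (1 + cmod w)) \<le> norm (\<bar>ln (1 / cmod (z - w))\<bar> + (ln 2 + ln (1 + cmod z)))"
      unfolding d_def by simp
  qed
qed

lemma log_integrableI:
  assumes M: "sets M = sets borel" "finite_measure M" and far: "integrable M (\<lambda>w. ln (1 + cmod w))"
    and \<rho>: "0 < \<rho>" and \<delta>: "0 < \<delta>"
    and fin: "(\<integral>\<^sup>+ w. log_kernel \<rho> (cmod (x - w)) * indicator (ball x \<delta>) w \<partial>M) < \<infinity>"
  shows "log_integrable M x"
proof -
  interpret finite_measure M by fact
  note M(1)[measurable_cong]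
  have [measurable]: "ball x R \<in> sets borel" for R by simp
  have sx: "{x} \<in> sets M" unfolding M(1) by simp
  let ?P = "\<integral>\<^sup>+ w. log_kernel \<rho> (cmod (x - w)) * indicator (ball x \<delta>) w \<partial>M"
  have "\<infinity> * emeasure M {x} = (\<integral>\<^sup>+ w. \<infinity> * indicator {x} w \<partial>M)"
    by (rule nn_integral_cmult_indicator[OF sx, symmetric])
  also have "\<dots> \<le> ?P"
    using \<delta> by (intro nn_integral_mono) (auto simp: log_kernel_def indicator_def)
  finally have "\<infinity> * emeasure M {x} < \<infinity>" using fin by (rule le_less_trans)
  then have atom: "emeasure M {x} = 0" by (auto simp: ennreal_mult_less_top)
  define C where "C = \<bar>ln \<rho>\<bar> + \<bar>ln \<delta>\<bar> + ln (1 + cmod x)"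
  have C: "0 \<le> C" by (simp add: C_def)
  have pt: "ennreal (norm (ln (1 / cmod (x - w)))) \<le> log_kernel \<rho> (cmod (x - w)) * indicator (ball x \<delta>) w + (ennreal C + ennreal (ln (1 + cmod w)))" for w
  proof (cases "w = x")
    case False
    define d where "d = cmod (x - w)"
    have d: "0 < d" using False by (simp add: d_def)
    have "d \<le> cmod x + cmod w" unfolding d_def by (rule norm_triangle_ineq4)
    moreover have "(1 + cmod x) * (1 + cmod w) = 1 + cmod x + cmod w + cmod x * cmod w" by (simp add: algebra_simps)
    moreover have "0 \<le> cmod x * cmod w" by simp
    ultimately have "d \<le> (1 + cmod x) * (1 + cmod w)" by linarith
    then have "ln d \<le> ln ((1 + cmod x) * (1 + cmod w))" using d by (intro ln_mono) auto
    also have "\<dots> = ln (1 + cmod x) + ln (1 + cmod w)" by (rule ln_mult_pos) (auto intro: add_pos_nonneg)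
    finally have up: "ln d \<le> ln (1 + cmod x) + ln (1 + cmod w)" .
    have nn: "0 \<le> ln (1 + cmod w)" "0 \<le> ln (1 + cmod x)" by simp_all
    have eq: "ln (1 / d) = - ln d" using d by (simp add: ln_div)
    show ?thesis
    proof (cases "d < \<delta>")
      case True
      have "ln (\<rho> / d) = ln \<rho> - ln d" using d \<rho> by (simp add: ln_div)
      then have "\<bar>ln (1 / d)\<bar> \<le> max 0 (ln (\<rho> / d)) + (C + ln (1 + cmod w))"
        using up nn unfolding eq C_def by linarith
      then have "ennreal \<bar>ln (1 / d)\<bar> \<le> ennreal (max 0 (ln (\<rho> / d)) + (C + ln (1 + cmod w)))" by (rule ennreal_leI)
      also have "\<dots> = ennreal (max 0 (ln (\<rho> / d))) + (ennreal C + ennreal (ln (1 + cmod w)))"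
        using C nn by (simp add: ennreal_plus)
      also have "ennreal (max 0 (ln (\<rho> / d))) = log_kernel \<rho> d" using d by (auto simp: log_kernel_def max_def ennreal_neg)
      finally show ?thesis using True unfolding d_def[symmetric] by (simp add: indicator_def dist_norm d_def[symmetric])
    next
      case F: False
      then have "ln \<delta> \<le> ln d" using \<delta> by (intro ln_mono) auto
      then have "\<bar>ln (1 / d)\<bar> \<le> C + ln (1 + cmod w)" using up nn unfolding eq C_def by linarith
      then have "ennreal \<bar>ln (1 / d)\<bar> \<le> ennreal (C + ln (1 + cmod w))" by (rule ennreal_leI)
      also have "\<dots> = ennreal C + ennreal (ln (1 + cmod w))" using C nn by (simp add: ennreal_plus)
      finally show ?thesis unfolding d_def[symmetric] by (simp add: add_increasing)
    qed
  qed simp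
  have "(\<integral>\<^sup>+ w. ennreal (norm (ln (1 / cmod (x - w)))) \<partial>M) \<le>
      (\<integral>\<^sup>+ w. log_kernel \<rho> (cmod (x - w)) * indicator (ball x \<delta>) w + (ennreal C + ennreal (ln (1 + cmod w))) \<partial>M)"
    by (rule nn_integral_mono) (rule pt)
  also have "\<dots> = ?P + (\<integral>\<^sup>+ w. ennreal C + ennreal (ln (1 + cmod w)) \<partial>M)"
    by (rule nn_integral_add) measurable
  also have "(\<integral>\<^sup>+ w. ennreal C + ennreal (ln (1 + cmod w)) \<partial>M) = (\<integral>\<^sup>+ w. ennreal C \<partial>M) + (\<integral>\<^sup>+ w. ennreal (ln (1 + cmod w)) \<partial>M)"
    by (rule nn_integral_add) measurable
  also have "\<dots> = ennreal C * emeasure M (space M) + ennreal (LINT w|M. ln (1 + cmod w))"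
    using nn_integral_eq_integral[OF far] by simp
  also have "?P + \<dots> < \<infinity>" using fin by (simp add: emeasure_eq_measure ennreal_mult_less_top)
  finally have "integrable M (\<lambda>w. ln (1 / cmod (x - w)))"
    by (intro integrableI_bounded) auto
  with atom show ?thesis by (simp add: log_integrable_def)
qed

lemma ln_norm_one_plus:
  assumes "cmod z \<le> 1 / 2" shows "\<bar>ln (cmod (1 + z)) - Re z\<bar> \<le> 2 * (cmod z)\<^sup>2"
proof -
  have nz: "1 + z \<noteq> 0"
  proof
    assume "1 + z = 0"
    then have "z = -1" by (simp add: add_eq_0_iff)
    with assms show False by simp
  qed
  have "\<bar>ln (cmod (1 + z)) - Re z\<bar> = \<bar>Re (Ln (1 + z) - z)\<bar>" using nz by simp
  also have "\<dots> \<le> cmod (Ln (1 + z) - z)" by (rule abs_Re_le_cmod)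
  also have "\<dots> \<le> (cmod z)\<^sup>2 / (1 - cmod z)" using assms by (intro Ln_approx_linear) auto
  also have "\<dots> \<le> (cmod z)\<^sup>2 / (1 / 2)" using assms by (intro divide_left_mono) auto
  finally show ?thesis by simp
qed

text \<open>
  The contributions of the dyadic annuli decay geometrically, so the bound does not involve the number \<open>n\<close> of annuli,
  unlike the one for the first power.
\<close>

lemma integral_inverse_square_annulus_le:
  fixes x :: complex
  assumes M: "sets M = sets borel" "finite_measure M" and s: "0 < s" and g: "0 \<le> g"
    and growth: "\<And>i. i < n \<Longrightarrow> measure M (ball x (2 ^ Suc i * s)) \<le> g * (2 ^ Suc i * s)"
  shows "(LINT y|M. (if s \<le> cmod (x - y) then 1 / (cmod (x - y))\<^sup>2 else 0))
    \<le> 4 * g / s * (1 - 1 / 2 ^ n) + measure M UNIV / (2 ^ n * s)\<^sup>2"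
proof -
  note M(1)[measurable_cong]
  interpret finite_measure M by fact
  have sp: "space M = UNIV" using sets_eq_imp_space_eq[OF M(1)] by simp
  have [measurable]: "ball x r \<in> sets M" for r unfolding M(1) by simp
  let ?f = "\<lambda>a y. if a \<le> cmod (x - y) then 1 / (cmod (x - y))\<^sup>2 else 0"
  have int: "integrable M (?f a)" if "0 < a" for a
    by (rule integrable_const_bound[of _ "1 / a\<^sup>2"]) (rule AE_I2, use that in \<open>auto intro!: frac_le power_mono\<close>)
  have tail: "(LINT y|M. ?f a y) \<le> measure M UNIV / a\<^sup>2" if "0 < a" for a
  proof -
    have "(LINT y|M. ?f a y) \<le> (LINT y|M. 1 / a\<^sup>2)"
      using that by (intro integral_mono int) (auto intro!: frac_le power_mono)
    then show ?thesis by (simp add: sp)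
  qed
  have "(LINT y|M. ?f s y) \<le> 4 * g / s * (1 - 1 / 2 ^ n) + (LINT y|M. ?f (2 ^ n * s) y)"
    using growth
  proof (induction n)
    case (Suc n)
    define r where "r = 2 ^ n * s"
    have r: "0 < r" using s by (simp add: r_def)
    have r2: "2 ^ Suc n * s = 2 * r" by (simp add: r_def)
    have c_int: "integrable M (\<lambda>y. 1 / r\<^sup>2 * indicator (ball x (2 * r)) y)"
      by (rule integrable_const_bound[of _ "1 / r\<^sup>2"]) (rule AE_I2, auto split: split_indicator)
    have "(LINT y|M. ?f r y) \<le> (LINT y|M. 1 / r\<^sup>2 * indicator (ball x (2 * r)) y + ?f (2 * r) y)"
    proof (rule integral_mono)
      show "integrable M (?f r)" by (rule int[OF r])
      show "integrable M (\<lambda>y. 1 / r\<^sup>2 * indicator (ball x (2 * r)) y + ?f (2 * r) y)"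
        using r by (intro Bochner_Integration.integrable_add c_int int) auto
      show "?f r y \<le> 1 / r\<^sup>2 * indicator (ball x (2 * r)) y + ?f (2 * r) y" for y
        using r by (auto simp: dist_norm indicator_def intro!: frac_le power_mono)
    qed
    also have "\<dots> = (LINT y|M. 1 / r\<^sup>2 * indicator (ball x (2 * r)) y) + (LINT y|M. ?f (2 * r) y)"
      using r by (intro Bochner_Integration.integral_add c_int int) auto
    also have "(LINT y|M. 1 / r\<^sup>2 * indicator (ball x (2 * r)) y) = 1 / r\<^sup>2 * measure M (ball x (2 * r))"
      by (simp add: sp)
    also have "\<dots> \<le> 1 / r\<^sup>2 * (g * (2 * r))"
      using Suc.prems[of n] unfolding r2 by (intro mult_left_mono) auto
    also have "\<dots> = 4 * g / s * (1 / 2 ^ n - 1 / 2 ^ Suc n)"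
      using s r unfolding r_def by (simp add: field_simps power2_eq_square)
    finally have step: "(LINT y|M. ?f r y) \<le> 4 * g / s * (1 / 2 ^ n - 1 / 2 ^ Suc n) + (LINT y|M. ?f (2 * r) y)" by simp
    have "(LINT y|M. ?f s y) \<le> 4 * g / s * (1 - 1 / 2 ^ n) + (LINT y|M. ?f r y)"
      unfolding r_def by (rule Suc.IH) (use Suc.prems in auto)
    also note step
    finally show ?case unfolding r2 by (simp add: algebra_simps)
  qed simp
  then show ?thesis using tail[of "2 ^ n * s"] s by simp
qed


section \<open>First order expansion of potentials\<close>

definition positive_potential :: "complex measure \<Rightarrow> complex \<Rightarrow> real" where
  "positive_potential M x = (LINT w|M. ln (1 / cmod (x - w)))"

text \<open>
  Extended-real valued, so that points of divergence keep the value \<open>\<infinity>\<close>.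
\<close>

definition local_potential :: "complex measure \<Rightarrow> real \<Rightarrow> complex \<Rightarrow> ennreal" where
  "local_potential \<tau> \<rho> x = (\<integral>\<^sup>+ w. log_kernel \<rho> (cmod (x - w)) \<partial>\<tau>)"

text \<open>
  The error of the first order expansion in \<open>ball a r\<close> is at most \<open>e * r\<close> up to the potential of an exceptional
  measure \<open>\<tau>\<close>, whose mass is small compared with \<open>phi r\<close>. The measure \<open>\<tau>\<close> also accounts for the points where the
  potential of \<open>M\<close> diverges.
\<close>

definition log_approximation :: "complex measure \<Rightarrow> complex \<Rightarrow> complex \<Rightarrow> real \<Rightarrow> real \<Rightarrow> bool" where
  "log_approximation M a c e r \<longleftrightarrow>
     (\<exists>\<tau>. sets \<tau> = sets borel \<and> finite_measure \<tau> \<and> emeasure \<tau> (- ball a (2 * r)) = 0 \<and>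
        measure \<tau> UNIV \<le> e * phi r \<and>
        (\<forall>x\<in>ball a r. (log_integrable M x \<or> local_potential \<tau> (4 * r) x = \<infinity>) \<and>
           ennreal \<bar>positive_potential M x - positive_potential M a + Re (c * (x - a))\<bar>
             \<le> ennreal (e * r) + local_potential \<tau> (4 * r) x))"

definition log_expansion :: "complex measure \<Rightarrow> complex \<Rightarrow> complex \<Rightarrow> bool" where
  "log_expansion M a c \<longleftrightarrow> log_integrable M a \<and>
     (\<forall>e>0. \<exists>r0>0. \<forall>r. 0 < r \<and> r < r0 \<longrightarrow> log_approximation M a c e r)"

text \<open>
  The points \<open>w\<close> outside \<open>ball a (2 * r)\<close> contribute the second order Taylor remainder of the
  logarithm, those inside the two logarithmic kernels themselves. Since \<open>x\<close> and \<open>a\<close> both lie in the ball, passing from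
  \<open>1\<close> to \<open>4 * r\<close> in the numerators cancels in the difference and makes both kernels nonnegative.
\<close>

lemma potential_difference_le:
  assumes M: "sets M = sets borel" "finite_measure M"
    and la: "log_integrable M a" and lx: "log_integrable M x" and r: "0 < r" and x: "dist a x < r"
  shows "ennreal \<bar>positive_potential M x - positive_potential M a + Re (cauchy_tail M a (2 * r) * (x - a))\<bar>
    \<le> (\<integral>\<^sup>+ w. log_kernel (4 * r) (cmod (x - w)) * indicator (ball a (2 * r)) w \<partial>M)
     + (\<integral>\<^sup>+ w. log_kernel (4 * r) (cmod (a - w)) * indicator (ball a (2 * r)) w \<partial>M)
     + ennreal (2 * r\<^sup>2 * (LINT w|M. (if 2 * r \<le> cmod (a - w) then 1 / (cmod (a - w))\<^sup>2 else 0)))"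
proof -
  interpret finite_measure M by fact
  note M(1)[measurable_cong]
  have [measurable]: "ball a R \<in> sets borel" for R by simp
  define k where "k w = (if 2 * r \<le> cmod (a - w) then 1 / (a - w) else 0)" for w
  define q where "q w = (if 2 * r \<le> cmod (a - w) then 1 / (cmod (a - w))\<^sup>2 else 0)" for w
  have [measurable]: "k \<in> borel_measurable M" "q \<in> borel_measurable M"
    unfolding k_def[abs_def] q_def[abs_def] by measurable
  have k_int: "integrable M k"
    unfolding k_def[abs_def] using integrable_cauchy_tail[OF M, of "2 * r" a] r by simp
  have q_int: "integrable M q"
  proof (rule integrable_const_bound[of _ "1 / (2 * r)\<^sup>2"], rule AE_I2)
    fix w
    have "1 / (cmod (a - w))\<^sup>2 \<le> 1 / (2 * r)\<^sup>2" if "2 * r \<le> cmod (a - w)"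
      using that r by (intro divide_left_mono power_mono mult_pos_pos zero_less_power) auto
    then show "norm (q w) \<le> 1 / (2 * r)\<^sup>2" by (simp add: q_def)
  qed measurable
  define f where "f w = ln (1 / cmod (x - w)) - ln (1 / cmod (a - w)) + Re (k w * (x - a))" for w
  have int: "integrable M (\<lambda>w. ln (1 / cmod (x - w)))" "integrable M (\<lambda>w. ln (1 / cmod (a - w)))"
    using la lx by (simp_all add: log_integrable_def)
  have kx_int: "integrable M (\<lambda>w. k w * (x - a))" by (rule integrable_mult_left[OF k_int])
  have "(LINT w|M. Re (k w * (x - a))) = Re (LINT w|M. k w * (x - a))"
    by (rule integral_Re[OF kx_int])
  also have "\<dots> = Re (cauchy_tail M a (2 * r) * (x - a))"
    unfolding cauchy_tail_def k_def[abs_def, symmetric] by simp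
  finally have "positive_potential M x - positive_potential M a + Re (cauchy_tail M a (2 * r) * (x - a)) = (LINT w|M. f w)"
    unfolding f_def positive_potential_def using int integrable_Re[OF kx_int]
    by (simp add: Bochner_Integration.integral_add Bochner_Integration.integral_diff)
  then have "ennreal \<bar>positive_potential M x - positive_potential M a + Re (cauchy_tail M a (2 * r) * (x - a))\<bar>
      = ennreal (norm (LINT w|M. f w))" by simp
  also have "\<dots> \<le> (\<integral>\<^sup>+ w. norm (f w) \<partial>M)"
    unfolding f_def using int integrable_Re[OF kx_int]
    by (intro integral_norm_bound_ennreal Bochner_Integration.integrable_add Bochner_Integration.integrable_diff)
  also have "\<dots> \<le> (\<integral>\<^sup>+ w. log_kernel (4 * r) (cmod (x - w)) * indicator (ball a (2 * r)) w
       + log_kernel (4 * r) (cmod (a - w)) * indicator (ball a (2 * r)) w + ennreal (2 * r\<^sup>2 * q w) \<partial>M)"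
  proof (rule nn_integral_mono)
    fix w
    define d where "d = cmod (a - w)"
    define d' where "d' = cmod (x - w)"
    have xa: "cmod (x - a) < r" using x by (simp add: dist_norm norm_minus_commute)
    show "ennreal (norm (f w)) \<le> log_kernel (4 * r) (cmod (x - w)) * indicator (ball a (2 * r)) w
       + log_kernel (4 * r) (cmod (a - w)) * indicator (ball a (2 * r)) w + ennreal (2 * r\<^sup>2 * q w)"
    proof (cases "d < 2 * r")
      case True
      then have k0: "k w = 0" by (simp add: k_def d_def)
      have ind: "indicator (ball a (2 * r)) w = (1::ennreal)" using True by (simp add: d_def dist_norm)
      show ?thesis
      proof (cases "d = 0 \<or> d' = 0")
        case True
        then show ?thesis unfolding ind d_def[symmetric] d'_def[symmetric] by (auto simp: log_kernel_def)
      next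
        case False
        then have d: "0 < d" "0 < d'" by (simp_all add: d_def d'_def)
        have "d' \<le> cmod (x - a) + d" unfolding d'_def d_def using norm_triangle_ineq[of "x - a" "a - w"] by simp
        then have d4: "d' \<le> 4 * r" using xa True r by linarith
        have "0 \<le> ln (4 * r / d)" "0 \<le> ln (4 * r / d')" using d d4 True r by simp_all
        moreover have "ln (4 * r / d) = ln (4 * r) - ln d" "ln (4 * r / d') = ln (4 * r) - ln d'"
          using d r by (simp_all add: ln_div)
        moreover have "f w = - ln d' + ln d"
          using d unfolding f_def k0 d_def[symmetric] d'_def[symmetric] by (simp add: ln_div)
        ultimately have "norm (f w) \<le> ln (4 * r / d') + ln (4 * r / d)" unfolding real_norm_def by linarith
        then have "ennreal (norm (f w)) \<le> ennreal (ln (4 * r / d') + ln (4 * r / d))" by (rule ennreal_leI)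
        also have "\<dots> = log_kernel (4 * r) d' + log_kernel (4 * r) d"
          using d \<open>0 \<le> ln (4 * r / d)\<close> \<open>0 \<le> ln (4 * r / d')\<close> by (simp add: log_kernel_def ennreal_plus)
        finally show ?thesis unfolding ind d_def[symmetric] d'_def[symmetric] by (simp add: add_increasing2)
      qed
    next
      case False
      then have d: "2 * r \<le> d" "0 < d" using r by auto
      have aw: "a - w \<noteq> 0" using d(2) by (auto simp: d_def)
      define z where "z = (x - a) / (a - w)"
      have z_le: "cmod z \<le> r / d" unfolding z_def d_def norm_divide using xa by (intro divide_right_mono) auto
      also have "r / d \<le> 1 / 2" using d by (simp add: field_simps)
      finally have z_half: "cmod z \<le> 1 / 2" .
      have "x - w = (a - w) * (1 + z)" using aw by (simp add: z_def field_simps)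
      then have d'_eq: "d' = d * cmod (1 + z)" unfolding d'_def d_def by (simp add: norm_mult)
      have "1 - cmod z \<le> cmod (1 + z)" using norm_triangle_ineq2[of 1 "- z"] by simp
      then have pos: "0 < cmod (1 + z)" using z_half by linarith
      have "k w * (x - a) = z" using d(1) unfolding k_def z_def d_def by simp
      then have "f w = - (ln (cmod (1 + z)) - Re z)"
        using d pos unfolding f_def d_def[symmetric] d'_def[symmetric] d'_eq by (simp add: ln_div ln_mult)
      then have "norm (f w) \<le> 2 * (cmod z)\<^sup>2" using ln_norm_one_plus[OF z_half] by simp
      also have "\<dots> \<le> 2 * (r / d)\<^sup>2" using z_le by (intro mult_left_mono power_mono) auto
      also have "\<dots> = 2 * r\<^sup>2 * q w" using d(1) by (simp add: q_def d_def power_divide)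
      finally have "ennreal (norm (f w)) \<le> ennreal (2 * r\<^sup>2 * q w)" by (rule ennreal_leI)
      then show ?thesis by (rule order_trans) (simp add: add_increasing)
    qed
  qed
  also have "\<dots> = (\<integral>\<^sup>+ w. log_kernel (4 * r) (cmod (x - w)) * indicator (ball a (2 * r)) w
       + log_kernel (4 * r) (cmod (a - w)) * indicator (ball a (2 * r)) w \<partial>M) + (\<integral>\<^sup>+ w. ennreal (2 * r\<^sup>2 * q w) \<partial>M)"
    by (rule nn_integral_add) measurable
  also have "(\<integral>\<^sup>+ w. log_kernel (4 * r) (cmod (x - w)) * indicator (ball a (2 * r)) w
       + log_kernel (4 * r) (cmod (a - w)) * indicator (ball a (2 * r)) w \<partial>M)
     = (\<integral>\<^sup>+ w. log_kernel (4 * r) (cmod (x - w)) * indicator (ball a (2 * r)) w \<partial>M)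
       + (\<integral>\<^sup>+ w. log_kernel (4 * r) (cmod (a - w)) * indicator (ball a (2 * r)) w \<partial>M)"
    by (rule nn_integral_add) measurable
  also have "(\<integral>\<^sup>+ w. ennreal (2 * r\<^sup>2 * q w) \<partial>M) = ennreal (LINT w|M. 2 * r\<^sup>2 * q w)"
    by (rule nn_integral_eq_integral[OF integrable_mult_right[OF q_int]]) (auto simp: q_def)
  also have "(LINT w|M. 2 * r\<^sup>2 * q w) = 2 * r\<^sup>2 * (LINT w|M. q w)" by simp
  finally show ?thesis unfolding q_def[abs_def] .
qed

lemma local_potential_restrict:
  assumes M: "sets M = sets borel" and S: "S \<in> sets borel"
  shows "local_potential (density M (indicator S)) \<rho> x = (\<integral>\<^sup>+ w. log_kernel \<rho> (cmod (x - w)) * indicator S w \<partial>M)"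
proof -
  note M[measurable_cong] S[measurable]
  show ?thesis unfolding local_potential_def
    by (subst nn_integral_density) (auto simp: mult.commute)
qed

lemma log_kernel_integral_at_growth_point:
  assumes M: "sets M = sets borel" "finite_measure M" and N: "0 \<le> N"
    and growth: "\<And>R. 0 < R \<Longrightarrow> measure M (ball a R) \<le> N * phi R" and r: "0 < r" and S: "S \<in> sets borel"
  shows "(\<integral>\<^sup>+ w. log_kernel (4 * r) (cmod (a - w)) * indicator S w \<partial>M) \<le> ennreal (8 * N * gauge_ratio (4 * r) * r)"
proof -
  interpret finite_measure M by fact
  have "(\<integral>\<^sup>+ w. log_kernel (4 * r) (cmod (a - w)) * indicator S w \<partial>M) \<le> ennreal (2 * (N * gauge_ratio (4 * r)) * (4 * r))"
  proof (rule nn_integral_log_kernel_le[OF M S])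
    show "0 \<le> N * gauge_ratio (4 * r)" using N r gauge_ratio_pos[of "4 * r"] by simp
    fix j :: nat
    define R where "R = 4 * r / 2 ^ j"
    have R: "0 < R" using r by (simp add: R_def)
    have Rr: "R \<le> 4 * r / 1" unfolding R_def using r by (intro divide_left_mono) auto
    have "measure M (S \<inter> ball a R) \<le> measure M (ball a R)"
      by (rule finite_measure_mono[OF Int_lower2 ball_in_sets[OF M(1)]])
    also have "\<dots> \<le> N * gauge_ratio (4 * r) * R"
      using R Rr by (intro le_gauge_ratio_mult growth N) auto
    finally show "measure M (S \<inter> ball a (4 * r / 2 ^ j)) \<le> N * gauge_ratio (4 * r) * (4 * r / 2 ^ j)"
      unfolding R_def .
  qed (use r in auto)
  then show ?thesis by (simp add: mult_ac)
qed

text \<open>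
  Here \<open>x\<close> is arbitrary: growth at the points of \<open>E\<close> bounds the potential of the part of \<open>M\<close> on \<open>E\<close> everywhere.
\<close>

lemma log_kernel_integral_over_growth_set:
  assumes M: "sets M = sets borel" "finite_measure M" and N: "0 \<le> N" and E: "closed E"
    and growth: "\<And>b R. b \<in> E \<Longrightarrow> 0 < R \<Longrightarrow> measure M (ball b R) \<le> N * phi R" and r: "0 < r"
  shows "(\<integral>\<^sup>+ w. log_kernel (4 * r) (cmod (x - w)) * indicator E w \<partial>M) \<le> ennreal (32 * N * gauge_ratio (4 * r) * r)"
proof -
  interpret finite_measure M by fact
  have "(\<integral>\<^sup>+ w. log_kernel (4 * r) (cmod (x - w)) * indicator E w \<partial>M) \<le> ennreal (2 * (4 * N * gauge_ratio (4 * r)) * (4 * r))"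
  proof (rule nn_integral_log_kernel_le[OF M])
    show "E \<in> sets borel" using E by simp
    show nn: "0 \<le> 4 * N * gauge_ratio (4 * r)" using N r gauge_ratio_pos[of "4 * r"] by simp
    fix j :: nat
    define R where "R = 4 * r / 2 ^ j"
    have R: "0 < R" using r by (simp add: R_def)
    have Rr: "R \<le> 4 * r / 1" unfolding R_def using r by (intro divide_left_mono) auto
    have "measure M (E \<inter> ball x R) \<le> 4 * N * gauge_ratio (4 * r) * R"
    proof (cases "E \<inter> ball x R = {}")
      case True
      then show ?thesis using nn R by simp
    next
      case False
      then obtain b where b: "b \<in> E" "dist x b < R" by auto
      have "E \<inter> ball x R \<subseteq> ball b (2 * R)"
      proof
        fix y assume "y \<in> E \<inter> ball x R"
        then have "dist x y < R" by simp
        then have "dist b y < 2 * R" using b(2) dist_triangle3[of b y x] by linarith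
        then show "y \<in> ball b (2 * R)" by simp
      qed
      then have "measure M (E \<inter> ball x R) \<le> measure M (ball b (2 * R))"
        by (rule finite_measure_mono[OF _ ball_in_sets[OF M(1)]])
      also have "\<dots> \<le> N * phi (2 * R)" using growth[OF b(1)] R by simp
      also have "\<dots> \<le> 4 * N * phi R"
        using mult_left_mono[OF phi_double[of R] N] by (simp add: mult_ac)
      finally show ?thesis using N R Rr by (intro le_gauge_ratio_mult) auto
    qed
    then show "measure M (E \<inter> ball x (4 * r / 2 ^ j)) \<le> 4 * N * gauge_ratio (4 * r) * (4 * r / 2 ^ j)"
      unfolding R_def .
  qed (use r in auto)
  then show ?thesis by (simp add: mult_ac)
qed

lemma inverse_square_tail_le:
  assumes M: "sets M = sets borel" "finite_measure M" and N: "0 \<le> N"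
    and growth: "\<And>R. 0 < R \<Longrightarrow> measure M (ball a R) \<le> N * phi R" and \<rho>: "0 < \<rho>" "\<rho> \<le> \<delta>"
  shows "(LINT w|M. (if \<rho> \<le> cmod (a - w) then 1 / (cmod (a - w))\<^sup>2 else 0))
    \<le> 4 * (N * gauge_ratio \<delta>) / \<rho> + 4 * measure M UNIV / \<delta>\<^sup>2"
proof -
  have \<delta>: "0 < \<delta>" using \<rho> by linarith
  obtain n where n: "\<delta> / 2 \<le> 2 ^ n * \<rho>" "2 ^ n * \<rho> \<le> \<delta>"
    using dyadic_multiple_between[of \<rho> "\<delta> / 2"] \<rho> by auto
  have "(LINT w|M. (if \<rho> \<le> cmod (a - w) then 1 / (cmod (a - w))\<^sup>2 else 0))
      \<le> 4 * (N * gauge_ratio \<delta>) / \<rho> * (1 - 1 / 2 ^ n) + measure M UNIV / (2 ^ n * \<rho>)\<^sup>2"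
  proof (rule integral_inverse_square_annulus_le[OF M \<rho>(1)])
    show "0 \<le> N * gauge_ratio \<delta>" using N gauge_ratio_pos[OF \<delta>] by simp
    fix i assume i: "i < n"
    define R where "R = 2 ^ Suc i * \<rho>"
    have R: "0 < R" using \<rho> by (simp add: R_def)
    have "(2::real) ^ Suc i \<le> 2 ^ n" using i by (intro power_increasing) auto
    then have "R \<le> 2 ^ n * \<rho>" unfolding R_def by (rule mult_right_mono) (use \<rho> in simp)
    then have "R \<le> \<delta>" using n(2) by linarith
    then show "measure M (ball a (2 ^ Suc i * \<rho>)) \<le> N * gauge_ratio \<delta> * (2 ^ Suc i * \<rho>)"
      using le_gauge_ratio_mult[OF N R _ growth[OF R]] unfolding R_def by blast
  qed
  also have "\<dots> \<le> 4 * (N * gauge_ratio \<delta>) / \<rho> * 1 + measure M UNIV / (\<delta> / 2)\<^sup>2"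
  proof (rule add_mono)
    show "4 * (N * gauge_ratio \<delta>) / \<rho> * (1 - 1 / 2 ^ n) \<le> 4 * (N * gauge_ratio \<delta>) / \<rho> * 1"
      using N gauge_ratio_pos[OF \<delta>] \<rho>(1) by (intro mult_left_mono) auto
    show "measure M UNIV / (2 ^ n * \<rho>)\<^sup>2 \<le> measure M UNIV / (\<delta> / 2)\<^sup>2"
      using n \<delta> \<rho>(1) by (intro divide_left_mono power_mono mult_pos_pos zero_less_power) auto
  qed
  finally show ?thesis by (simp add: power_divide mult.commute)
qed

text \<open>
  The exceptional measure is the part of \<open>M\<close> in \<open>ball a (2 * r)\<close> off \<open>E\<close>. All other errors are
  \<open>o(r)\<close>: the potential of the part on \<open>E\<close> and the Taylor remainder by growth, the linear
  term by convergence of the principal value.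
\<close>

lemma log_expansion_at_good_point:
  assumes M: "sets M = sets borel" "finite_measure M" and far: "integrable M (\<lambda>w. ln (1 + cmod w))" and N: "0 \<le> N"
    and E: "closed E" and a: "a \<in> E"
    and growth: "\<And>b r. b \<in> E \<Longrightarrow> 0 < r \<Longrightarrow> measure M (ball b r) \<le> N * phi r"
    and pv: "(cauchy_tail M a \<longlongrightarrow> c) (at_right 0)"
    and dens: "\<forall>e>0. \<exists>d>0. \<forall>r. 0 < r \<and> r \<le> d \<longrightarrow> measure M (ball a r - E) \<le> e * phi r"
  shows "log_expansion M a c"
proof -
  interpret finite_measure M by fact
  note M(1)[measurable_cong]
  have Eb [measurable]: "E \<in> sets borel" using E by simp
  have [measurable]: "ball x R \<in> sets borel" for x :: complex and R by simp
  have la: "log_integrable M a"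
  proof (rule log_integrableI[OF M far, of 4 1])
    have "(\<integral>\<^sup>+ w. log_kernel 4 (cmod (a - w)) * indicator (ball a 1) w \<partial>M)
        \<le> ennreal (8 * N * gauge_ratio (4 * 1) * 1)"
      using log_kernel_integral_at_growth_point[OF M N growth[OF a], of 1 "ball a 1"] by simp
    also have "\<dots> < \<infinity>" by simp
    finally show "(\<integral>\<^sup>+ w. log_kernel 4 (cmod (a - w)) * indicator (ball a 1) w \<partial>M) < \<infinity>" .
  qed auto
  show ?thesis
    unfolding log_expansion_def
  proof (intro conjI la allI impI)
    fix e :: real assume e: "0 < e"
    define m where "m = measure M UNIV"
    have m: "0 \<le> m" by (simp add: m_def)
    \<comment> \<open>the errors controlled by growth add up to \<open>32 + 8 + 4 = 44\<close> times \<open>N * gauge_ratio \<delta> * r\<close>\<close>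
    obtain \<delta> where \<delta>: "0 < \<delta>" "gauge_ratio \<delta> < e / (3 * (44 * N + 1))"
      using gauge_ratio_small[of "e / (3 * (44 * N + 1))"] e N by auto
    have \<delta>': "44 * N * gauge_ratio \<delta> \<le> e / 3"
    proof -
      have "44 * N * gauge_ratio \<delta> \<le> (44 * N + 1) * gauge_ratio \<delta>"
        using gauge_ratio_pos[OF \<delta>(1)] by (intro mult_right_mono) auto
      also have "\<dots> \<le> (44 * N + 1) * (e / (3 * (44 * N + 1)))" using \<delta>(2) N by (intro mult_left_mono) auto
      also have "\<dots> = e / 3" using N by (simp add: field_simps)
      finally show ?thesis .
    qed
    obtain d1 where d1: "0 < d1" "\<And>r. 0 < r \<Longrightarrow> r \<le> d1 \<Longrightarrow> measure M (ball a r - E) \<le> e / 4 * phi r"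
      using dens e by (metis divide_pos_pos zero_less_numeral)
    have "\<forall>\<^sub>F r in at_right 0. dist (cauchy_tail M a r) c < e / 3"
      using pv e by (intro tendstoD) auto
    then obtain d2 where d2: "0 < d2" "\<And>r. 0 < r \<Longrightarrow> r < d2 \<Longrightarrow> dist (cauchy_tail M a r) c < e / 3"
      unfolding eventually_at_right_field by blast
    \<comment> \<open>\<open>d3\<close> makes the Taylor remainder from the mass at distance at least \<open>\<delta>\<close> small\<close>
    define d3 where "d3 = e * \<delta>\<^sup>2 / (24 * (m + 1))"
    have d3: "0 < d3" using e \<delta> m by (simp add: d3_def)
    define r0 where "r0 = min (min (\<delta> / 4) (d1 / 2)) (min (d2 / 2) d3)"
    have r0: "0 < r0" using \<delta> d1 d2 d3 by (simp add: r0_def)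
    show "\<exists>r0>0. \<forall>r. 0 < r \<and> r < r0 \<longrightarrow> log_approximation M a c e r"
    proof (rule exI[of _ r0], intro conjI r0 allI impI)
      fix r assume r: "0 < r \<and> r < r0"
      then have r': "0 < r" "4 * r < \<delta>" "2 * r \<le> d1" "2 * r < d2" "r < d3" by (auto simp: r0_def)
      define S where "S = ball a (2 * r) - E"
      have S [measurable]: "S \<in> sets borel" unfolding S_def by measurable
      define \<tau> where "\<tau> = density M (indicator S)"
      have \<tau>_em: "emeasure \<tau> A = emeasure M (S \<inter> A)" if "A \<in> sets borel" for A
        unfolding \<tau>_def using that S M(1) by (intro emeasure_restricted) auto
      have g4: "gauge_ratio (4 * r) \<le> gauge_ratio \<delta>" using r' by (intro gauge_ratio_mono) auto
      define P where "P x = local_potential \<tau> (4 * r) x" for x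
      have P_eq: "P x = (\<integral>\<^sup>+ w. log_kernel (4 * r) (cmod (x - w)) * indicator S w \<partial>M)" for x
        unfolding P_def \<tau>_def by (rule local_potential_restrict[OF M(1) S])
      have near: "(\<integral>\<^sup>+ w. log_kernel (4 * r) (cmod (x - w)) * indicator (ball a (2 * r)) w \<partial>M)
          \<le> ennreal (32 * N * gauge_ratio (4 * r) * r) + P x" for x
      proof -
        have "(\<integral>\<^sup>+ w. log_kernel (4 * r) (cmod (x - w)) * indicator (ball a (2 * r)) w \<partial>M)
          \<le> (\<integral>\<^sup>+ w. log_kernel (4 * r) (cmod (x - w)) * indicator E w + log_kernel (4 * r) (cmod (x - w)) * indicator S w \<partial>M)"
          by (intro nn_integral_mono) (auto simp: indicator_def S_def)
        also have "\<dots> = (\<integral>\<^sup>+ w. log_kernel (4 * r) (cmod (x - w)) * indicator E w \<partial>M) + P x"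
          unfolding P_eq by (rule nn_integral_add) measurable
        also have "\<dots> \<le> ennreal (32 * N * gauge_ratio (4 * r) * r) + P x"
          by (intro add_right_mono log_kernel_integral_over_growth_set[OF M N E growth] r')
        finally show ?thesis .
      qed
      have sq: "2 * r\<^sup>2 * (LINT w|M. (if 2 * r \<le> cmod (a - w) then 1 / (cmod (a - w))\<^sup>2 else 0)) \<le> r * (4 * N * gauge_ratio \<delta> + e / 3)"
      proof -
        define \<rho> where "\<rho> = 2 * r"
        have "(LINT w|M. (if \<rho> \<le> cmod (a - w) then 1 / (cmod (a - w))\<^sup>2 else 0))
            \<le> 4 * (N * gauge_ratio \<delta>) / \<rho> + 4 * m / \<delta>\<^sup>2"
          unfolding m_def using r' by (intro inverse_square_tail_le[OF M N growth[OF a]]) (auto simp: \<rho>_def)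
        then have "2 * r\<^sup>2 * (LINT w|M. (if \<rho> \<le> cmod (a - w) then 1 / (cmod (a - w))\<^sup>2 else 0))
            \<le> 2 * r\<^sup>2 * (4 * (N * gauge_ratio \<delta>) / \<rho> + 4 * m / \<delta>\<^sup>2)" by (intro mult_left_mono) auto
        also have "\<dots> = r * (4 * N * gauge_ratio \<delta> + r * (8 * m / \<delta>\<^sup>2))"
          using r'(1) \<delta>(1) by (simp add: \<rho>_def field_simps power2_eq_square)
        also have "\<dots> \<le> r * (4 * N * gauge_ratio \<delta> + e / 3)"
        proof (intro mult_left_mono add_left_mono)
          have "r * (8 * m / \<delta>\<^sup>2) \<le> d3 * (8 * (m + 1) / \<delta>\<^sup>2)"
            using r' m \<delta> by (intro mult_mono divide_right_mono) auto
          also have "\<dots> = e / 3"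
          proof -
            define m1 where "m1 = m + 1"
            have "m1 \<noteq> 0" using m by (simp add: m1_def)
            then show ?thesis unfolding d3_def m1_def[symmetric] using \<delta>(1) by (simp add: field_simps)
          qed
          finally show "r * (8 * m / \<delta>\<^sup>2) \<le> e / 3" .
        qed (use r' in auto)
        finally show ?thesis unfolding \<rho>_def .
      qed
      have main: "(log_integrable M x \<or> P x = \<infinity>) \<and>
          ennreal \<bar>positive_potential M x - positive_potential M a + Re (c * (x - a))\<bar> \<le> ennreal (e * r) + P x"
        if x: "x \<in> ball a r" for x
      proof (cases "P x = \<infinity>")
        case False
        have xa: "dist a x < r" using x by simp
        have lx: "log_integrable M x"
        proof (rule log_integrableI[OF M far, of "4 * r" r])
          have "ball x r \<subseteq> ball a (2 * r)"
          proof
            fix y assume "y \<in> ball x r"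
            then have "dist x y < r" by simp
            then have "dist a y < 2 * r" using xa dist_triangle[of a y x] by linarith
            then show "y \<in> ball a (2 * r)" by simp
          qed
          then have "(\<integral>\<^sup>+ w. log_kernel (4 * r) (cmod (x - w)) * indicator (ball x r) w \<partial>M)
              \<le> (\<integral>\<^sup>+ w. log_kernel (4 * r) (cmod (x - w)) * indicator (ball a (2 * r)) w \<partial>M)"
            by (intro nn_integral_mono mult_left_mono) (simp_all add: indicator_def subset_eq)
          also have "\<dots> \<le> ennreal (32 * N * gauge_ratio (4 * r) * r) + P x" by (rule near)
          also have "\<dots> < \<infinity>" using False by (simp add: less_top[symmetric])
          finally show "(\<integral>\<^sup>+ w. log_kernel (4 * r) (cmod (x - w)) * indicator (ball x r) w \<partial>M) < \<infinity>" .
        qed (use r' in auto)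
        define D where "D = positive_potential M x - positive_potential M a + Re (cauchy_tail M a (2 * r) * (x - a))"
        have nearA: "(\<integral>\<^sup>+ w. log_kernel (4 * r) (cmod (a - w)) * indicator (ball a (2 * r)) w \<partial>M)
            \<le> ennreal (8 * N * gauge_ratio (4 * r) * r)"
          by (rule log_kernel_integral_at_growth_point[OF M N growth[OF a] r'(1)]) simp_all
        define G where "G = gauge_ratio \<delta>"
        have G: "0 \<le> G" unfolding G_def using gauge_ratio_pos[OF \<delta>(1)] by simp
        have nG: "N * gauge_ratio (4 * r) * r \<le> N * G * r"
          unfolding G_def using g4 N r' by (intro mult_right_mono mult_left_mono) auto
        have nn: "0 \<le> N * G * r" using N G r' by simp
        define X where "X = N * G * r"
        define Y where "Y = e / 3 * r"
        have XY: "0 \<le> X" "0 \<le> Y" using nn e r' by (simp_all add: X_def Y_def)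
        have "ennreal \<bar>D\<bar> \<le> (ennreal (32 * N * gauge_ratio (4 * r) * r) + P x) + ennreal (8 * N * gauge_ratio (4 * r) * r)
            + ennreal (r * (4 * N * gauge_ratio \<delta> + e / 3))"
          unfolding D_def
          by (rule order_trans[OF potential_difference_le[OF M la lx r'(1) xa]])
             (intro add_mono near nearA ennreal_leI sq)
        also have "\<dots> \<le> (ennreal (32 * X) + P x) + ennreal (8 * X) + ennreal (4 * X + Y)"
        proof (intro add_mono ennreal_leI order_refl)
          show "32 * N * gauge_ratio (4 * r) * r \<le> 32 * X" "8 * N * gauge_ratio (4 * r) * r \<le> 8 * X"
            using nG unfolding X_def by (simp_all only: mult.assoc)
          show "r * (4 * N * gauge_ratio \<delta> + e / 3) \<le> 4 * X + Y"
            unfolding X_def Y_def G_def by (simp add: algebra_simps)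
        qed
        also have "\<dots> = ennreal (44 * X + Y) + P x"
        proof -
          have "ennreal (44 * X + Y) = ennreal (32 * X) + (ennreal (8 * X) + ennreal (4 * X + Y))"
            using XY by (simp add: ennreal_plus[symmetric] del: ennreal_plus)
          then show ?thesis by (simp add: add_ac)
        qed
        finally have D: "ennreal \<bar>D\<bar> \<le> ennreal (44 * X + Y) + P x" .
        have tail: "\<bar>Re ((c - cauchy_tail M a (2 * r)) * (x - a))\<bar> \<le> e / 3 * r"
        proof -
          have "\<bar>Re ((c - cauchy_tail M a (2 * r)) * (x - a))\<bar> \<le> cmod (c - cauchy_tail M a (2 * r)) * cmod (x - a)"
            using abs_Re_le_cmod[of "(c - cauchy_tail M a (2 * r)) * (x - a)"] by (simp only: norm_mult)
          also have "\<dots> \<le> e / 3 * r"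
            using d2(2)[of "2 * r"] r' xa e by (intro mult_mono) (auto simp: dist_norm norm_minus_commute)
          finally show ?thesis .
        qed
        have eq: "positive_potential M x - positive_potential M a + Re (c * (x - a)) = D + Re ((c - cauchy_tail M a (2 * r)) * (x - a))"
          unfolding D_def by (simp add: algebra_simps)
        have "ennreal \<bar>D + Re ((c - cauchy_tail M a (2 * r)) * (x - a))\<bar> \<le> ennreal (\<bar>D\<bar> + Y)"
          using tail abs_triangle_ineq[of D "Re ((c - cauchy_tail M a (2 * r)) * (x - a))"]
          unfolding Y_def by (intro ennreal_leI) linarith
        also have "\<dots> = ennreal \<bar>D\<bar> + ennreal Y" using XY by (intro ennreal_plus) auto
        also have "\<dots> \<le> ennreal (44 * X + Y) + P x + ennreal Y"
          by (intro add_right_mono D)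
        also have "\<dots> = ennreal (44 * X + Y + Y) + P x"
        proof -
          have "ennreal (44 * X + Y + Y) = ennreal (44 * X + Y) + ennreal Y" using XY by (intro ennreal_plus) auto
          then show ?thesis by (simp only: add_ac)
        qed
        also have "\<dots> \<le> ennreal (e * r) + P x"
        proof (intro add_right_mono ennreal_leI)
          have "44 * X \<le> Y"
            using mult_right_mono[OF \<delta>', of r] r' unfolding G_def X_def Y_def by (simp add: mult_ac)
          moreover have "e * r = 3 * Y" by (simp add: Y_def)
          ultimately show "44 * X + Y + Y \<le> e * r" by linarith
        qed
        finally show ?thesis using lx unfolding eq by blast
      qed simp
      show "log_approximation M a c e r"
        unfolding log_approximation_def
      proof (intro exI[of _ \<tau>] conjI ballI)
        show \<tau>s: "sets \<tau> = sets borel" by (simp add: \<tau>_def M(1))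
        show "finite_measure \<tau>"
          using \<tau>_em[of UNIV] sets_eq_imp_space_eq[OF \<tau>s] by (intro finite_measureI) auto
        have "S \<inter> - ball a (2 * r) = {}" by (auto simp: S_def)
        then show "emeasure \<tau> (- ball a (2 * r)) = 0" using \<tau>_em[of "- ball a (2 * r)"] by simp
        have "measure \<tau> UNIV = measure M S" using \<tau>_em[of UNIV] by (simp add: measure_def)
        also have "\<dots> \<le> e / 4 * phi (2 * r)" unfolding S_def using r' by (intro d1) auto
        also have "\<dots> \<le> e / 4 * (4 * phi r)" using e phi_double[of r] by (intro mult_left_mono) auto
        finally show "measure \<tau> UNIV \<le> e * phi r" by simp
      qed (use main in \<open>auto simp: P_def\<close>)
    qed
  qed
qed


section \<open>Wiener capacity\<close>

text \<open>
  Duality: exchanging the order of integration turns the potential of \<open>\<tau>\<close> into that of \<open>\<nu>\<close>, which is at most \<open>1\<close>. The condition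
  \<open>4 * r \<le> 1\<close> makes replacing \<open>ln (4 * r / d)\<close> by \<open>ln (1 / d)\<close> an increase.
\<close>

lemma cap_admissible_local_potential_le:
  assumes \<nu>: "cap_admissible K \<nu>" and K: "compact K" "K \<subseteq> ball a r" and r: "0 < r" "4 * r \<le> 1"
    and \<tau>: "sets \<tau> = sets borel" "finite_measure \<tau>" "emeasure \<tau> (- ball a (2 * r)) = 0"
  shows "(\<integral>\<^sup>+ x. local_potential \<tau> (4 * r) x \<partial>\<nu>) \<le> emeasure \<tau> UNIV"
proof -
  have \<nu>s: "sets \<nu> = sets borel" and \<nu>f: "finite_measure \<nu>" and \<nu>K: "emeasure \<nu> (- K) = 0"
    and \<nu>z: "\<And>z. log_integrable \<nu> z \<and> (LINT w|\<nu>. ln (1 / cmod (z - w))) \<le> 1"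
    using \<nu> by (auto simp: cap_admissible_def)
  note \<nu>s[measurable_cong] \<tau>(1)[measurable_cong]
  interpret N: finite_measure \<nu> by (rule \<nu>f)
  interpret T: finite_measure \<tau> by fact
  interpret P: pair_sigma_finite \<nu> \<tau> ..
  have sp: "space \<tau> = UNIV" "space \<nu> = UNIV"
    using sets_eq_imp_space_eq[OF \<tau>(1)] sets_eq_imp_space_eq[OF \<nu>s] by simp_all
  have AE_K: "AE x in \<nu>. x \<in> K"
  proof -
    have "- K \<in> null_sets \<nu>" using \<nu>K K(1) \<nu>s by (intro null_setsI) (auto simp: compact_imp_closed borel_open)
    from AE_not_in[OF this] show ?thesis by simp
  qed
  have AE_ball: "AE w in \<tau>. w \<in> ball a (2 * r)"
  proof -
    have "- ball a (2 * r) \<in> null_sets \<tau>" using \<tau> by (intro null_setsI) auto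
    from AE_not_in[OF this] show ?thesis by simp
  qed
  have inner: "(\<integral>\<^sup>+ x. log_kernel (4 * r) (cmod (x - w)) \<partial>\<nu>) \<le> 1" if w: "w \<in> ball a (2 * r)" for w
  proof -
    have li: "log_integrable \<nu> w" "(LINT x|\<nu>. ln (1 / cmod (w - x))) \<le> 1" using \<nu>z by blast+
    have int: "integrable \<nu> (\<lambda>x. ln (1 / cmod (w - x)))" using li(1) by (simp add: log_integrable_def)
    have "emeasure \<nu> {w} = 0" using li(1) unfolding log_integrable_def by (rule conjunct1)
    moreover have "{w} \<in> sets \<nu>" unfolding \<nu>s by simp
    ultimately have "{w} \<in> null_sets \<nu>" by (rule null_setsI)
    from AE_not_in[OF this] have AE_w: "AE x in \<nu>. x \<noteq> w" by simp
    define f where "f x = ln (4 * r) + ln (1 / cmod (w - x))" for x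
    have f_int: "integrable \<nu> f" unfolding f_def by (intro Bochner_Integration.integrable_add int) simp
    have AE_f: "AE x in \<nu>. log_kernel (4 * r) (cmod (x - w)) = ennreal (f x) \<and> 0 \<le> f x"
      using AE_K AE_w
    proof eventually_elim
      case (elim x)
      define d where "d = cmod (x - w)"
      have d: "0 < d" using elim by (simp add: d_def)
      have "dist a x < r" using elim K(2) by auto
      then have "d < 4 * r" using w dist_triangle3[of x w a] r by (simp add: d_def dist_norm[symmetric])
      then have "0 \<le> ln (4 * r / d)" using d by simp
      moreover have "f x = ln (4 * r / d)" using d r unfolding f_def d_def by (simp add: ln_div norm_minus_commute)
      ultimately show ?case using d unfolding log_kernel_def d_def[symmetric] by simp
    qed
    have "(\<integral>\<^sup>+ x. log_kernel (4 * r) (cmod (x - w)) \<partial>\<nu>) = (\<integral>\<^sup>+ x. ennreal (f x) \<partial>\<nu>)"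
      by (rule nn_integral_cong_AE) (use AE_f in auto)
    also have "\<dots> = ennreal (LINT x|\<nu>. f x)"
      by (rule nn_integral_eq_integral[OF f_int]) (use AE_f in auto)
    also have "(LINT x|\<nu>. f x) \<le> (LINT x|\<nu>. ln (1 / cmod (w - x)))"
    proof (rule integral_mono[OF f_int int])
      have "ln (4 * r) \<le> 0" using r by simp
      then show "f x \<le> ln (1 / cmod (w - x))" for x unfolding f_def by linarith
    qed
    also have "\<dots> \<le> 1" by (rule li(2))
    finally show ?thesis by (simp add: ennreal_leI)
  qed
  have "(\<integral>\<^sup>+ x. local_potential \<tau> (4 * r) x \<partial>\<nu>) = (\<integral>\<^sup>+ w. \<integral>\<^sup>+ x. log_kernel (4 * r) (cmod (x - w)) \<partial>\<nu> \<partial>\<tau>)"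
    unfolding local_potential_def by (rule P.Fubini'[symmetric]) measurable
  also have "\<dots> \<le> (\<integral>\<^sup>+ w. 1 \<partial>\<tau>)"
    by (rule nn_integral_mono_AE) (use AE_ball inner in auto)
  also have "\<dots> = emeasure \<tau> UNIV" by (simp add: sp)
  finally show ?thesis .
qed

lemma cap_admissible_mass_le:
  assumes "cap_admissible K \<nu>" "compact K" "K \<subseteq> A"
  shows "emeasure \<nu> UNIV \<le> wiener_cap A"
proof -
  have "emeasure \<nu> UNIV \<le> wiener_cap_compact K"
    unfolding wiener_cap_compact_def using assms by (intro SUP_upper) simp
  also have "\<dots> \<le> wiener_cap A"
    unfolding wiener_cap_def using assms by (intro SUP_upper) auto
  finally show ?thesis .
qed

text \<open>
  A multiple of a rotated square inside the ball is admissible: its density is bounded, hence its potential exceeds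
  \<open>ln (1 / r)\<close> only by a constant, which is at most \<open>128\<close> and is absorbed by the smallness of \<open>r\<close>.
\<close>

lemma wiener_cap_ball_ge:
  assumes r: "0 < r" "r < exp (- 128)"
  shows "ennreal (1 / (2 * ln (1 / r))) \<le> wiener_cap (ball a r)"
proof -
  define \<sigma> where "\<sigma> = distr spin_measure borel (\<lambda>v. a + of_real (r / 4) * v)"
  have meas: "(\<lambda>v. a + of_real (r / 4) * v) \<in> spin_measure \<rightarrow>\<^sub>M borel" by measurable
  have \<sigma>s [measurable_cong]: "sets \<sigma> = sets borel" and \<sigma>sp: "space \<sigma> = UNIV" by (simp_all add: \<sigma>_def)
  have \<sigma>1: "emeasure \<sigma> UNIV = 1"
    unfolding \<sigma>_def by (subst emeasure_distr[OF meas]) auto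
  have \<sigma>f: "finite_measure \<sigma>" using \<sigma>1 \<sigma>sp by (intro finite_measureI) simp
  interpret finite_measure \<sigma> by (rule \<sigma>f)
  have ln_r: "128 < ln (1 / r)"
  proof -
    have "ln r < ln (exp (- 128))" using r by (subst ln_less_cancel_iff) auto
    then show ?thesis using r(1) by (simp add: ln_div)
  qed
  have supp: "AE w in \<sigma>. w \<in> cball a (r / 2)"
  proof -
    have "AE v in spin_measure. a + of_real (r / 4) * v \<in> cball a (r / 2)"
      using AE_spin_measure
    proof eventually_elim
      case (elim v)
      have "r / 4 * cmod v \<le> r / 4 * 2" using elim r by (intro mult_left_mono) auto
      moreover have "cmod (of_real (r / 4) * v) = r / 4 * cmod v" using r by (simp add: norm_mult)
      ultimately have "cmod (of_real (r / 4) * v) \<le> r / 2" by linarith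
      then show ?case unfolding mem_cball dist_norm by simp
    qed
    then show ?thesis unfolding \<sigma>_def by (subst AE_distr_iff[OF meas]) auto
  qed
  have growth: "measure \<sigma> (ball z s) \<le> 64 * (s / r)\<^sup>2" if s: "0 \<le> s" for z s
  proof -
    have sub: "(\<lambda>v. a + of_real (r / 4) * v) -` ball z s \<inter> space spin_measure \<subseteq> ball ((z - a) / of_real (r / 4)) (4 * s / r)"
    proof
      fix v assume "v \<in> (\<lambda>v. a + of_real (r / 4) * v) -` ball z s \<inter> space spin_measure"
      then have "cmod (z - a - of_real (r / 4) * v) < s" by (simp add: dist_norm diff_diff_eq)
      moreover have "(z - a) / of_real (r / 4) - v = (z - a - of_real (r / 4) * v) / of_real (r / 4)"
        using r by (simp add: field_simps)
      then have "cmod ((z - a) / of_real (r / 4) - v) = cmod (z - a - of_real (r / 4) * v) / (r / 4)"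
        using r by (simp only: norm_divide norm_of_real)
      ultimately show "v \<in> ball ((z - a) / of_real (r / 4)) (4 * s / r)"
        using r by (simp add: dist_norm field_simps)
    qed
    have "emeasure \<sigma> (ball z s) = emeasure spin_measure ((\<lambda>v. a + of_real (r / 4) * v) -` ball z s \<inter> space spin_measure)"
      unfolding \<sigma>_def by (rule emeasure_distr[OF meas]) simp
    also have "\<dots> \<le> emeasure spin_measure (ball ((z - a) / of_real (r / 4)) (4 * s / r))"
      by (rule emeasure_mono[OF sub]) simp
    also have "\<dots> \<le> ennreal (4 * (4 * s / r)\<^sup>2)" by (rule emeasure_spin_measure_ball_le) (use s r in auto)
    also have "4 * (4 * s / r)\<^sup>2 = 64 * (s / r)\<^sup>2" by (simp add: power_divide power_mult_distrib)
    finally show ?thesis by (simp add: emeasure_eq_measure)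
  qed
  have pot: "(\<integral>\<^sup>+ w. log_kernel r (cmod (z - w)) * indicator UNIV w \<partial>\<sigma>) \<le> ennreal (2 * (64 / r) * r)" for z
  proof (rule nn_integral_log_kernel_le[OF \<sigma>s \<sigma>f])
    fix j :: nat
    define x where "x = (1::real) / 2 ^ j"
    have x: "0 \<le> x" "x \<le> 1" by (simp_all add: x_def)
    have "measure \<sigma> (ball z (r * x)) \<le> 64 * (r * x / r)\<^sup>2" using x r by (intro growth) auto
    also have "\<dots> = 64 * (x * x)" using r by (simp add: power2_eq_square)
    also have "\<dots> \<le> 64 * (x * 1)" using x by (intro mult_left_mono) auto
    also have "\<dots> = 64 / r * (r * x)" using r by simp
    finally show "measure \<sigma> (UNIV \<inter> ball z (r / 2 ^ j)) \<le> 64 / r * (r / 2 ^ j)" by (simp add: x_def)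
  qed (use r in auto)
  have pot128: "(\<integral>\<^sup>+ w. log_kernel r (cmod (z - w)) \<partial>\<sigma>) \<le> ennreal 128" for z
    using pot[of z] r by simp
  have far: "integrable \<sigma> (\<lambda>w. ln (1 + cmod w))"
  proof (rule integrable_const_bound[of _ "ln (1 + (cmod a + r))"])
    show "AE w in \<sigma>. norm (ln (1 + cmod w)) \<le> ln (1 + (cmod a + r))"
      using supp
    proof eventually_elim
      case (elim w)
      have "cmod w \<le> cmod a + cmod (w - a)" using norm_triangle_ineq[of a "w - a"] by simp
      then have "cmod w \<le> cmod a + r" using elim r by (simp add: dist_norm norm_minus_commute)
      then have "ln (1 + cmod w) \<le> ln (1 + (cmod a + r))"
        by (intro ln_mono) (auto intro: add_pos_nonneg)
      then show ?case by simp
    qed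
  qed measurable
  have li: "log_integrable \<sigma> z" for z
  proof (rule log_integrableI[OF \<sigma>s \<sigma>f far r(1), of 1])
    have "(\<integral>\<^sup>+ w. log_kernel r (cmod (z - w)) * indicator (ball z 1) w \<partial>\<sigma>) \<le> (\<integral>\<^sup>+ w. log_kernel r (cmod (z - w)) \<partial>\<sigma>)"
      by (intro nn_integral_mono) (auto simp: indicator_def)
    also have "\<dots> < \<infinity>" using pot128[of z] by (simp add: le_less_trans)
    finally show "(\<integral>\<^sup>+ w. log_kernel r (cmod (z - w)) * indicator (ball z 1) w \<partial>\<sigma>) < \<infinity>" .
  qed simp
  have int_le: "(LINT w|\<sigma>. ln (1 / cmod (z - w))) \<le> 2 * ln (1 / r)" for z
  proof -
    have "(\<integral>\<^sup>+ w. ennreal (ln (1 / cmod (z - w))) \<partial>\<sigma>) \<le> (\<integral>\<^sup>+ w. ennreal (ln (1 / r)) + log_kernel r (cmod (z - w)) \<partial>\<sigma>)"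
    proof (rule nn_integral_mono)
      fix w
      define d where "d = cmod (z - w)"
      show "ennreal (ln (1 / cmod (z - w))) \<le> ennreal (ln (1 / r)) + log_kernel r (cmod (z - w))"
      proof (cases "d = 0")
        case True then show ?thesis by (simp add: d_def log_kernel_def)
      next
        case False
        then have d: "0 < d" by (simp add: d_def)
        have "ln (1 / d) = ln (1 / r) + ln (r / d)" using d r by (simp add: ln_div)
        also have "\<dots> \<le> ln (1 / r) + max 0 (ln (r / d))" by simp
        finally have "ennreal (ln (1 / d)) \<le> ennreal (ln (1 / r) + max 0 (ln (r / d)))" by (rule ennreal_leI)
        also have "\<dots> = ennreal (ln (1 / r)) + ennreal (max 0 (ln (r / d)))" using ln_r by (intro ennreal_plus) linarith+
        also have "ennreal (max 0 (ln (r / d))) = log_kernel r d" using d by (auto simp: log_kernel_def max_def ennreal_neg)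
        finally show ?thesis unfolding d_def .
      qed
    qed
    also have "\<dots> = (\<integral>\<^sup>+ w. ennreal (ln (1 / r)) \<partial>\<sigma>) + (\<integral>\<^sup>+ w. log_kernel r (cmod (z - w)) \<partial>\<sigma>)"
      by (rule nn_integral_add) measurable
    also have "\<dots> \<le> ennreal (ln (1 / r)) + ennreal 128"
      using pot128[of z] by (intro add_mono) (simp_all add: \<sigma>sp \<sigma>1)
    also have "\<dots> = ennreal (ln (1 / r) + 128)" using ln_r by (intro ennreal_plus[symmetric]) linarith+
    also have "\<dots> \<le> ennreal (2 * ln (1 / r))" using ln_r by (intro ennreal_leI) linarith
    finally have "enn2real (\<integral>\<^sup>+ w. ennreal (ln (1 / cmod (z - w))) \<partial>\<sigma>) \<le> 2 * ln (1 / r)"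
      using ln_r by (intro enn2real_leI) linarith+
    moreover have "integrable \<sigma> (\<lambda>w. ln (1 / cmod (z - w)))" using li[of z] by (simp add: log_integrable_def)
    then have "(LINT w|\<sigma>. ln (1 / cmod (z - w))) = enn2real (\<integral>\<^sup>+ w. ennreal (ln (1 / cmod (z - w))) \<partial>\<sigma>)
        - enn2real (\<integral>\<^sup>+ w. ennreal (- ln (1 / cmod (z - w))) \<partial>\<sigma>)"
      by (rule real_lebesgue_integral_def)
    moreover have "0 \<le> enn2real (\<integral>\<^sup>+ w. ennreal (- ln (1 / cmod (z - w))) \<partial>\<sigma>)" by simp
    ultimately show ?thesis by linarith
  qed
  define m where "m = 1 / (2 * ln (1 / r))"
  have m: "0 < m" using ln_r by (simp add: m_def del: ln_div)
  define \<nu> where "\<nu> = density \<sigma> (\<lambda>_. ennreal m)"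
  have \<nu>s: "sets \<nu> = sets borel" by (simp add: \<nu>_def \<sigma>s)
  have \<nu>_em: "emeasure \<nu> A = ennreal m * emeasure \<sigma> A" if "A \<in> sets borel" for A
    unfolding \<nu>_def using that by (intro emeasure_density_const) (simp add: \<sigma>s)
  have "cap_admissible (cball a (r / 2)) \<nu>"
    unfolding cap_admissible_def
  proof (intro conjI allI \<nu>s)
    show "finite_measure \<nu>"
      using \<nu>_em[of UNIV] \<sigma>1 sets_eq_imp_space_eq[OF \<nu>s] by (intro finite_measureI) simp
    have "emeasure \<sigma> (- cball a (r / 2)) = 0"
      using supp by (subst (asm) AE_iff_measurable[of "- cball a (r / 2)"]) (auto simp: \<sigma>s \<sigma>sp borel_open)
    then show "emeasure \<nu> (- cball a (r / 2)) = 0"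
      using \<nu>_em[of "- cball a (r / 2)"] by (simp add: borel_open)
    fix z
    have int: "integrable \<sigma> (\<lambda>w. ln (1 / cmod (z - w)))" and atom: "emeasure \<sigma> {z} = 0"
      using li[of z] by (simp_all add: log_integrable_def)
    have "integrable \<nu> (\<lambda>w. ln (1 / cmod (z - w)))"
      unfolding \<nu>_def using int m by (subst integrable_density) auto
    then show "log_integrable \<nu> z"
      using atom \<nu>_em[of "{z}"] by (simp add: log_integrable_def)
    have "(LINT w|\<nu>. ln (1 / cmod (z - w))) = (LINT w|\<sigma>. m * ln (1 / cmod (z - w)))"
      unfolding \<nu>_def using m by (subst integral_density) auto
    also have "\<dots> = m * (LINT w|\<sigma>. ln (1 / cmod (z - w)))" by simp
    also have "\<dots> \<le> m * (2 * ln (1 / r))" using m by (intro mult_left_mono int_le) auto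
    also have "\<dots> = 1"
    proof -
      define L where "L = ln (1 / r)"
      have "L \<noteq> 0" using ln_r unfolding L_def by linarith
      then show ?thesis unfolding m_def L_def[symmetric] by simp
    qed
    finally show "(LINT w|\<nu>. ln (1 / cmod (z - w))) \<le> 1" .
  qed
  then have "emeasure \<nu> UNIV \<le> wiener_cap (ball a r)"
  proof (rule cap_admissible_mass_le[OF _ compact_cball])
    show "cball a (r / 2) \<subseteq> ball a r"
    proof
      fix x assume "x \<in> cball a (r / 2)"
      then have "dist a x \<le> r / 2" by simp
      then have "dist a x < r" using r(1) by linarith
      then show "x \<in> ball a r" by simp
    qed
  qed
  moreover have "emeasure \<nu> UNIV = ennreal (1 / (2 * ln (1 / r)))"
    using \<nu>_em[of UNIV] \<sigma>1 unfolding m_def by simp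
  ultimately show ?thesis by simp
qed

lemma mult_wiener_cap_le:
  assumes "\<And>K \<nu>. compact K \<Longrightarrow> K \<subseteq> A \<Longrightarrow> cap_admissible K \<nu> \<Longrightarrow> ennreal t * emeasure \<nu> UNIV \<le> Z"
  shows "ennreal t * wiener_cap A \<le> Z"
  unfolding wiener_cap_def wiener_cap_compact_def SUP_mult_left_ennreal
  using assms by (intro SUP_least) auto

lemma weak_cap_differentiableI:
  assumes "\<And>e. 0 < e \<Longrightarrow> \<exists>r0>0. \<forall>r. 0 < r \<and> r < r0 \<longrightarrow>
      (\<forall>t>0. ennreal t * wiener_cap {x \<in> ball a r. \<bar>u x - u a - (A1 * (Re x - Re a) + A2 * (Im x - Im a))\<bar> > t}
         \<le> ennreal (e * r) * wiener_cap (ball a r))"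
  shows "weak_cap_differentiable u a"
  unfolding weak_cap_differentiable_def
proof (intro exI, rule order_tendstoI)
  let ?f = "\<lambda>r. (SUP t\<in>{0<..}. ennreal t *
                 wiener_cap {x \<in> ball a r. \<bar>u x - u a - (A1 * (Re x - Re a) + A2 * (Im x - Im a))\<bar> > t})
              / (ennreal r * wiener_cap (ball a r))"
  fix y :: ennreal assume "0 < y"
  then obtain e' :: real where e': "0 < e'" "ennreal e' < y"
  proof (cases y)
    case (real q)
    then have "0 < q" using \<open>0 < y\<close> by simp
    then show thesis using that[of "q / 2"] unfolding real(2) by (simp add: ennreal_lessI)
  next
    case top
    then show thesis using that[of 1] by simp
  qed
  obtain r0 where r0: "0 < r0" "\<And>r t. 0 < r \<Longrightarrow> r < r0 \<Longrightarrow> 0 < t \<Longrightarrow>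
      ennreal t * wiener_cap {x \<in> ball a r. \<bar>u x - u a - (A1 * (Re x - Re a) + A2 * (Im x - Im a))\<bar> > t}
         \<le> ennreal (e' * r) * wiener_cap (ball a r)"
    using assms[OF e'(1)] by blast
  have "?f r < y" if r: "0 < r" "r < r0" for r
  proof -
    let ?C = "wiener_cap (ball a r)"
    have "?f r \<le> (ennreal (e' * r) * ?C) / (ennreal r * ?C)"
      using r0(2)[OF r] by (intro divide_right_mono_ennreal SUP_least) auto
    also have "\<dots> = (ennreal e' * (ennreal r * ?C)) / (ennreal r * ?C)"
      using e' r by (simp add: ennreal_mult mult.assoc)
    also have "\<dots> \<le> ennreal e'"
    proof (cases "ennreal r * ?C = 0 \<or> ennreal r * ?C = \<infinity>")
      case True
      then show ?thesis by (auto simp: divide_ennreal_def)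
    next
      case False
      then show ?thesis by (simp add: ennreal_mult_divide_eq)
    qed
    finally show ?thesis using e'(2) by (rule le_less_trans)
  qed
  then show "\<forall>\<^sub>F r in at_right 0. ?f r < y"
    unfolding eventually_at_right_field using r0(1) by blast
qed simp


section \<open>Differentiability almost everywhere\<close>

text \<open>
  Small thresholds \<open>t\<close> of order \<open>r\<close> are harmless since capacity is monotone. Above them the exceptional measures must
  have potential at least \<open>t / 2\<close>, and by duality the admissible measures on such a set have mass at most a multiple of
  \<open>e * phi r / t\<close>; finally \<open>phi r\<close> is at most \<open>2 * r\<close> times the capacity of the ball.
\<close>

lemma weak_cap_differentiable_of_expansions:
  assumes p: "sets p = sets borel" "finite_measure p" "log_expansion p a cp"
    and n: "sets n = sets borel" "finite_measure n" "log_expansion n a cn"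
    and u: "\<And>x. log_integrable p x \<Longrightarrow> log_integrable n x \<Longrightarrow> u x = positive_potential p x - positive_potential n x"
  shows "weak_cap_differentiable u a"
proof (rule weak_cap_differentiableI)
  define c where "c = cp - cn"
  have lp: "log_integrable p a" and ln: "log_integrable n a" using p(3) n(3) by (auto simp: log_expansion_def)
  have ua: "u a = positive_potential p a - positive_potential n a" by (rule u[OF lp ln])
  fix e :: real assume e0: "0 < e"
  \<comment> \<open>a factor \<open>4\<close> is lost below and another factor \<open>2\<close> in comparing \<open>phi r\<close> with the capacity of the ball\<close>
  define e' where "e' = e / 8"
  have e: "0 < e'" using e0 by (simp add: e'_def)
  obtain rp where rp: "0 < rp" "\<And>r. 0 < r \<Longrightarrow> r < rp \<Longrightarrow> log_approximation p a cp e' r"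
    using p(3) e unfolding log_expansion_def by blast
  obtain rn where rn: "0 < rn" "\<And>r. 0 < r \<Longrightarrow> r < rn \<Longrightarrow> log_approximation n a cn e' r"
    using n(3) e unfolding log_expansion_def by blast
  define r0 where "r0 = min (min rp rn) (min (exp (- 128)) (1 / 4))"
  show "\<exists>r0>0. \<forall>r. 0 < r \<and> r < r0 \<longrightarrow> (\<forall>t>0. ennreal t * wiener_cap {x \<in> ball a r.
          \<bar>u x - u a - ((- Re c) * (Re x - Re a) + Im c * (Im x - Im a))\<bar> > t} \<le> ennreal (e * r) * wiener_cap (ball a r))"
  proof (rule exI[of _ r0], intro conjI allI impI)
    show "0 < r0" using rp(1) rn(1) by (simp add: r0_def)
    fix r t :: real assume r: "0 < r \<and> r < r0" and t: "0 < t"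
    have r': "0 < r" "r < rp" "r < rn" "r < exp (- 128)" "4 * r \<le> 1" using r by (auto simp: r0_def)
    obtain \<tau> where \<tau>: "sets \<tau> = sets borel" "finite_measure \<tau>" "emeasure \<tau> (- ball a (2 * r)) = 0"
        "measure \<tau> UNIV \<le> e' * phi r"
      and \<tau>x: "\<And>x. x \<in> ball a r \<Longrightarrow> (log_integrable p x \<or> local_potential \<tau> (4 * r) x = \<infinity>) \<and>
              ennreal \<bar>positive_potential p x - positive_potential p a + Re (cp * (x - a))\<bar>
                \<le> ennreal (e' * r) + local_potential \<tau> (4 * r) x"
      using rp(2)[OF r'(1,2)] unfolding log_approximation_def by (elim exE conjE) (rule that, blast+)
    obtain \<kappa> where \<kappa>: "sets \<kappa> = sets borel" "finite_measure \<kappa>" "emeasure \<kappa> (- ball a (2 * r)) = 0"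
        "measure \<kappa> UNIV \<le> e' * phi r"
      and \<kappa>x: "\<And>x. x \<in> ball a r \<Longrightarrow> (log_integrable n x \<or> local_potential \<kappa> (4 * r) x = \<infinity>) \<and>
              ennreal \<bar>positive_potential n x - positive_potential n a + Re (cn * (x - a))\<bar>
                \<le> ennreal (e' * r) + local_potential \<kappa> (4 * r) x"
      using rn(2)[OF r'(1,3)] unfolding log_approximation_def by (elim exE conjE) (rule that, blast+)
    define rem where "rem x = \<bar>u x - u a - ((- Re c) * (Re x - Re a) + Im c * (Im x - Im a))\<bar>" for x
    define A where "A = {x \<in> ball a r. rem x > t}"
    \<comment> \<open>where one of the two potentials diverges, so does \<open>P\<close>, and the default value of \<open>u\<close> does no harm\<close>
    define P where "P x = local_potential \<tau> (4 * r) x + local_potential \<kappa> (4 * r) x" for x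
    have rem_le: "ennreal (rem x) \<le> ennreal (2 * e' * r) + P x" if x: "x \<in> ball a r" for x
    proof (cases "log_integrable p x \<and> log_integrable n x")
      case True
      define Dp where "Dp = positive_potential p x - positive_potential p a + Re (cp * (x - a))"
      define Dn where "Dn = positive_potential n x - positive_potential n a + Re (cn * (x - a))"
      have "u x - u a - ((- Re c) * (Re x - Re a) + Im c * (Im x - Im a)) = Dp - Dn"
        using u[of x] True ua by (simp add: Dp_def Dn_def c_def algebra_simps)
      then have "rem x \<le> \<bar>Dp\<bar> + \<bar>Dn\<bar>" unfolding rem_def by linarith
      then have "ennreal (rem x) \<le> ennreal (\<bar>Dp\<bar> + \<bar>Dn\<bar>)" by (rule ennreal_leI)
      also have "\<dots> = ennreal \<bar>Dp\<bar> + ennreal \<bar>Dn\<bar>" by (rule ennreal_plus) auto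
      also have "\<dots> \<le> (ennreal (e' * r) + local_potential \<tau> (4 * r) x) + (ennreal (e' * r) + local_potential \<kappa> (4 * r) x)"
        unfolding Dp_def Dn_def using \<tau>x[OF x] \<kappa>x[OF x] by (intro add_mono) auto
      also have "\<dots> = (ennreal (e' * r) + ennreal (e' * r)) + P x" by (simp add: P_def add_ac)
      also have "ennreal (e' * r) + ennreal (e' * r) = ennreal (2 * e' * r)"
        using e r' by (simp add: ennreal_plus[symmetric] del: ennreal_plus)
      finally show ?thesis .
    next
      case False
      then have "local_potential \<tau> (4 * r) x = \<infinity> \<or> local_potential \<kappa> (4 * r) x = \<infinity>"
        using \<tau>x[OF x] \<kappa>x[OF x] by blast
      then have "P x = \<infinity>" unfolding P_def by (elim disjE) simp_all
      then show ?thesis by simp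
    qed
    have cap: "ennreal (phi r) \<le> ennreal (2 * r) * wiener_cap (ball a r)"
    proof -
      have "r \<le> exp (-1)" using r'(4) by (rule order_trans[OF less_imp_le]) simp
      then have "phi r = r * (1 / ln (1 / r))" using r' by (simp add: phi_def del: ln_div)
      also have "\<dots> = (2 * r) * (1 / (2 * ln (1 / r)))" by simp
      finally have eq: "phi r = (2 * r) * (1 / (2 * ln (1 / r)))" .
      have "ennreal (phi r) = ennreal (2 * r) * ennreal (1 / (2 * ln (1 / r)))"
        unfolding eq by (rule ennreal_mult') (use r' in simp)
      also have "\<dots> \<le> ennreal (2 * r) * wiener_cap (ball a r)"
        by (intro mult_left_mono wiener_cap_ball_ge r') simp
      finally show ?thesis .
    qed
    have "ennreal t * wiener_cap A \<le> ennreal (e * r) * wiener_cap (ball a r)"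
    proof (rule mult_wiener_cap_le)
      fix K \<nu> assume K: "compact K" "K \<subseteq> A" and \<nu>: "cap_admissible K \<nu>"
      have Kb: "K \<subseteq> ball a r" using K(2) by (auto simp: A_def)
      show "ennreal t * emeasure \<nu> UNIV \<le> ennreal (e * r) * wiener_cap (ball a r)"
      proof (cases "t \<le> 4 * e' * r")
        case True
        have "4 * e' * r \<le> e * r" using e0 r' by (simp add: e'_def)
        then have "ennreal t \<le> ennreal (e * r)" using True by (intro ennreal_leI) linarith
        then show ?thesis by (intro mult_mono cap_admissible_mass_le[OF \<nu> K(1) Kb]) auto
      next
        case False
        have \<nu>s: "sets \<nu> = sets borel" and \<nu>K: "emeasure \<nu> (- K) = 0"
          using \<nu> by (auto simp: cap_admissible_def)
        note \<nu>s[measurable_cong] \<tau>(1)[measurable_cong] \<kappa>(1)[measurable_cong]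
        interpret \<tau>: finite_measure \<tau> by fact
        interpret \<kappa>: finite_measure \<kappa> by fact
        have sp: "space \<nu> = UNIV" using sets_eq_imp_space_eq[OF \<nu>s] by simp
        have "- K \<in> sets \<nu>" unfolding \<nu>s using K(1) by (intro borel_open) (auto simp: compact_imp_closed)
        then have "- K \<in> null_sets \<nu>" using \<nu>K by (intro null_setsI)
        from AE_not_in[OF this] have AE_K: "AE x in \<nu>. x \<in> K" by simp
        have pt: "ennreal (t / 2) \<le> P x" if x: "x \<in> K" for x
        proof (cases "P x = \<infinity>")
          case False
          then obtain q where q: "0 \<le> q" "P x = ennreal q" by (cases "P x") auto
          have xb: "x \<in> ball a r" "t < rem x" using x K(2) by (auto simp: A_def)
          have "ennreal (rem x) \<le> ennreal (2 * e' * r + q)"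
            using rem_le[OF xb(1)] q e r' by (simp add: ennreal_plus)
          then have "rem x \<le> 2 * e' * r + q" using q e r' by (subst (asm) ennreal_le_iff) auto
          then show ?thesis using xb(2) \<open>\<not> t \<le> 4 * e' * r\<close> unfolding q(2) by (intro ennreal_leI) linarith
        qed simp
        have "ennreal (t / 2) * emeasure \<nu> UNIV = (\<integral>\<^sup>+ x. ennreal (t / 2) \<partial>\<nu>)" by (simp add: sp)
        also have "\<dots> \<le> (\<integral>\<^sup>+ x. P x \<partial>\<nu>)"
          by (rule nn_integral_mono_AE) (use AE_K pt in auto)
        also have "\<dots> = (\<integral>\<^sup>+ x. local_potential \<tau> (4 * r) x \<partial>\<nu>) + (\<integral>\<^sup>+ x. local_potential \<kappa> (4 * r) x \<partial>\<nu>)"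
          unfolding P_def local_potential_def by (rule nn_integral_add) measurable
        also have "\<dots> \<le> emeasure \<tau> UNIV + emeasure \<kappa> UNIV"
          using \<tau> \<kappa> by (intro add_mono cap_admissible_local_potential_le[OF \<nu> K(1) Kb r'(1) r'(5)])
        also have "\<dots> \<le> ennreal (e' * phi r) + ennreal (e' * phi r)"
          using \<tau>(4) \<kappa>(4) by (intro add_mono) (simp_all add: \<tau>.emeasure_eq_measure \<kappa>.emeasure_eq_measure ennreal_leI)
        also have "\<dots> = ennreal (2 * e' * phi r)"
          using e by (simp add: ennreal_plus[symmetric] del: ennreal_plus)
        finally have "ennreal 2 * (ennreal (t / 2) * emeasure \<nu> UNIV) \<le> ennreal 2 * ennreal (2 * e' * phi r)"
          by (rule mult_left_mono) simp
        moreover have "ennreal 2 * (ennreal (t / 2) * emeasure \<nu> UNIV) = ennreal t * emeasure \<nu> UNIV"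
        proof -
          have "ennreal 2 * ennreal (t / 2) = ennreal t" using t by (subst ennreal_mult[symmetric]) auto
          then show ?thesis by (simp only: mult.assoc[symmetric])
        qed
        moreover have "ennreal 2 * ennreal (2 * e' * phi r) = ennreal (4 * e') * ennreal (phi r)"
          using e by (simp only: ennreal_mult[symmetric] phi_nonneg) (simp add: ennreal_mult[symmetric] del: ennreal_numeral)
        ultimately have "ennreal t * emeasure \<nu> UNIV \<le> ennreal (4 * e') * ennreal (phi r)" by simp
        also have "\<dots> \<le> ennreal (4 * e') * (ennreal (2 * r) * wiener_cap (ball a r))"
          by (intro mult_left_mono cap) simp
        also have "\<dots> = ennreal (e * r) * wiener_cap (ball a r)"
        proof -
          have "ennreal (4 * e') * ennreal (2 * r) = ennreal (e * r)"
            using e r' by (subst ennreal_mult[symmetric]) (auto simp: e'_def)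
          then show ?thesis by (simp only: mult.assoc[symmetric])
        qed
        finally show ?thesis .
      qed
    qed
    then show "ennreal t * wiener_cap {x \<in> ball a r.
          \<bar>u x - u a - ((- Re c) * (Re x - Re a) + Im c * (Im x - Im a))\<bar> > t} \<le> ennreal (e * r) * wiener_cap (ball a r)"
      unfolding A_def rem_def .
  qed
qed

lemma log_expansion_almost_everywhere:
  assumes M: "sets M = sets borel" "finite_measure M" and z: "log_integrable M z"
  shows "phi_content {a. \<not> (\<exists>c. log_expansion M a c)} = 0"
proof -
  note far = log_integrable_imp_far[OF M z]
  define E where "E N = growth_set M (real N)" for N
  define B where "B N = {a \<in> E N. \<not> (\<exists>c. (cauchy_tail M a \<longlongrightarrow> c) (at_right 0))}" for N
  define C where "C N = {a \<in> E N. \<not> (\<forall>e>0. \<exists>d>0. \<forall>r. 0 < r \<and> r \<le> d \<longrightarrow> measure M (ball a r - E N) \<le> e * phi r)}" for N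
  have E: "closed (E N)" for N unfolding E_def by (rule closed_growth_set[OF M])
  have growth: "measure M (ball b r) \<le> real N * phi r" if "b \<in> E N" "0 < r" for b r N
    using growth_setD that unfolding E_def by blast
  have B: "phi_content (B N) = 0" for N
    unfolding B_def by (rule principal_values_exist[OF M, of "real N"]) (use growth in auto)
  have C: "phi_content (C N) = 0" for N
    unfolding C_def by (rule density_outside_closed[OF M E])
  have "phi_content (- (\<Union>N. E N)) = 0" unfolding E_def by (rule growth_sets_exhaust[OF M])
  moreover have "phi_content (\<Union>N. B N \<union> C N) = 0"
    by (intro phi_content_UN_null phi_content_Un_null B C)
  ultimately have "phi_content (- (\<Union>N. E N) \<union> (\<Union>N. B N \<union> C N)) = 0" by (rule phi_content_Un_null)
  moreover have "{a. \<not> (\<exists>c. log_expansion M a c)} \<subseteq> - (\<Union>N. E N) \<union> (\<Union>N. B N \<union> C N)"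
  proof (rule subsetI, rule ccontr)
    fix a assume a: "a \<in> {a. \<not> (\<exists>c. log_expansion M a c)}" and "a \<notin> - (\<Union>N. E N) \<union> (\<Union>N. B N \<union> C N)"
    then obtain N where N: "a \<in> E N" "a \<notin> B N" "a \<notin> C N" by blast
    then obtain c where c: "(cauchy_tail M a \<longlongrightarrow> c) (at_right 0)" unfolding B_def by blast
    have dens: "\<forall>e>0. \<exists>d>0. \<forall>r. 0 < r \<and> r \<le> d \<longrightarrow> measure M (ball a r - E N) \<le> e * phi r"
      using N unfolding C_def by blast
    have "log_expansion M a c"
      by (rule log_expansion_at_good_point[OF M far of_nat_0_le_iff E N(1) growth c dens])
    then show False using a by blast
  qed
  ultimately show ?thesis by (rule phi_content_null_subset)
qed

lemma weak_cap_differentiable_zero: "weak_cap_differentiable (\<lambda>_. 0) a"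
proof (rule weak_cap_differentiableI)
  show "\<exists>r0>0. \<forall>r. 0 < r \<and> r < r0 \<longrightarrow> (\<forall>t>0. ennreal t * wiener_cap {x \<in> ball a r.
          \<bar>0 - 0 - (0 * (Re x - Re a) + 0 * (Im x - Im a))\<bar> > t} \<le> ennreal (e * r) * wiener_cap (ball a r))" for e
  proof (rule exI[of _ 1], intro conjI allI impI)
    fix r t :: real assume t: "0 < t"
    show "ennreal t * wiener_cap {x \<in> ball a r. \<bar>0 - 0 - (0 * (Re x - Re a) + 0 * (Im x - Im a))\<bar> > t}
        \<le> ennreal (e * r) * wiener_cap (ball a r)"
    proof (rule mult_wiener_cap_le)
      fix K \<nu> assume "K \<subseteq> {x \<in> ball a r. \<bar>0 - 0 - (0 * (Re x - Re a) + 0 * (Im x - Im a))\<bar> > t}" "cap_admissible K \<nu>"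
      then have "K = {}" "cap_admissible K \<nu>" using t by auto
      then have "emeasure \<nu> UNIV = 0" by (simp add: cap_admissible_def)
      then show "ennreal t * emeasure \<nu> UNIV \<le> ennreal (e * r) * wiener_cap (ball a r)" by simp
    qed
  qed simp
qed

theorem theorem3:
  fixes \<mu> :: "complex set \<Rightarrow> real"
  assumes "finite_signed_borel_measure \<mu>"
  shows "hausdorff_measure phi {a. \<not> weak_cap_differentiable (log_potential \<mu>) a} = 0 \<and>
    ((\<exists>z. log_potential_converges \<mu> z) \<longrightarrow>
      hausdorff_measure phi {a. \<not> log_potential_converges \<mu> a} = 0)"
proof (cases "\<exists>z. log_potential_converges \<mu> z")
  case False
  then have "log_potential \<mu> = (\<lambda>_. 0)" by (auto simp: log_potential_def)
  then have "{a. \<not> weak_cap_differentiable (log_potential \<mu>) a} = {}"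
    using weak_cap_differentiable_zero by simp
  then show ?thesis using False hausdorff_measure_phi_null[of "{}"] by simp
next
  case True
  then obtain z where z: "log_integrable (pos_variation \<mu>) z" "log_integrable (neg_variation \<mu>) z"
    by (auto simp: log_potential_converges_def)
  have p: "sets (pos_variation \<mu>) = sets borel" "finite_measure (pos_variation \<mu>)"
    using finite_pos_variation[OF assms] by simp_all
  have n: "sets (neg_variation \<mu>) = sets borel" "finite_measure (neg_variation \<mu>)"
    using finite_pos_variation[OF finite_signed_borel_measure_uminus[OF assms]] by (simp_all add: neg_variation_def)
  define Z where "Z = {a. \<not> (\<exists>c. log_expansion (pos_variation \<mu>) a c)} \<union> {a. \<not> (\<exists>c. log_expansion (neg_variation \<mu>) a c)}"
  have Z: "phi_content Z = 0"
    unfolding Z_def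
    by (intro phi_content_Un_null log_expansion_almost_everywhere[OF p z(1)] log_expansion_almost_everywhere[OF n z(2)])
  have "{a. \<not> weak_cap_differentiable (log_potential \<mu>) a} \<subseteq> Z"
  proof (rule subsetI, rule ccontr)
    fix a assume a: "a \<in> {a. \<not> weak_cap_differentiable (log_potential \<mu>) a}" and "a \<notin> Z"
    then obtain cp cn where "log_expansion (pos_variation \<mu>) a cp" "log_expansion (neg_variation \<mu>) a cn"
      unfolding Z_def by blast
    then have "weak_cap_differentiable (log_potential \<mu>) a"
      by (rule weak_cap_differentiable_of_expansions[OF p _ n])
         (simp add: log_potential_def log_potential_converges_def positive_potential_def)
    then show False using a by simp
  qed
  moreover have "{a. \<not> log_potential_converges \<mu> a} \<subseteq> Z"
    unfolding Z_def log_expansion_def log_potential_converges_def by blast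
  ultimately show ?thesis
    using Z phi_content_null_subset hausdorff_measure_phi_null by meson
qed

end
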